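(* Let $d\in\mathbb{N}$, $\alpha\in(0,1)$ and $\epsilon>0$. There exists a pair $(K,K')$ of regular Cantor sets in $\mathbb{R}^d$ which has $\mathcal{C}^{1+\alpha}$ stable intersection and satisfies $\dim_{\mathrm{HD}}(K)<\epsilon$. Moreover, for every $\delta>0$ the pair $(K,K')$ with these properties can be chosen so that, in addition, $K$ and $K'$ are affine and each of them is $\delta$-close (in the $\mathcal{C}^{1+\alpha}$ sense) to some conformal (indeed to some homothetical) Cantor set.
   Context: $\dim_{\mathrm{HD}}$ is Hausdorff dimension. For a linear map $A$, $\|A\|_{op}=\sup_{|v|=1}|Av|$ and $m(A)=\inf_{|v|=1}|Av|$. Regular Cantor sets. A ($\mathcal{C}^{1+\alpha}$) regular Cantor set $K$ in $\mathbb{R}^d$ is given by the following data: a finite alphabet $\mathfrak{A}$ and a set $\mathfrak{B}\subset\mathfrak{A}\times\mathfrak{A}$ of admissible pairs; for each $a\in\mathfrak{A}$ a compact connected set $G(a)\subset\mathbb{R}^d$, these sets being pairwise disjoint; and a $\mathcal{C}^{1+\alpha}$ map $g:V\to\mathbb{R}^d$ on an open neighborhood $V$ of $\bigsqcup_a G(a)$ such that: $(a,b)\in\mathfrak{B}$ implies $G(b)\subset g(G(a))$, and otherwise $G(b)\cap g(G(a))=\emptyset$; each $g|_{G(a)}$ extends to a $\mathcal{C}^{1+\alpha}$ embedding (with $\mathcal{C}^{1+\alpha}$ inverse) of an open neighborhood of $G(a)$; there is $\mu\in(0,1)$ with $m(Dg(x))>\mu^{-1}$ for all $x\in V$; the subshift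 $\Sigma=\{(a_0,a_1,\dots)\in\mathfrak{A}^{\mathbb{N}}:(a_i,a_{i+1})\in\mathfrak{B}\ \forall i\ge0\}$ (the symbolic type) with the left shift is topologically mixing. Then $K=\bigcap_{n\ge0}g^{-n}\big(\bigsqcup_a G(a)\big)$, a nonempty, perfect, compact, totally disconnected set. A Cantor set is always considered together with its data. Types. $K$ is affine if $g$ is an expanding affine map on each $G(a)$; homothetical if $Dg(x)/\|Dg(x)\|_{op}=\mathrm{Id}$ for all $x\in K$; conformal if $Dg(x)/\|Dg(x)\|_{op}\in \mathrm{O}(d)$ for all $x\in K$; bunched if there is $N\in\mathbb{N}$ with $\|Dg^N(x)\|_{op}\, m(Dg^N(x))^{-1}\mu^{\alpha N}<1$ for all $x\in K$. Closeness. Two $\mathcal{C}^{r}$ diffeomorphisms $f_1,f_2$ between open subsets of $\mathbb{R}^d$ are $\mathcal{C}^r$-close if there is a diffeomorphism $\phi:\mathrm{Dom}(f_1)\to\mathrm{Dom}(f_2)$ that is $\mathcal{C}^r$-close to the identity and such that $f_2\circ \phi$ is $\mathcal{C}^r$-close to $f_1$. Let $G^*(a)$ denote a small open neighborhood of $G(a)$ (of a fixed small radius) such that $g$ extends to a neighborhood of $\overline{G^*(a)}$ and the sets $\overline{G^*(a)}$, $a\in\mathfrak{A}$, together with $g$ satisfy the conditions in the definition of a regular Cantor set with $\overline{G^*(a)}$ in place of $G(a)$, that is: the sets $\overline{G^*(a)}$ are pairwise disjoint; $(a,b)\in\mathfrak{B}$ implies $\overline{G^*(b)}\subset g(\overline{G^*(a)})$,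 and otherwise $\overline{G^*(b)}\cap g(\overline{G^*(a)})=\emptyset$; $g$ restricted to each $\overline{G^*(a)}$ extends to a $\mathcal{C}^{1+\alpha}$ embedding (with $\mathcal{C}^{1+\alpha}$ inverse) of an open neighborhood of $\overline{G^*(a)}$; and $m(Dg)>\mu^{-1}$ there. A regular Cantor set $\tilde K$ (bunched) with the same symbolic type as $K$, generated by $\tilde g$ with pieces $\tilde G(a)$, is $\delta$-close to $K$ in the $\mathcal{C}^{1+\alpha}$ sense if $\tilde g|_{\tilde G^*(a)}$ is $\delta$-close to $g|_{G^*(a)}$ in this $\mathcal{C}^{1+\alpha}$ topology for all $a\in\mathfrak{A}$. Stable intersection. $(K,K')$ has $\mathcal{C}^{1+\alpha}$ stable intersection if $\tilde K\cap\tilde K'\neq\emptyset$ for all pairs $(\tilde K,\tilde K')$ of Cantor sets sufficiently $\mathcal{C}^{1+\alpha}$-close to $K$ and $K'$ respectively. *)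

theory Defs
  imports "HOL-Analysis.Analysis"
begin

subsection \<open>Hausdorff dimension\<close>

text \<open>\<open>diameter\<close> is only meaningful on bounded sets, hence the boundedness of the covering sets.\<close>

definition hausdorff_premeasure :: "real \<Rightarrow> real \<Rightarrow> 'a::metric_space set \<Rightarrow> ennreal" where
  "hausdorff_premeasure s \<delta> A =
     (INF U \<in> {U :: nat \<Rightarrow> 'a set. A \<subseteq> (\<Union>i. U i) \<and> (\<forall>i. bounded (U i) \<and> diameter (U i) \<le> \<delta>)}.
        \<Sum>i. ennreal (diameter (U i) powr s))"

definition hausdorff_measure :: "real \<Rightarrow> 'a::metric_space set \<Rightarrow> ennreal" where
  "hausdorff_measure s A = (SUP \<delta> \<in> {0<..}. hausdorff_premeasure s \<delta> A)"

text \<open>Only \<open>s > 0\<close> is used, since \<open>0 powr 0 = 0\<close> makes \<open>hausdorff_measure 0\<close> differ from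
  the counting measure; this does not affect the infimum.\<close>

definition hausdorff_dim :: "'a::metric_space set \<Rightarrow> ereal" where
  "hausdorff_dim A = Inf (ereal ` {s. 0 < s \<and> hausdorff_measure s A = 0})"

subsection \<open>Maps of class $C^{1+\alpha}$\<close>

abbreviation Deriv :: "('a::real_normed_vector \<Rightarrow> 'b::real_normed_vector) \<Rightarrow> 'a \<Rightarrow> 'a \<Rightarrow> 'b" where
  "Deriv f x \<equiv> frechet_derivative f (at x)"

definition conorm :: "('a::real_normed_vector \<Rightarrow> 'b::real_normed_vector) \<Rightarrow> real" where
  "conorm A = (INF v \<in> sphere 0 1. norm (A v))"

definition C1_holder_on ::
    "real \<Rightarrow> 'a::euclidean_space set \<Rightarrow> ('a \<Rightarrow> 'b::euclidean_space) \<Rightarrow> bool" where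
  "C1_holder_on \<alpha> U f \<longleftrightarrow>
     (\<forall>x\<in>U. f differentiable (at x)) \<and>
     (\<forall>x\<in>U. \<exists>e>0. \<exists>C. \<forall>y\<in>ball x e \<inter> U. \<forall>z\<in>ball x e \<inter> U.
        onorm (\<lambda>v. Deriv f y v - Deriv f z v) \<le> C * dist y z powr \<alpha>)"

definition C1_holder_diffeo ::
    "real \<Rightarrow> 'a::euclidean_space set \<Rightarrow> 'a set \<Rightarrow> ('a \<Rightarrow> 'a) \<Rightarrow> bool" where
  "C1_holder_diffeo \<alpha> U W f \<longleftrightarrow> open U \<and> open W \<and>
     (\<exists>k. homeomorphism U W f k \<and> C1_holder_on \<alpha> U f \<and> C1_holder_on \<alpha> W k)"

text \<open>The $C^{1+\alpha}$ norm of \<open>f\<close> on \<open>U\<close>, i.e. the maximum of $\sup |f|$, $\sup \|Df\|_{op}$ and the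
  global \<open>\<alpha>\<close>-Hoelder seminorm of $Df$, is at most \<open>B\<close>.\<close>

definition C1_holder_norm_le ::
    "real \<Rightarrow> 'a::euclidean_space set \<Rightarrow> ('a \<Rightarrow> 'b::euclidean_space) \<Rightarrow> real \<Rightarrow> bool" where
  "C1_holder_norm_le \<alpha> U f B \<longleftrightarrow>
     (\<forall>x\<in>U. f differentiable (at x) \<and> norm (f x) \<le> B \<and> onorm (Deriv f x) \<le> B) \<and>
     (\<forall>x\<in>U. \<forall>y\<in>U. onorm (\<lambda>v. Deriv f x v - Deriv f y v) \<le> B * dist x y powr \<alpha>)"

definition C1_holder_close ::
    "real \<Rightarrow> real \<Rightarrow> 'a::euclidean_space set \<Rightarrow> ('a \<Rightarrow> 'a) \<Rightarrow> 'a set \<Rightarrow> ('a \<Rightarrow> 'a) \<Rightarrow> bool" where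
  "C1_holder_close \<alpha> \<delta> U\<^sub>1 f\<^sub>1 U\<^sub>2 f\<^sub>2 \<longleftrightarrow>
     (\<exists>\<phi>. C1_holder_diffeo \<alpha> U\<^sub>1 U\<^sub>2 \<phi> \<and>
          C1_holder_norm_le \<alpha> U\<^sub>1 (\<lambda>x. \<phi> x - x) \<delta> \<and>
          C1_holder_norm_le \<alpha> U\<^sub>1 (\<lambda>x. f\<^sub>2 (\<phi> x) - f\<^sub>1 x) \<delta>)"

subsection \<open>Symbolic dynamics\<close>

definition subshift :: "nat set \<Rightarrow> (nat \<times> nat) set \<Rightarrow> (nat \<Rightarrow> nat) set" where
  "subshift A B = {s. \<forall>i. s i \<in> A \<and> (s i, s (Suc i)) \<in> B}"

definition shift :: "(nat \<Rightarrow> 'a) \<Rightarrow> nat \<Rightarrow> 'a" where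
  "shift s = (\<lambda>i. s (Suc i))"

definition topologically_mixing :: "'a::topological_space set \<Rightarrow> ('a \<Rightarrow> 'a) \<Rightarrow> bool" where
  "topologically_mixing X T \<longleftrightarrow>
     (\<forall>U W. openin (top_of_set X) U \<and> U \<noteq> {} \<and> openin (top_of_set X) W \<and> W \<noteq> {} \<longrightarrow>
        (\<exists>N. \<forall>n\<ge>N. (T ^^ n) ` U \<inter> W \<noteq> {}))"

subsection \<open>Regular Cantor sets\<close>

text \<open>The generating map is a total function of which only the values on \<open>nhd\<close>
  (the open set $V$) matter; \<open>rate\<close> is the constant $\mu$.\<close>

record 'a cantor_data =
  alphabet :: "nat set"
  admissible :: "(nat \<times> nat) set"
  piece :: "nat \<Rightarrow> 'a set"
  nhd :: "'a set"
  gen :: "'a \<Rightarrow> 'a"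
  rate :: real

abbreviation symbolic_type :: "'a cantor_data \<Rightarrow> (nat \<Rightarrow> nat) set" where
  "symbolic_type K \<equiv> subshift (alphabet K) (admissible K)"

text \<open>The last clause but one excludes the degenerate cases in which the Cantor set would be
  empty or a single point rather than perfect.\<close>

definition regular_cantor :: "real \<Rightarrow> 'a::euclidean_space cantor_data \<Rightarrow> bool" where
  "regular_cantor \<alpha> K \<longleftrightarrow>
     finite (alphabet K) \<and> admissible K \<subseteq> alphabet K \<times> alphabet K \<and>
     (\<forall>a\<in>alphabet K. compact (piece K a) \<and> connected (piece K a) \<and> piece K a \<noteq> {}) \<and>
     disjoint_family_on (piece K) (alphabet K) \<and>
     open (nhd K) \<and> (\<Union>a\<in>alphabet K. piece K a) \<subseteq> nhd K \<and>
     C1_holder_on \<alpha> (nhd K) (gen K) \<and>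
     (\<forall>a\<in>alphabet K. \<forall>b\<in>alphabet K.
        if (a, b) \<in> admissible K then piece K b \<subseteq> gen K ` piece K a
        else piece K b \<inter> gen K ` piece K a = {}) \<and>
     (\<forall>a\<in>alphabet K. \<exists>U W h. piece K a \<subseteq> U \<and> C1_holder_diffeo \<alpha> U W h \<and>
        (\<forall>x\<in>piece K a. h x = gen K x)) \<and>
     0 < rate K \<and> rate K < 1 \<and> (\<forall>x\<in>nhd K. conorm (Deriv (gen K) x) > inverse (rate K)) \<and>
     (\<exists>s\<in>symbolic_type K. \<exists>t\<in>symbolic_type K. s \<noteq> t) \<and>
     topologically_mixing (symbolic_type K) shift"

definition cantor_set :: "'a cantor_data \<Rightarrow> 'a set" where
  "cantor_set K = (\<Inter>n. (gen K ^^ n) -` (\<Union>a\<in>alphabet K. piece K a))"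

definition affine_cantor :: "'a::euclidean_space cantor_data \<Rightarrow> bool" where
  "affine_cantor K \<longleftrightarrow>
     (\<forall>a\<in>alphabet K. \<exists>A c. linear A \<and> conorm A > 1 \<and> (\<forall>x\<in>piece K a. gen K x = A x + c))"

definition homothetical_cantor :: "'a::euclidean_space cantor_data \<Rightarrow> bool" where
  "homothetical_cantor K \<longleftrightarrow>
     (\<forall>x\<in>cantor_set K. (\<lambda>v. Deriv (gen K) x v /\<^sub>R onorm (Deriv (gen K) x)) = id)"

definition conformal_cantor :: "'a::euclidean_space cantor_data \<Rightarrow> bool" where
  "conformal_cantor K \<longleftrightarrow>
     (\<forall>x\<in>cantor_set K.
        orthogonal_transformation (\<lambda>v. Deriv (gen K) x v /\<^sub>R onorm (Deriv (gen K) x)))"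

definition bunched_cantor :: "real \<Rightarrow> 'a::euclidean_space cantor_data \<Rightarrow> bool" where
  "bunched_cantor \<alpha> K \<longleftrightarrow>
     (\<exists>N. \<forall>x\<in>cantor_set K.
        onorm (Deriv (gen K ^^ N) x) * inverse (conorm (Deriv (gen K ^^ N) x))
          * rate K powr (\<alpha> * real N) < 1)"

subsection \<open>Closeness and stable intersection\<close>

definition star_piece :: "real \<Rightarrow> 'a::euclidean_space cantor_data \<Rightarrow> nat \<Rightarrow> 'a set" where
  "star_piece r K a = (\<Union>x\<in>piece K a. ball x r)"

definition star_radius :: "real \<Rightarrow> real \<Rightarrow> 'a::euclidean_space cantor_data \<Rightarrow> bool" where
  "star_radius \<alpha> r K \<longleftrightarrow>
     0 < r \<and> regular_cantor \<alpha> (K\<lparr>piece := \<lambda>a. closure (star_piece r K a)\<rparr>)"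

text \<open>\<open>L\<close> is \<open>\<delta>\<close>-close to \<open>K\<close>, the neighbourhoods $G^*(a)$ being taken of radius \<open>r\<close>.\<close>

definition cantor_close ::
    "real \<Rightarrow> real \<Rightarrow> real \<Rightarrow> 'a::euclidean_space cantor_data \<Rightarrow> 'a cantor_data \<Rightarrow> bool" where
  "cantor_close \<alpha> r \<delta> K L \<longleftrightarrow>
     star_radius \<alpha> r K \<and> star_radius \<alpha> r L \<and>
     regular_cantor \<alpha> L \<and> bunched_cantor \<alpha> L \<and>
     alphabet L = alphabet K \<and> symbolic_type L = symbolic_type K \<and>
     (\<forall>a\<in>alphabet K. C1_holder_close \<alpha> \<delta> (star_piece r K a) (gen K) (star_piece r L a) (gen L))"

text \<open>The radius is fixed before \<open>\<delta>\<close> and the perturbations, and may be any sufficiently small one.\<close>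

definition stable_intersection ::
    "real \<Rightarrow> 'a::euclidean_space cantor_data \<Rightarrow> 'a cantor_data \<Rightarrow> bool" where
  "stable_intersection \<alpha> K K' \<longleftrightarrow>
     (\<forall>\<^sub>F r in at_right 0. \<exists>\<delta>>0. \<forall>L L'.
        cantor_close \<alpha> r \<delta> K L \<and> cantor_close \<alpha> r \<delta> K' L' \<longrightarrow> cantor_set L \<inter> cantor_set L' \<noteq> {})"

end

theory Submission
  imports Defs
begin

text \<open>
  Write \<open>d\<close> for the dimension and \<open>I\<close> for the identity.  The set \<open>K'\<close> fills a large cube up to
  thin gaps: its pieces are cubes centred at points of \<open>4\<int>\<^sup>d\<close>, separated by gaps of width \<open>2\<gamma>\<close>, and
  a homothety of factor \<open>\<lambda>\<close> expands each of them onto the whole cube.  The set \<open>K\<close> lives in the unit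
  ball, which is smaller than a piece of \<open>K'\<close>.  It has \<open>N\<close> tiny pieces, placed along the diagonal,
  with derivatives \<open>\<lambda>(I + \<theta>Y\<^sub>i)\<close>.  The number \<open>N\<close> is fixed before \<open>\<lambda>\<close>, so a large \<open>\<lambda>\<close> makes the
  dimension of \<open>K\<close> small, and \<open>\<theta>\<close> can be as small as closeness to the homothetical system
  \<open>\<theta> = 0\<close> demands.

  A common point is found by renormalization.  A placement is a map \<open>h\<close> of the unit ball into the
  large cube; it carries the first set into the region of the second.  If \<open>f\<close> is an inverse branch of
  the first system and \<open>h \<circ> f\<close> maps the ball into one piece of the second system, whose expanding map
  is \<open>g'\<close>, then \<open>g' \<circ> h \<circ> f\<close> is again a placement.  An infinite chain of such steps that starts at
  the identity yields a nested sequence of compact sets and hence a point whose orbits under both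
  systems stay in their pieces (\<open>nested_intersection\<close>).  So it suffices to find a class of
  placements from which a step leads back into the class, and this for all small perturbations of the
  two systems.  The class consists of the \<open>h\<close> whose derivative is within \<open>\<kappa>\<close> of \<open>I\<close> and has a small
  Hoelder constant (\<open>near_identity\<close>).  Three things could destroy it.

  \<^item> The image of a piece of \<open>K\<close> may meet a gap of \<open>K'\<close>.  The pieces of \<open>K\<close> have well separated
    coordinates, so in each of the \<open>d\<close> coordinate directions at most one piece is hit by a gap; among
    \<open>d + 1\<close> pieces one is hit in no direction (\<open>exists_point_off_strips\<close>).

  \<^item> The linear part drifts: a perturbation multiplies it by an uncontrolled factor near \<open>I\<close> at each
    step, and for homothetical systems nothing would stop the accumulation.  This is why \<open>K\<close> is only
    nearly homothetical.  The \<open>Y\<^sub>i\<close> run through a finite net of the unit ball of matrices, each one being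
    used by \<open>d + 1\<close> pieces, and the choice of \<open>Y\<^sub>i\<close> close to \<open>(Dh(0) - I) / \<kappa>\<close> lowers the bound \<open>\<kappa>\<close>
    for the distance of the derivative to \<open>I\<close> by \<open>\<theta>/2\<close> (\<open>linear_correction\<close>).

  \<^item> Nonlinearity accumulates.  Here Hoelder continuity of the derivatives enters: precomposition with a
    contraction of ratio about \<open>1/\<lambda>\<close> multiplies the Hoelder constant of \<open>Dh\<close> by about
    \<open>\<lambda>\<^sup>-\<^sup>\<alpha>\<close>, so that errors of size \<open>\<delta>\<close> sum to a multiple of \<open>\<delta>\<close>.

  All the inequalities hold with room to spare in the affine case, and \<open>near_identity_step\<close> shows that
  they survive perturbation.  What the perturbed systems look like in terms of estimates is the content
  of \<open>perturbed_inverse_branch\<close> and \<open>perturbed_gen_on_piece\<close>.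
\<close>

section \<open>Hausdorff dimension of sets covered by their own contractions\<close>

text \<open>The cylinder cover of an attractor: a word of length \<open>n\<close> contributes the image of \<open>S\<close> under the
  composition of its \<open>n\<close> contractions.\<close>

lemma self_covered_imp_small_covers:
  fixes S :: "'a::euclidean_space set"
  assumes bdd: "\<And>x y. x \<in> S \<Longrightarrow> y \<in> S \<Longrightarrow> dist x y \<le> D" and "0 < q"
    and lip: "\<And>i x y. i < N \<Longrightarrow> dist (f i x) (f i y) \<le> q * dist x y"
    and cover: "S \<subseteq> (\<Union>i<N. f i ` S)"
  shows "\<exists>U :: nat \<Rightarrow> 'a set. S \<subseteq> (\<Union>i<N ^ n. U i) \<and>
           (\<forall>i<N ^ n. \<forall>x\<in>U i. \<forall>y\<in>U i. dist x y \<le> D * q ^ n)"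
proof (induction n)
  case 0
  then show ?case using bdd by (intro exI[of _ "\<lambda>_. S"]) auto
next
  case (Suc n)
  then obtain U where U: "S \<subseteq> (\<Union>i<N ^ n. U i)"
    and dU: "\<And>i x y. i < N ^ n \<Longrightarrow> x \<in> U i \<Longrightarrow> y \<in> U i \<Longrightarrow> dist x y \<le> D * q ^ n" by metis
  \<comment> \<open>The pair (first letter, remaining word) is coded by quotient and remainder.\<close>
  define U' where "U' k = f (k div N ^ n) ` U (k mod N ^ n)" for k
  have "x \<in> (\<Union>i<N ^ Suc n. U' i)" if x: "x \<in> S" for x
  proof -
    obtain a y where a: "a < N" "y \<in> S" "x = f a y" using cover x by blast
    then obtain b where b: "b < N ^ n" "y \<in> U b" using U by blast
    let ?k = "a * N ^ n + b"
    have "N ^ n \<noteq> 0" using b(1) by linarith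
    then have "?k div N ^ n = a" "?k mod N ^ n = b" using b(1) by simp_all
    then have "x \<in> U' ?k" using a b by (simp add: U'_def)
    moreover have "?k < N ^ Suc n"
    proof -
      have "?k < (a + 1) * N ^ n" using b by simp
      also have "\<dots> \<le> N * N ^ n" using a by (intro mult_right_mono) auto
      finally show ?thesis by simp
    qed
    ultimately show ?thesis by blast
  qed
  moreover have "dist x y \<le> D * q ^ Suc n" if k: "k < N ^ Suc n" and "x \<in> U' k" "y \<in> U' k" for k x y
  proof -
    obtain x' y' where xy: "x' \<in> U (k mod N ^ n)" "y' \<in> U (k mod N ^ n)"
      "x = f (k div N ^ n) x'" "y = f (k div N ^ n) y'"
      using \<open>x \<in> U' k\<close> \<open>y \<in> U' k\<close> by (auto simp: U'_def)
    have "0 < N ^ n" using k by (cases "N = 0") auto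
    then have "k div N ^ n < N" "k mod N ^ n < N ^ n"
      using k by (auto simp: less_mult_imp_div_less)
    then have "dist x y \<le> q * dist x' y'" "dist x' y' \<le> D * q ^ n"
      using lip xy(3,4) dU[OF _ xy(1,2)] by auto
    then have "dist x y \<le> q * (D * q ^ n)"
      using \<open>0 < q\<close> by (meson less_imp_le mult_left_mono order_trans)
    then show ?thesis by (simp add: mult_ac)
  qed
  ultimately show ?case by (intro exI[of _ U']) auto
qed

text \<open>The \<open>N\<^sup>n\<close> cylinders of order \<open>n\<close> contribute at most \<open>D\<^sup>s (N q\<^sup>s)\<^sup>n\<close> to the sum, which tends
  to zero.\<close>

lemma hausdorff_measure_self_covered:
  fixes S :: "'a::euclidean_space set"
  assumes "bounded S" and q: "0 < q" "q < 1" and s: "0 < s" and small: "real N * q powr s < 1"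
    and lip: "\<And>i x y. i < N \<Longrightarrow> dist (f i x) (f i y) \<le> q * dist x y"
    and cover: "S \<subseteq> (\<Union>i<N. f i ` S)"
  shows "hausdorff_measure s S = 0"
proof -
  obtain D0 where "\<And>x y. x \<in> S \<Longrightarrow> y \<in> S \<Longrightarrow> dist x y \<le> D0"
    using \<open>bounded S\<close> unfolding bounded_two_points by blast
  then obtain D where D: "D > 0" "\<And>x y. x \<in> S \<Longrightarrow> y \<in> S \<Longrightarrow> dist x y \<le> D"
    using that[of "max D0 1"] by (force simp: le_max_iff_disj)
  have "hausdorff_premeasure s \<delta> S \<le> ennreal e" if "\<delta> > 0" "e > 0" for \<delta> e
  proof -
    have "(\<lambda>n. D * q ^ n) \<longlonglongrightarrow> D * 0" using q by (intro tendsto_intros) auto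
    then have "\<forall>\<^sub>F n in sequentially. D * q ^ n < \<delta>" using \<open>\<delta> > 0\<close> by (simp add: order_tendstoD)
    moreover have "(\<lambda>n. D powr s * (real N * q powr s) ^ n) \<longlonglongrightarrow> D powr s * 0"
      using small by (intro tendsto_intros LIMSEQ_power_zero) auto
    then have "\<forall>\<^sub>F n in sequentially. D powr s * (real N * q powr s) ^ n < e"
      using \<open>e > 0\<close> by (simp add: order_tendstoD)
    ultimately have "\<forall>\<^sub>F n in sequentially. D * q ^ n < \<delta> \<and> D powr s * (real N * q powr s) ^ n < e"
      by eventually_elim auto
    then obtain n where n: "D * q ^ n < \<delta>" "D powr s * (real N * q powr s) ^ n < e"
      using eventually_happens'[OF sequentially_bot] by blast
    obtain U where U: "S \<subseteq> (\<Union>i<N ^ n. U i)"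
      and dU: "\<forall>i<N ^ n. \<forall>x\<in>U i. \<forall>y\<in>U i. dist x y \<le> D * q ^ n"
      using self_covered_imp_small_covers[of S D q N f n, OF D(2) q(1) lip cover] by blast
    define V where "V i = (if i < N ^ n then U i else {})" for i
    have Vn: "norm (x - y) \<le> D * q ^ n" if "x \<in> V i" "y \<in> V i" for i x y
      using dU that by (auto simp: V_def dist_norm split: if_splits)
    have Dq: "0 \<le> D * q ^ n" using D q by simp
    have dV: "diameter (V i) \<le> D * q ^ n" for i using Vn Dq by (intro diameter_le) auto
    have bV: "bounded (V i)" for i
      using Vn by (auto simp: bounded_two_points dist_norm)
    have d0: "0 \<le> diameter (V i)" for i by (rule diameter_ge_0[OF bV])
    have "(\<Sum>i. ennreal (diameter (V i) powr s)) = (\<Sum>i<N ^ n. ennreal (diameter (V i) powr s))"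
      by (rule suminf_finite) (auto simp: V_def)
    also have "\<dots> \<le> (\<Sum>i<N ^ n. ennreal ((D * q ^ n) powr s))"
      using dV d0 s by (intro sum_mono ennreal_leI powr_mono2) auto
    also have "\<dots> = ennreal (real (N ^ n) * (D * q ^ n) powr s)"
      by (simp add: ennreal_mult' ennreal_of_nat_eq_real_of_nat)
    also have "real (N ^ n) * (D * q ^ n) powr s = D powr s * (real N * q powr s) ^ n"
      using D q by (simp add: powr_mult power_mult_distrib powr_power powr_realpow[symmetric] powr_powr mult_ac)
    also have "ennreal \<dots> \<le> ennreal e" using n by (intro ennreal_leI) simp
    finally have le: "(\<Sum>i. ennreal (diameter (V i) powr s)) \<le> ennreal e" .
    have "V \<in> {U. S \<subseteq> (\<Union>i. U i) \<and> (\<forall>i. bounded (U i) \<and> diameter (U i) \<le> \<delta>)}"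
    proof -
      have "S \<subseteq> (\<Union>i. V i)" using U by (auto simp: V_def)
      moreover have "diameter (V i) \<le> \<delta>" for i using dV[of i] n(1) by simp
      ultimately show ?thesis using bV by blast
    qed
    then show ?thesis
      unfolding hausdorff_premeasure_def by (rule INF_lower2[where i=V]) (use le in simp_all)
  qed
  then have "hausdorff_premeasure s \<delta> S = 0" if "\<delta> > 0" for \<delta>
    using that ennreal_le_epsilon[of 0 "hausdorff_premeasure s \<delta> S"] by simp
  then show ?thesis unfolding hausdorff_measure_def
    by (simp add: SUP_eq_const)
qed

section \<open>Maps with a Hoelder continuous derivative\<close>

text \<open>In finite dimension an expanding linear map is injective and therefore invertible; the expansion
  constant bounds the inverse.\<close>

lemma linear_expanding_invertible:
  fixes T :: "'a::euclidean_space \<Rightarrow>\<^sub>L 'a"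
  assumes "c > 0" and T: "\<And>x. c * norm x \<le> norm (T x)"
  obtains S :: "'a \<Rightarrow>\<^sub>L 'a" where "\<And>x. S (T x) = x" "\<And>x. T (S x) = x" "norm S \<le> 1 / c"
proof -
  have "inj (blinfun_apply T)"
  proof (rule linear_injective_0[THEN iffD2, rule_format])
    show "linear (blinfun_apply T)" by (simp add: blinfun.bounded_linear_right bounded_linear.linear)
    fix x assume "T x = 0"
    then show "x = 0" using T[of x] \<open>c > 0\<close> by (simp add: mult_le_0_iff)
  qed
  then obtain f' where f': "linear f'" "\<And>x. f' (T x) = x" "\<And>x. T (f' x) = x"
    using linear_injective_isomorphism[of "blinfun_apply T"]
    by (metis blinfun.bounded_linear_right bounded_linear.linear)
  have bl: "bounded_linear f'" using f'(1) by (simp add: linear_conv_bounded_linear)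
  have app: "blinfun_apply (Blinfun f') = f'" using bl by (rule bounded_linear_Blinfun_apply)
  have "norm (f' x) \<le> 1 / c * norm x" for x
    using T[of "f' x"] f'(3) \<open>c > 0\<close> by (simp add: field_simps)
  then show ?thesis
    using f' app \<open>c > 0\<close> by (intro that[of "Blinfun f'"] norm_blinfun_bound) auto
qed

text \<open>The derivative is carried along as a function \<open>F\<close> into the normed space of bounded linear maps,
  where compositions and differences of derivatives can be estimated by the norm.\<close>

definition has_holder_deriv ::
    "real \<Rightarrow> 'a::euclidean_space set \<Rightarrow> ('a \<Rightarrow> 'b::euclidean_space) \<Rightarrow> ('a \<Rightarrow> 'a \<Rightarrow>\<^sub>L 'b) \<Rightarrow> real \<Rightarrow> bool" where
  "has_holder_deriv \<alpha> U f F B \<longleftrightarrow>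
     (\<forall>x\<in>U. (f has_derivative F x) (at x)) \<and>
     (\<forall>x\<in>U. \<forall>y\<in>U. norm (F x - F y) \<le> B * dist x y powr \<alpha>)"

lemma has_holder_derivD:
  assumes "has_holder_deriv \<alpha> U f F B"
  shows "x \<in> U \<Longrightarrow> (f has_derivative F x) (at x)"
    and "x \<in> U \<Longrightarrow> y \<in> U \<Longrightarrow> norm (F x - F y) \<le> B * dist x y powr \<alpha>"
  using assms by (auto simp: has_holder_deriv_def)

lemma has_holder_deriv_mono:
  assumes "has_holder_deriv \<alpha> U f F B" "B \<le> B'"
  shows "has_holder_deriv \<alpha> U f F B'"
  unfolding has_holder_deriv_def
proof (intro conjI ballI)
  fix x y assume "x \<in> U" "y \<in> U"
  then have "norm (F x - F y) \<le> B * dist x y powr \<alpha>" by (rule has_holder_derivD(2)[OF assms(1)])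
  also have "\<dots> \<le> B' * dist x y powr \<alpha>" using assms(2) by (intro mult_right_mono) auto
  finally show "norm (F x - F y) \<le> B' * dist x y powr \<alpha>" .
qed (rule has_holder_derivD(1)[OF assms(1)])

lemma has_holder_deriv_cong:
  assumes "has_holder_deriv \<alpha> U f F B" "open U" "\<And>x. x \<in> U \<Longrightarrow> f x = g x"
  shows "has_holder_deriv \<alpha> U g F B"
  unfolding has_holder_deriv_def
proof (intro conjI ballI)
  show "(g has_derivative F x) (at x)" if "x \<in> U" for x
    by (rule has_derivative_transform_within_open[OF has_holder_derivD(1)[OF assms(1) that] assms(2) that assms(3)])
qed (rule has_holder_derivD(2)[OF assms(1)])

lemma has_holder_deriv_lipschitz:
  assumes "has_holder_deriv \<alpha> U f F B" "convex U" "\<And>x. x \<in> U \<Longrightarrow> norm (F x) \<le> l"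
    and "x \<in> U" "y \<in> U"
  shows "dist (f x) (f y) \<le> l * dist x y"
  unfolding dist_norm
proof (rule differentiable_bound[OF \<open>convex U\<close> _ _ \<open>x \<in> U\<close> \<open>y \<in> U\<close>])
  show "(f has_derivative F x) (at x within U)" if "x \<in> U" for x
    using has_holder_derivD(1)[OF assms(1) that] by (rule has_derivative_at_withinI)
  show "onorm (F x) \<le> l" if "x \<in> U" for x using assms(3)[OF that] by (simp add: norm_blinfun.rep_eq)
qed

text \<open>The factor \<open>l powr \<alpha>\<close> in front of the Hoelder constant of the outer map is what makes
  renormalization contract nonlinearity when the inner map is a contraction of ratio \<open>l\<close>.\<close>

lemma has_holder_deriv_compose:
  assumes f: "has_holder_deriv \<alpha> U f F Bf" and g: "has_holder_deriv \<alpha> W g G Bg"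
    and "convex W" "g ` W \<subseteq> U" "0 \<le> \<alpha>" "0 \<le> Bf"
    and l: "\<And>x. x \<in> W \<Longrightarrow> norm (G x) \<le> l" and m: "\<And>x. x \<in> W \<Longrightarrow> norm (F (g x)) \<le> m"
  shows "has_holder_deriv \<alpha> W (\<lambda>x. f (g x)) (\<lambda>x. F (g x) o\<^sub>L G x) (Bf * l powr \<alpha> * l + m * Bg)"
  unfolding has_holder_deriv_def
proof (intro conjI ballI)
  fix x assume x: "x \<in> W"
  have "(f \<circ> g has_derivative blinfun_apply (F (g x)) \<circ> blinfun_apply (G x)) (at x)"
    using x f g \<open>g ` W \<subseteq> U\<close> by (intro diff_chain_at) (auto simp: has_holder_deriv_def)
  then show "((\<lambda>x. f (g x)) has_derivative blinfun_apply (F (g x) o\<^sub>L G x)) (at x)"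
    by (simp add: o_def blinfun_compose.rep_eq)
next
  fix x y assume x: "x \<in> W" and y: "y \<in> W"
  have "0 \<le> l" using l[OF x] norm_ge_zero order_trans by blast
  have "0 \<le> m" using m[OF x] norm_ge_zero order_trans by blast
  have "dist (g x) (g y) powr \<alpha> \<le> (l * dist x y) powr \<alpha>"
    using has_holder_deriv_lipschitz[OF g \<open>convex W\<close> l x y] \<open>0 \<le> \<alpha>\<close> by (intro powr_mono2) auto
  then have gxy: "dist (g x) (g y) powr \<alpha> \<le> l powr \<alpha> * dist x y powr \<alpha>"
    using \<open>0 \<le> l\<close> by (simp add: powr_mult)
  have "norm (F (g x) - F (g y)) \<le> Bf * dist (g x) (g y) powr \<alpha>"
    using x y \<open>g ` W \<subseteq> U\<close> by (intro has_holder_derivD(2)[OF f]) auto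
  also have "\<dots> \<le> Bf * (l powr \<alpha> * dist x y powr \<alpha>)" using gxy \<open>0 \<le> Bf\<close> by (rule mult_left_mono)
  finally have F: "norm (F (g x) - F (g y)) \<le> Bf * (l powr \<alpha> * dist x y powr \<alpha>)" .
  have "(F (g x) o\<^sub>L G x) - (F (g y) o\<^sub>L G y) =
      ((F (g x) - F (g y)) o\<^sub>L G x) + (F (g y) o\<^sub>L (G x - G y))"
    by (rule blinfun_eqI) (simp add: blinfun.bilinear_simps)
  then have "norm ((F (g x) o\<^sub>L G x) - (F (g y) o\<^sub>L G y)) \<le>
      norm (F (g x) - F (g y)) * norm (G x) + norm (F (g y)) * norm (G x - G y)"
    by (metis norm_triangle_mono norm_blinfun_compose)
  also have "\<dots> \<le> Bf * (l powr \<alpha> * dist x y powr \<alpha>) * l + m * (Bg * dist x y powr \<alpha>)"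
    using F l[OF x] m[OF y] has_holder_derivD(2)[OF g x y] \<open>0 \<le> m\<close> \<open>0 \<le> Bf\<close>
    by (intro add_mono mult_mono) auto
  finally show "norm ((F (g x) o\<^sub>L G x) - (F (g y) o\<^sub>L G y)) \<le>
      (Bf * l powr \<alpha> * l + m * Bg) * dist x y powr \<alpha>"
    by (simp add: algebra_simps)
qed

lemma C1_holder_norm_le_imp:
  assumes "C1_holder_norm_le \<alpha> U f B"
  obtains F where "has_holder_deriv \<alpha> U f F B" "\<And>x. x \<in> U \<Longrightarrow> norm (f x) \<le> B"
    "\<And>x. x \<in> U \<Longrightarrow> norm (F x) \<le> B"
proof -
  define F where "F x = Blinfun (Deriv f x)" for x
  have d: "(f has_derivative Deriv f x) (at x)" if "x \<in> U" for x
    using assms that frechet_derivative_works unfolding C1_holder_norm_le_def by blast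
  have F: "blinfun_apply (F x) = Deriv f x" if "x \<in> U" for x
    unfolding F_def using d[OF that] by (intro bounded_linear_Blinfun_apply) (rule has_derivative_bounded_linear)
  show ?thesis
  proof (rule that[of F])
    show "has_holder_deriv \<alpha> U f F B"
      using assms d F by (auto simp: has_holder_deriv_def C1_holder_norm_le_def norm_blinfun.rep_eq minus_blinfun.rep_eq)
    show "\<And>x. x \<in> U \<Longrightarrow> norm (f x) \<le> B" "\<And>x. x \<in> U \<Longrightarrow> norm (F x) \<le> B"
      using assms F by (auto simp: C1_holder_norm_le_def norm_blinfun.rep_eq)
  qed
qed

text \<open>Closeness to a map that is affine on \<open>U\<close> controls the derivative of \<open>u\<close> itself, since subtracting
  a constant does not change a Hoelder seminorm.\<close>

lemma C1_holder_norm_le_affine: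
  fixes T :: "'a::euclidean_space \<Rightarrow>\<^sub>L 'a"
  assumes "C1_holder_norm_le \<alpha> U (\<lambda>x. u x - g x) B" "open U" and g: "\<And>x. x \<in> U \<Longrightarrow> g x = T x + b"
  obtains D where "has_holder_deriv \<alpha> U u D B" "\<And>x. x \<in> U \<Longrightarrow> norm (u x - (T x + b)) \<le> B"
    "\<And>x. x \<in> U \<Longrightarrow> norm (D x - T) \<le> B"
proof -
  obtain F where F: "has_holder_deriv \<alpha> U (\<lambda>x. u x - g x) F B"
    "\<And>x. x \<in> U \<Longrightarrow> norm (u x - g x) \<le> B" "\<And>x. x \<in> U \<Longrightarrow> norm (F x) \<le> B"
    using C1_holder_norm_le_imp[OF assms(1)] by metis
  show ?thesis
  proof (rule that[of "\<lambda>x. F x + T"])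
    have "(u has_derivative F x + T) (at x)" if x: "x \<in> U" for x
    proof -
      have "((\<lambda>x. (u x - g x) + (T x + b)) has_derivative (\<lambda>v. F x v + (T v + 0))) (at x)"
        by (intro derivative_intros has_holder_derivD(1)[OF F(1) x] blinfun.bounded_linear_right bounded_linear_imp_has_derivative)
      then have "((\<lambda>x. (u x - g x) + (T x + b)) has_derivative F x + T) (at x)"
        by (simp add: plus_blinfun.rep_eq)
      then show ?thesis
        by (rule has_derivative_transform_within_open[OF _ \<open>open U\<close> x]) (simp add: g)
    qed
    then show "has_holder_deriv \<alpha> U u (\<lambda>x. F x + T) B"
      using F(1) by (auto simp: has_holder_deriv_def)
  qed (use F g in auto)
qed

lemma near_affine_bilipschitz:
  fixes T :: "'a::euclidean_space \<Rightarrow>\<^sub>L 'a"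
  assumes u: "has_holder_deriv \<alpha> U u D B" and "convex U" and D: "\<And>x. x \<in> U \<Longrightarrow> norm (D x - T) \<le> \<eta>"
    and "x \<in> U" "y \<in> U"
  shows "norm ((u x - u y) - T (x - y)) \<le> \<eta> * norm (x - y)"
proof -
  have "norm ((u x - T x) - (u y - T y)) \<le> \<eta> * norm (x - y)"
  proof (rule differentiable_bound[OF \<open>convex U\<close> _ _ \<open>x \<in> U\<close> \<open>y \<in> U\<close>])
    show "((\<lambda>x. u x - T x) has_derivative D x - T) (at x within U)" if "x \<in> U" for x
      unfolding minus_blinfun.rep_eq
      by (intro derivative_intros has_derivative_at_withinI[OF has_holder_derivD(1)[OF u that]]
          blinfun.bounded_linear_right bounded_linear_imp_has_derivative)
    show "onorm (D x - T) \<le> \<eta>" if "x \<in> U" for x using D[OF that] by (simp add: norm_blinfun.rep_eq)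
  qed
  then show ?thesis by (simp add: blinfun.diff_right algebra_simps)
qed

lemma norm_blinfun_compose3: "norm (a o\<^sub>L (b o\<^sub>L c)) \<le> norm a * (norm b * norm c)"
  using norm_blinfun_compose[of a "b o\<^sub>L c"] mult_left_mono[OF norm_blinfun_compose[of b c] norm_ge_zero[of a]]
  by linarith

text \<open>The solution of \<open>u x = y\<close> is the fixed point of \<open>x \<mapsto> S (y - b) - S (u x - (T x + b))\<close>, which is a
  contraction of the ball of radius \<open>B\<close> about the solution \<open>S (y - b)\<close> of the affine equation.  The
  derivative of the inverse is estimated by the resolvent identities
  \<open>V - S = V (T - Du) S\<close> and \<open>V\<^sub>1 - V\<^sub>2 = V\<^sub>1 (Du\<^sub>2 - Du\<^sub>1) V\<^sub>2\<close>.\<close>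

lemma near_affine_inverse:
  fixes T S :: "'a::euclidean_space \<Rightarrow>\<^sub>L 'a"
  assumes u: "has_holder_deriv \<alpha> U u D B" and "convex U" "open W"
    and T: "\<And>x. T (S x) = x" "\<And>x. S (T x) = x" "norm S \<le> 1"
    and near: "\<And>x. x \<in> U \<Longrightarrow> norm (u x - (T x + b)) \<le> B" "\<And>x. x \<in> U \<Longrightarrow> norm (D x - T) \<le> B"
    and B: "B \<le> 1/2" "0 \<le> B" and \<alpha>: "0 \<le> \<alpha>" "\<alpha> \<le> 1"
    and W: "\<And>y. y \<in> W \<Longrightarrow> cball (S (y - b)) B \<subseteq> U"
  obtains v V where "\<And>y. y \<in> W \<Longrightarrow> v y \<in> U" "\<And>y. y \<in> W \<Longrightarrow> u (v y) = y"
    "\<And>y. y \<in> W \<Longrightarrow> norm (v y - S (y - b)) \<le> B"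
    "has_holder_deriv \<alpha> W v V (8 * B)" "\<And>y. y \<in> W \<Longrightarrow> norm (V y - S) \<le> 2 * B"
proof -
  have S: "norm (S x) \<le> norm x" for x
    using norm_blinfun[of S x] T(3) by (meson mult_left_le_one_le norm_ge_zero order_trans)
  have Tn: "norm x \<le> norm (T x)" for x using S[of "T x"] T(2) by simp
  have lip: "norm ((u x - u y) - T (x - y)) \<le> B * norm (x - y)" if "x \<in> U" "y \<in> U" for x y
    using near_affine_bilipschitz[OF u \<open>convex U\<close> near(2) that] .
  have expand: "norm (x - y) \<le> 2 * norm (u x - u y)" if "x \<in> U" "y \<in> U" for x y
  proof -
    have "norm (T (x - y)) \<le> norm (u x - u y) + norm ((u x - u y) - T (x - y))"
      by (metis norm_minus_commute norm_triangle_sub)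
    also have "\<dots> \<le> norm (u x - u y) + 1/2 * norm (x - y)"
      using lip[OF that] B(1) mult_right_mono[OF B(1) norm_ge_zero, of "x - y"] by linarith
    finally show ?thesis using Tn[of "x - y"] by linarith
  qed
  have "\<exists>x\<in>U. u x = y \<and> norm (x - S (y - b)) \<le> B" if y: "y \<in> W" for y
  proof -
    let ?C = "cball (S (y - b)) B"
    define \<Phi> where "\<Phi> x = S (y - b) - S (u x - (T x + b))" for x
    have "\<exists>!x\<in>?C. \<Phi> x = x"
    proof (rule Banach_fix[where c="1/2"])
      show "\<Phi> ` ?C \<subseteq> ?C"
      proof (clarsimp simp: \<Phi>_def dist_norm)
        fix x assume "norm (S (y - b) - x) \<le> B"
        then have "x \<in> U" using W[OF y] by (auto simp: dist_norm)
        then show "norm (S (u x - (T x + b))) \<le> B" using S near(1) order_trans by blast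
      qed
      show "dist (\<Phi> x) (\<Phi> z) \<le> 1/2 * dist x z" if "x \<in> ?C" "z \<in> ?C" for x z
      proof -
        have xz: "x \<in> U" "z \<in> U" using that W[OF y] by auto
        have "\<Phi> x - \<Phi> z = - S ((u x - u z) - T (x - z))"
          by (simp add: \<Phi>_def blinfun.diff_right blinfun.add_right)
        then have "dist (\<Phi> x) (\<Phi> z) \<le> B * norm (x - z)"
          using S lip[OF xz] by (metis dist_norm norm_minus_cancel order_trans)
        also have "\<dots> \<le> 1/2 * norm (x - z)" using B by (intro mult_right_mono) auto
        finally show ?thesis by (simp add: dist_norm)
      qed
    qed (use B in \<open>auto simp: complete_eq_closed\<close>)
    then obtain x where x: "x \<in> ?C" "\<Phi> x = x" by blast
    then have "S (y - b) - S (u x - (T x + b)) = x" by (simp add: \<Phi>_def)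
    then have "T (S (y - b) - S (u x - (T x + b))) = T x" by simp
    then have "u x = y" by (simp add: blinfun.diff_right T) 
    then show ?thesis using x W[OF y] by (auto simp: dist_norm norm_minus_commute)
  qed
  then obtain v where v: "\<And>y. y \<in> W \<Longrightarrow> v y \<in> U" "\<And>y. y \<in> W \<Longrightarrow> u (v y) = y"
    "\<And>y. y \<in> W \<Longrightarrow> norm (v y - S (y - b)) \<le> B" by metis
  have vlip: "dist (v y) (v z) \<le> 2 * dist y z" if "y \<in> W" "z \<in> W" for y z
    using expand[of "v y" "v z"] v that by (simp add: dist_norm)
  have "\<exists>M :: 'a \<Rightarrow>\<^sub>L 'a. (\<forall>x. blinfun_apply M (D (v y) x) = x) \<and> (\<forall>x. D (v y) (blinfun_apply M x) = x) \<and> norm M \<le> 2" if y: "y \<in> W" for y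
  proof -
    have "1/2 * norm x \<le> norm (D (v y) x)" for x
    proof -
      have "norm (T x) \<le> norm (D (v y) x) + norm ((D (v y) - T) x)"
        by (metis blinfun.diff_left norm_minus_commute norm_triangle_sub)
      moreover have "norm ((D (v y) - T) x) \<le> 1/2 * norm x"
        using norm_blinfun[of "D (v y) - T" x] near(2)[OF v(1)[OF y]] B(1)
        by (meson mult_right_mono norm_ge_zero order_trans)
      ultimately show ?thesis using Tn[of x] by linarith
    qed
    then obtain M :: "'a \<Rightarrow>\<^sub>L 'a" where "\<And>x. M (D (v y) x) = x" "\<And>x. D (v y) (M x) = x" "norm M \<le> 1 / (1/2)"
      using linear_expanding_invertible[of "1/2" "D (v y)"] by force
    then show ?thesis by auto
  qed
  then obtain V :: "'a \<Rightarrow> 'a \<Rightarrow>\<^sub>L 'a" where V: "\<And>y x. y \<in> W \<Longrightarrow> blinfun_apply (V y) (D (v y) x) = x"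
    "\<And>y x. y \<in> W \<Longrightarrow> D (v y) (blinfun_apply (V y) x) = x"
    "\<And>y. y \<in> W \<Longrightarrow> norm (V y) \<le> 2" by metis
  show ?thesis
  proof (rule that[OF v])
    show "norm (V y - S) \<le> 2 * B" if y: "y \<in> W" for y
    proof -
      have "V y - S = V y o\<^sub>L ((T - D (v y)) o\<^sub>L S)"
        by (rule blinfun_eqI) (simp add: blinfun.bilinear_simps T V y)
      then have "norm (V y - S) \<le> norm (V y) * (norm (T - D (v y)) * norm S)"
        by (simp only: norm_blinfun_compose3)
      also have "\<dots> \<le> 2 * (B * 1)"
        using V(3)[OF y] near(2)[OF v(1)[OF y]] T(3) B(2) by (intro mult_mono) (auto simp: norm_minus_commute)
      finally show ?thesis by simp
    qed
    show "has_holder_deriv \<alpha> W v V (8 * B)"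
      unfolding has_holder_deriv_def
    proof (intro conjI ballI)
      fix y assume y: "y \<in> W"
      have "2-lipschitz_on W v" using vlip by (intro lipschitz_onI) auto
      then have "continuous (at y) v"
        using \<open>open W\<close> y lipschitz_on_continuous_on continuous_on_eq_continuous_at by blast
      then show "(v has_derivative V y) (at y)"
        using \<open>open W\<close> y v(2) V(1) has_holder_derivD(1)[OF u v(1)[OF y]]
        by (intro has_derivative_inverse_basic[where f=u and f'="D (v y)" and g=v and T=W])
          (auto simp: blinfun.bounded_linear_right fun_eq_iff)
    next
      fix y z assume y: "y \<in> W" and z: "z \<in> W"
      have "V y - V z = V y o\<^sub>L ((D (v z) - D (v y)) o\<^sub>L V z)"
        by (rule blinfun_eqI) (simp add: blinfun.bilinear_simps V y z)
      then have "norm (V y - V z) \<le> norm (V y) * (norm (D (v z) - D (v y)) * norm (V z))"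
        by (simp only: norm_blinfun_compose3)
      also have "\<dots> \<le> 2 * ((B * dist (v z) (v y) powr \<alpha>) * 2)"
        using V(3) y z has_holder_derivD(2)[OF u v(1)[OF z] v(1)[OF y]] B(2) by (intro mult_mono) auto
      also have "\<dots> \<le> 2 * ((B * (2 * dist z y) powr \<alpha>) * 2)"
        using vlip[OF z y] \<alpha> B by (intro mult_mono powr_mono2) auto
      also have "\<dots> = 4 * B * 2 powr \<alpha> * dist z y powr \<alpha>" by (simp add: powr_mult)
      also have "\<dots> \<le> 4 * B * 2 powr 1 * dist z y powr \<alpha>"
        using \<alpha> B by (intro mult_right_mono mult_left_mono powr_mono) auto
      finally show "norm (V y - V z) \<le> 8 * B * dist y z powr \<alpha>" by (simp add: dist_commute)
    qed
  qed
qed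

lemma powr_2_le: "\<alpha> \<le> 1 \<Longrightarrow> 2 powr \<alpha> \<le> (2::real)"
  using powr_mono[of \<alpha> 1 2] by simp

section \<open>Affine systems of full-shift type\<close>

text \<open>An open set in the product topology constrains finitely many coordinates only; behind them the
  sequence can be continued by any other one.\<close>

lemma full_shift_mixing:
  "topologically_mixing (subshift A (A \<times> A)) (shift :: (nat \<Rightarrow> nat) \<Rightarrow> _)"
  unfolding topologically_mixing_def
proof (intro allI impI)
  fix U W :: "(nat \<Rightarrow> nat) set"
  let ?X = "subshift A (A \<times> A)"
  assume H: "openin (top_of_set ?X) U \<and> U \<noteq> {} \<and> openin (top_of_set ?X) W \<and> W \<noteq> {}"
  then obtain u w where u: "u \<in> U" and w: "w \<in> W" by blast
  obtain V where V: "open V" "U = ?X \<inter> V" using H by (auto simp: openin_open)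
  have X: "s \<in> ?X \<longleftrightarrow> (\<forall>i. s i \<in> A)" for s by (auto simp: subshift_def)
  have uA: "u i \<in> A" for i using u V X by blast
  have wA: "w i \<in> A" for i using w H X by (meson openin_imp_subset subsetD)
  have "openin (product_topology (\<lambda>i. euclidean) UNIV) V" using V by (simp add: open_fun_def)
  then obtain Z :: "nat \<Rightarrow> nat set" where Z: "finite {i. Z i \<noteq> UNIV}" "u \<in> Pi\<^sub>E UNIV Z" "Pi\<^sub>E UNIV Z \<subseteq> V"
    using u V(2) unfolding openin_product_topology_alt by fastforce
  then obtain m where m: "\<And>i. Z i \<noteq> UNIV \<Longrightarrow> i < m"
    by (metis (mono_tags, lifting) finite_nat_set_iff_bounded mem_Collect_eq)
  have shift: "(shift ^^ n) s = (\<lambda>i. s (i + n))" for n and s :: "nat \<Rightarrow> nat"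
    by (induction n) (auto simp: shift_def)
  show "\<exists>N. \<forall>n\<ge>N. (shift ^^ n) ` U \<inter> W \<noteq> {}"
  proof (intro exI allI impI)
    fix n assume "m \<le> n"
    define s where "s i = (if i < n then u i else w (i - n))" for i
    have "s i \<in> Z i" for i
      using Z(2) m[of i] \<open>m \<le> n\<close> by (cases "Z i = UNIV") (auto simp: s_def)
    then have "s \<in> U" using V Z(3) X uA wA by (auto simp: s_def)
    moreover have "(shift ^^ n) s = w" unfolding shift by (auto simp: s_def)
    ultimately show "(shift ^^ n) ` U \<inter> W \<noteq> {}" using w by blast
  qed
qed

text \<open>A full shift on \<open>N\<close> symbols.  All pieces are translates of one body \<open>T\<close>, and \<open>V\<close> is a larger open
  body whose translates are still disjoint, so that the generator is affine near every piece.  Keeping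
  \<open>T\<close> apart from \<open>V\<close> lets a thickened system be described by the same generator.\<close>

definition affine_data ::
    "nat \<Rightarrow> (nat \<Rightarrow> 'a) \<Rightarrow> (nat \<Rightarrow> 'a \<Rightarrow>\<^sub>L 'a) \<Rightarrow> 'a set \<Rightarrow> 'a set \<Rightarrow> 'a::euclidean_space cantor_data" where
  "affine_data N c A V T =
     \<lparr>alphabet = {..<N}, admissible = {..<N} \<times> {..<N}, piece = (\<lambda>i. (+) (c i) ` T),
      nhd = (\<Union>i<N. (+) (c i) ` V),
      gen = (\<lambda>x. let i = (LEAST i. i < N \<and> x - c i \<in> V) in A i (x - c i)), rate = 1/2\<rparr>"

text \<open>The factor 4 leaves room for perturbations: their generators still expand by the factor 2.\<close>

definition affine_system ::
    "nat \<Rightarrow> (nat \<Rightarrow> 'a) \<Rightarrow> (nat \<Rightarrow> 'a \<Rightarrow>\<^sub>L 'a) \<Rightarrow> 'a set \<Rightarrow> 'a::euclidean_space set \<Rightarrow> bool" where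
  "affine_system N c A V T \<longleftrightarrow>
     2 \<le> N \<and> open V \<and> T \<subseteq> V \<and> compact T \<and> convex T \<and> T \<noteq> {} \<and>
     (\<forall>i<N. \<forall>j<N. i \<noteq> j \<longrightarrow> (+) (c i) ` V \<inter> (+) (c j) ` V = {}) \<and>
     (\<forall>i<N. \<forall>x. 4 * norm x \<le> norm (A i x)) \<and>
     (\<forall>i<N. \<forall>k<N. (+) (c k) ` T \<subseteq> A i ` T)"

lemma mem_translate_iff: "x \<in> (+) c ` V \<longleftrightarrow> x - c \<in> V" for x c :: "'a::ab_group_add"
  by (force simp: image_iff)

definition thicken :: "real \<Rightarrow> 'a::euclidean_space set \<Rightarrow> 'a set" where
  "thicken r T = {z. \<exists>t\<in>T. norm (z - t) \<le> r}"

definition open_thicken :: "real \<Rightarrow> 'a::euclidean_space set \<Rightarrow> 'a set" where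
  "open_thicken r T = {z. \<exists>t\<in>T. norm (z - t) < r}"

lemma thicken_eq_sum: "thicken r T = {x + y | x y. x \<in> T \<and> y \<in> cball 0 r}"
proof -
  have "z \<in> {x + y | x y. x \<in> T \<and> y \<in> cball 0 r}" if "t \<in> T" "norm (z - t) \<le> r" for z t
    using that by (intro CollectI exI[of _ t] exI[of _ "z - t"]) simp
  then show ?thesis by (auto simp: thicken_def intro!: bexI)
qed

lemma open_thicken_eq_sum: "open_thicken r T = {x + y | x y. x \<in> T \<and> y \<in> ball 0 r}"
proof -
  have "z \<in> {x + y | x y. x \<in> T \<and> y \<in> ball 0 r}" if "t \<in> T" "norm (z - t) < r" for z t
    using that by (intro CollectI exI[of _ t] exI[of _ "z - t"]) simp
  then show ?thesis by (auto simp: open_thicken_def intro!: bexI)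
qed

lemma sumset_eq_UN: "{x + y | x y. x \<in> S \<and> y \<in> T} = (\<Union>x\<in>S. \<Union>y\<in>T. {x + y})"
  by blast

lemma open_thicken_subset: "open_thicken r T \<subseteq> thicken r T"
  unfolding open_thicken_def thicken_def by (blast intro: less_imp_le)

lemma open_open_thicken: "open (open_thicken r T)"
  unfolding open_thicken_eq_sum sumset_eq_UN by (intro open_sums disjI2) simp

lemma convex_open_thicken: "convex T \<Longrightarrow> convex (open_thicken r T)"
  unfolding open_thicken_eq_sum sumset_eq_UN by (intro convex_sums) auto

lemma compact_thicken: "compact T \<Longrightarrow> compact (thicken r T)"
  unfolding thicken_eq_sum by (intro compact_sums) auto

lemma convex_thicken: "convex T \<Longrightarrow> convex (thicken r T)"
  unfolding thicken_eq_sum sumset_eq_UN by (intro convex_sums) auto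

lemma closure_open_thicken:
  assumes "compact T" "0 < r"
  shows "closure (open_thicken r T) = thicken r T"
proof
  show "closure (open_thicken r T) \<subseteq> thicken r T"
    by (intro closure_minimal open_thicken_subset compact_imp_closed compact_thicken assms)
  have "thicken r T = T + cball 0 r" unfolding thicken_eq_sum set_plus_def by blast
  also have "\<dots> = closure T + closure (ball 0 r)" using assms by (simp add: compact_imp_closed)
  also have "\<dots> \<subseteq> closure (T + ball 0 r)" by (rule closure_sum)
  also have "T + ball 0 r = open_thicken r T" unfolding open_thicken_eq_sum set_plus_def by blast
  finally show "thicken r T \<subseteq> closure (open_thicken r T)" .
qed

lemma C1_holder_on_affine: 
  fixes f :: "'a::euclidean_space \<Rightarrow> 'a"
  assumes "\<And>x. x \<in> U \<Longrightarrow> \<exists>W M. open W \<and> x \<in> W \<and> (\<forall>y\<in>W. (f has_derivative M) (at y))"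
  shows "C1_holder_on \<alpha> U f"
  unfolding C1_holder_on_def
proof (intro conjI ballI)
  fix x assume x: "x \<in> U"
  show "f differentiable (at x)" using assms[OF x] by (auto simp: differentiable_def)
  obtain W M where W: "open W" "x \<in> W" "\<And>y. y \<in> W \<Longrightarrow> (f has_derivative M) (at y)"
    using assms[OF x] by blast
  then obtain e where e: "e > 0" "ball x e \<subseteq> W" using open_contains_ball by blast
  have "Deriv f y = M" if "y \<in> ball x e" for y
    using W(3) e(2) that by (metis frechet_derivative_at subsetD)
  then show "\<exists>e>0. \<exists>C. \<forall>y\<in>ball x e \<inter> U. \<forall>z\<in>ball x e \<inter> U.
      onorm (\<lambda>v. Deriv f y v - Deriv f z v) \<le> C * dist y z powr \<alpha>"
    using e(1) by (intro exI[of _ e] conjI exI[of _ 0]) (auto simp: onorm_zero)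
qed

context
  fixes N c A V T assumes sys: "affine_system N c (A :: nat \<Rightarrow> 'a \<Rightarrow>\<^sub>L 'a) V (T :: 'a::euclidean_space set)"
begin

lemma affine_system_expanding: "i < N \<Longrightarrow> 4 * norm x \<le> norm (A i x)"
  using sys by (auto simp: affine_system_def)

lemma gen_affine_data:
  assumes "i < N" "x - c i \<in> V"
  shows "gen (affine_data N c A V T) x = A i (x - c i)"
proof -
  have "(LEAST i. i < N \<and> x - c i \<in> V) = i"
  proof (rule Least_equality)
    fix j assume "j < N \<and> x - c j \<in> V"
    then show "i \<le> j"
      using sys assms mem_translate_iff[of x] unfolding affine_system_def by (metis disjoint_iff order_refl)
  qed (use assms in auto)
  then show ?thesis by (simp add: affine_data_def)
qed

lemma gen_affine_data_deriv:
  assumes "i < N" "x - c i \<in> V"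
  shows "(gen (affine_data N c A V T) has_derivative A i) (at x)"
proof -
  have V: "open V" using sys by (auto simp: affine_system_def)
  have "((\<lambda>x. A i (x - c i)) has_derivative (\<lambda>v. A i (v - 0))) (at x)"
    by (intro bounded_linear.has_derivative[OF blinfun.bounded_linear_right] derivative_intros)
  then have d: "((\<lambda>x. A i (x - c i)) has_derivative A i) (at x)" by simp
  show ?thesis
    by (rule has_derivative_transform_within_open[OF d, of "(+) (c i) ` V"])
      (use V assms in \<open>auto simp: mem_translate_iff gen_affine_data open_translation\<close>)
qed

lemma Deriv_gen_affine_data:
  "i < N \<Longrightarrow> x - c i \<in> V \<Longrightarrow> Deriv (gen (affine_data N c A V T)) x = A i"
  using frechet_derivative_at[OF gen_affine_data_deriv] by simp

lemma conorm_affine: "i < N \<Longrightarrow> 4 \<le> conorm (A i)"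
  unfolding conorm_def
proof (rule cINF_greatest)
  have "(SOME b::'a. b \<in> Basis) \<in> sphere 0 1" by simp
  then show "sphere (0::'a) 1 \<noteq> {}" by blast
  fix x :: 'a assume "i < N" "x \<in> sphere 0 1"
  then show "4 \<le> norm (A i x)" using affine_system_expanding[of i x] by simp
qed

lemma affine_system_inverse:
  assumes "i < N"
  obtains S :: "'a \<Rightarrow>\<^sub>L 'a" where "\<And>x. S (A i x) = x" "\<And>x. A i (S x) = x" "norm S \<le> 1/4"
proof (rule linear_expanding_invertible[of 4 "A i"])
  show "4 * norm x \<le> norm (A i x)" for x using affine_system_expanding[OF assms] .
qed (use that in auto)

lemma affine_diffeo:
  assumes "i < N"
  shows "C1_holder_diffeo \<alpha> UNIV UNIV (\<lambda>x. A i (x - c i))"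
proof -
  obtain S :: "'a \<Rightarrow>\<^sub>L 'a" where S: "\<And>x. S (A i x) = x" "\<And>x. A i (S x) = x"
    using affine_system_inverse[OF assms] by metis
  have d1: "((\<lambda>x. A i (x - c i)) has_derivative (\<lambda>v. A i (v - 0))) (at y)" for y
    by (intro bounded_linear.has_derivative[OF blinfun.bounded_linear_right] derivative_intros)
  have d2: "((\<lambda>x. c i + S x) has_derivative (\<lambda>v. 0 + S v)) (at y)" for y
    by (intro derivative_intros bounded_linear_imp_has_derivative blinfun.bounded_linear_right)
  have "homeomorphism UNIV UNIV (\<lambda>x. A i (x - c i)) (\<lambda>x. c i + S x)"
    using S by (intro homeomorphismI continuous_intros) auto
  moreover have "C1_holder_on \<alpha> UNIV (\<lambda>x. A i (x - c i))" "C1_holder_on \<alpha> UNIV (\<lambda>x. c i + S x)"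
    using d1 d2 by (auto intro!: C1_holder_on_affine exI[of _ UNIV])
  ultimately show ?thesis unfolding C1_holder_diffeo_def by blast
qed

lemma regular_cantor_affine_data: "regular_cantor \<alpha> (affine_data N c A V T)" (is "regular_cantor _ ?K")
  unfolding regular_cantor_def
proof (intro conjI)
  have s: "2 \<le> N" "open V" "T \<subseteq> V" "compact T" "convex T" "T \<noteq> {}"
    "\<And>i j. i < N \<Longrightarrow> j < N \<Longrightarrow> i \<noteq> j \<Longrightarrow> (+) (c i) ` V \<inter> (+) (c j) ` V = {}"
    "\<And>i k. i < N \<Longrightarrow> k < N \<Longrightarrow> (+) (c k) ` T \<subseteq> A i ` T"
    using sys unfolding affine_system_def by blast+
  have simps: "alphabet ?K = {..<N}" "admissible ?K = {..<N} \<times> {..<N}" "\<And>i. piece ?K i = (+) (c i) ` T"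
    "nhd ?K = (\<Union>i<N. (+) (c i) ` V)" "rate ?K = 1/2"
    by (auto simp: affine_data_def)
  show "finite (alphabet ?K)" "admissible ?K \<subseteq> alphabet ?K \<times> alphabet ?K"
    "0 < rate ?K" "rate ?K < 1" by (auto simp: simps)
  show "\<forall>a\<in>alphabet ?K. compact (piece ?K a) \<and> connected (piece ?K a) \<and> piece ?K a \<noteq> {}"
    using s by (auto simp: simps compact_translation convex_connected)
  show "disjoint_family_on (piece ?K) (alphabet ?K)"
    unfolding disjoint_family_on_def simps
  proof (intro ballI impI)
    fix i j assume "i \<in> {..<N}" "j \<in> {..<N}" "i \<noteq> j"
    then show "(+) (c i) ` T \<inter> (+) (c j) ` T = {}" using s(7)[of i j] image_mono[OF s(3), of "(+) (c i)"] image_mono[OF s(3), of "(+) (c j)"] by auto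
  qed
  show "open (nhd ?K)" using s(2) by (auto simp: simps open_translation)
  show "(\<Union>a\<in>alphabet ?K. piece ?K a) \<subseteq> nhd ?K" using s(3) by (auto simp: simps)
  show "C1_holder_on \<alpha> (nhd ?K) (gen ?K)"
  proof (rule C1_holder_on_affine)
    fix x assume "x \<in> nhd ?K"
    then obtain i where i: "i < N" "x \<in> (+) (c i) ` V" by (auto simp: simps)
    have "(gen ?K has_derivative A i) (at y)" if "y \<in> (+) (c i) ` V" for y
      using gen_affine_data_deriv[OF i(1)] that by (simp only: mem_translate_iff)
    then show "\<exists>W M. open W \<and> x \<in> W \<and> (\<forall>y\<in>W. (gen ?K has_derivative M) (at y))"
      using i(2) open_translation[OF s(2)] by blast
  qed
  have gT: "gen ?K ` ((+) (c i) ` T) = A i ` T" if "i < N" for i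
    unfolding image_image using s(3) that gen_affine_data[OF that] by (intro image_cong) auto
  show "\<forall>a\<in>alphabet ?K. \<forall>b\<in>alphabet ?K. if (a, b) \<in> admissible ?K then piece ?K b \<subseteq> gen ?K ` piece ?K a
     else piece ?K b \<inter> gen ?K ` piece ?K a = {}"
    using s(8) gT by (auto simp: simps)
  show "\<forall>a\<in>alphabet ?K. \<exists>U W h. piece ?K a \<subseteq> U \<and> C1_holder_diffeo \<alpha> U W h \<and> (\<forall>x\<in>piece ?K a. h x = gen ?K x)"
  proof
    fix a assume "a \<in> alphabet ?K"
    then have a: "a < N" by (simp add: simps)
    show "\<exists>U W h. piece ?K a \<subseteq> U \<and> C1_holder_diffeo \<alpha> U W h \<and> (\<forall>x\<in>piece ?K a. h x = gen ?K x)"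
      using affine_diffeo[OF a] gen_affine_data[OF a] s(3)
      by (intro exI[of _ UNIV] exI[of _ "\<lambda>x. A a (x - c a)"]) (auto simp: simps)
  qed
  show "\<forall>x\<in>nhd ?K. inverse (rate ?K) < conorm (Deriv (gen ?K) x)"
  proof
    fix x assume "x \<in> nhd ?K"
    then obtain i where i: "i < N" "x - c i \<in> V" by (auto simp: simps)
    then show "inverse (rate ?K) < conorm (Deriv (gen ?K) x)"
      using conorm_affine[OF i(1)] unfolding Deriv_gen_affine_data[OF i] simps by simp
  qed
  show "\<exists>s\<in>symbolic_type ?K. \<exists>t\<in>symbolic_type ?K. s \<noteq> t"
    using s(1) by (intro bexI[of _ "\<lambda>_. 0"] bexI[of _ "\<lambda>_. 1"]) (auto simp: simps subshift_def fun_eq_iff)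
  show "topologically_mixing (symbolic_type ?K) shift" unfolding simps by (rule full_shift_mixing)
qed

text \<open>The Markov property passes to neighbourhoods because the inverses of the \<open>A i\<close> do not increase
  norms.\<close>

lemma affine_system_thicken:
  assumes "0 < r" "thicken r T \<subseteq> V"
  shows "affine_system N c A V (thicken r T)"
proof -
  have s: "2 \<le> N" "open V" "T \<subseteq> V" "compact T" "convex T" "T \<noteq> {}"
    "\<forall>i<N. \<forall>j<N. i \<noteq> j \<longrightarrow> (+) (c i) ` V \<inter> (+) (c j) ` V = {}"
    "\<forall>i<N. \<forall>x. 4 * norm x \<le> norm (A i x)"
    "\<And>i k. i < N \<Longrightarrow> k < N \<Longrightarrow> (+) (c k) ` T \<subseteq> A i ` T"
    using sys unfolding affine_system_def by blast+
  have "compact (thicken r T)" "convex (thicken r T)" using compact_thicken[OF s(4)] convex_thicken[OF s(5)] by auto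
  moreover have "thicken r T \<noteq> {}"
  proof -
    obtain t where "t \<in> T" using s(6) by blast
    then have "t \<in> thicken r T" using \<open>0 < r\<close> unfolding thicken_def by (intro CollectI bexI[of _ t]) simp_all
    then show ?thesis by blast
  qed
  moreover have "(+) (c k) ` thicken r T \<subseteq> A i ` thicken r T" if "i < N" "k < N" for i k
  proof clarify
    fix z assume "z \<in> thicken r T"
    then obtain x y where xy: "z = x + y" "x \<in> T" "norm y \<le> r"
      unfolding thicken_eq_sum mem_cball_0 by blast
    have "c k + x \<in> A i ` T" using s(9)[OF that] xy(2) by (simp only: image_subset_iff)
    then obtain t where t: "c k + x = A i t" "t \<in> T" by (rule imageE)
    obtain S :: "'a \<Rightarrow>\<^sub>L 'a" where S: "\<And>y. S (A i y) = y" "\<And>y. A i (S y) = y" "norm S \<le> 1/4"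
      by (rule affine_system_inverse[OF \<open>i < N\<close>]) blast
    have "norm (S y) \<le> r" using affine_system_expanding[OF that(1), of "S y"] xy(3) norm_ge_zero[of "S y"] unfolding S(2) by linarith
    then have "t + S y \<in> thicken r T" using t xy(3) unfolding thicken_def by (intro CollectI bexI[of _ t]) simp_all
    moreover have "A i (t + S y) = c k + z" using t S(2) xy(1) by (simp add: blinfun.add_right)
    ultimately show "c k + z \<in> A i ` thicken r T" by (metis image_eqI)
  qed
  ultimately show ?thesis using s(1,2,7,8) assms(2) unfolding affine_system_def by simp
qed

lemma star_piece_affine_data:
  "star_piece r (affine_data N c A V T) i = (+) (c i) ` open_thicken r T"
proof -
  have "z \<in> star_piece r (affine_data N c A V T) i \<longleftrightarrow> z - c i \<in> open_thicken r T" for z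
    by (simp add: star_piece_def affine_data_def open_thicken_def dist_norm diff_diff_eq norm_minus_commute)
  then show ?thesis by (intro set_eqI) (simp only: mem_translate_iff)
qed

lemma closure_star_piece_affine_data:
  "0 < r \<Longrightarrow> closure (star_piece r (affine_data N c A V T) i) = (+) (c i) ` thicken r T"
  using sys by (simp add: star_piece_affine_data closure_translation closure_open_thicken affine_system_def)

end

text \<open>Replacing the pieces by the closed neighbourhoods gives the affine system with body
  \<open>thicken r T\<close>.\<close>

lemma star_radius_affine_data:
  assumes "affine_system N c A V T" "0 < r" "thicken r T \<subseteq> V"
  shows "star_radius \<alpha> r (affine_data N c A V T)"
proof -
  have "(affine_data N c A V T)\<lparr>piece := \<lambda>a. closure (star_piece r (affine_data N c A V T) a)\<rparr>
      = affine_data N c A V (thicken r T)"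
    by (simp add: closure_star_piece_affine_data[OF assms(1,2)]) (simp add: affine_data_def)
  then show ?thesis
    using regular_cantor_affine_data[OF affine_system_thicken[OF assms]] assms(2) by (simp add: star_radius_def)
qed

lemma affine_data_sel [simp]:
  "alphabet (affine_data N c A V T) = {..<N}" "admissible (affine_data N c A V T) = {..<N} \<times> {..<N}"
  "piece (affine_data N c A V T) i = (+) (c i) ` T" "rate (affine_data N c A V T) = 1/2"
  by (simp_all add: affine_data_def)

lemma cantor_set_affine_dataE:
  assumes "affine_system N c A V T" "x \<in> cantor_set (affine_data N c A V T)"
  obtains i where "i < N" "x - c i \<in> T" "x - c i \<in> V"
proof -
  have "x \<in> (gen (affine_data N c A V T) ^^ 0) -` (\<Union>a<N. (+) (c a) ` T)"
    using assms(2) unfolding cantor_set_def affine_data_sel by blast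
  then obtain i where "i < N" "x \<in> (+) (c i) ` T" by auto
  moreover have "T \<subseteq> V" using assms(1) by (simp add: affine_system_def)
  ultimately show ?thesis using that by (metis mem_translate_iff subsetD)
qed

text \<open>For an affine system bunching can be tested on the first iterate.\<close>

lemma bunched_affine_data:
  assumes "affine_system N c A V T"
    and "\<And>i. i < N \<Longrightarrow> onorm (A i) * inverse (conorm (A i)) * (1/2) powr \<alpha> < 1"
  shows "bunched_cantor \<alpha> (affine_data N c A V T)"
  unfolding bunched_cantor_def
proof (intro exI[of _ 1] ballI)
  fix x assume "x \<in> cantor_set (affine_data N c A V T)"
  then obtain i where i: "i < N" "x - c i \<in> V" using cantor_set_affine_dataE[OF assms(1)] by metis
  have "gen (affine_data N c A V T) ^^ 1 = gen (affine_data N c A V T)" by simp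
  then show "onorm (Deriv (gen (affine_data N c A V T) ^^ 1) x) *
       inverse (conorm (Deriv (gen (affine_data N c A V T) ^^ 1) x)) *
       rate (affine_data N c A V T) powr (\<alpha> * real 1) < 1"
    using assms(2)[OF i(1)] Deriv_gen_affine_data[OF assms(1) i] by simp
qed

lemma bunched_affine_dataI:
  fixes T :: "'a::euclidean_space set"
  assumes sys: "affine_system N c A V T" and "0 < a"
    and A: "\<And>i. i < N \<Longrightarrow> norm (A i) \<le> b" "\<And>i x. i < N \<Longrightarrow> a * norm x \<le> norm (A i x)"
    and ab: "b < a * 2 powr \<alpha>"
  shows "bunched_cantor \<alpha> (affine_data N c A V T)"
proof (rule bunched_affine_data[OF sys])
  fix i assume i: "i < N"
  have "a \<le> conorm (A i)" unfolding conorm_def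
  proof (rule cINF_greatest)
    have "(SOME b::'a. b \<in> Basis) \<in> sphere 0 1" by simp
    then show "sphere (0::'a) 1 \<noteq> {}" by blast
    show "a \<le> norm (A i x)" if "x \<in> sphere 0 1" for x using A(2)[OF i, of x] that by simp
  qed
  then have "inverse (conorm (A i)) \<le> inverse a" using \<open>0 < a\<close> by (simp add: le_imp_inverse_le)
  moreover have "onorm (A i) \<le> b" using A(1)[OF i] by (simp add: norm_blinfun.rep_eq)
  moreover have "0 \<le> onorm (A i)" using norm_ge_zero[of "A i"] by (simp add: norm_blinfun.rep_eq)
  ultimately have "onorm (A i) * inverse (conorm (A i)) \<le> b * inverse a"
    using \<open>0 < a\<close> \<open>a \<le> conorm (A i)\<close> by (intro mult_mono) auto
  then have "onorm (A i) * inverse (conorm (A i)) * (1/2) powr \<alpha> \<le> b * inverse a * (1/2) powr \<alpha>"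
    by (intro mult_right_mono) auto
  also have "\<dots> < 1"
    using ab \<open>0 < a\<close> by (simp add: powr_divide field_simps)
  finally show "onorm (A i) * inverse (conorm (A i)) * (1/2) powr \<alpha> < 1" .
qed

lemma affine_cantor_affine_data:
  assumes "affine_system N c A V T"
  shows "affine_cantor (affine_data N c A V T)"
  unfolding affine_cantor_def
proof
  fix a assume "a \<in> alphabet (affine_data N c A V T)"
  then have a: "a < N" by simp
  have "gen (affine_data N c A V T) x = A a x + (- A a (c a))" if "x \<in> piece (affine_data N c A V T) a" for x
  proof -
    have "x - c a \<in> V" using that assms unfolding affine_data_sel mem_translate_iff affine_system_def by blast
    then show ?thesis using gen_affine_data[OF assms a] by (simp add: blinfun.diff_right)
  qed
  moreover have "linear (blinfun_apply (A a))" by (simp add: blinfun.bounded_linear_right bounded_linear.linear)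
  moreover have "conorm (A a) > 1" using conorm_affine[OF assms a] by simp
  ultimately show "\<exists>A' c'. linear A' \<and> conorm A' > 1 \<and>
      (\<forall>x\<in>piece (affine_data N c A V T) a. gen (affine_data N c A V T) x = A' x + c')" by blast
qed

lemma homothetical_affine_data:
  assumes "affine_system N c (\<lambda>_. l *\<^sub>R id_blinfun) V (T :: 'a::euclidean_space set)" "0 < l"
  shows "homothetical_cantor (affine_data N c (\<lambda>_. l *\<^sub>R id_blinfun) V T)"
    and "conformal_cantor (affine_data N c (\<lambda>_. l *\<^sub>R id_blinfun) V T)"
proof -
  let ?K = "affine_data N c (\<lambda>_. l *\<^sub>R id_blinfun) V T"
  have "norm (l *\<^sub>R id_blinfun :: 'a \<Rightarrow>\<^sub>L 'a) = l" using \<open>0 < l\<close> by simp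
  then have onorm: "onorm (blinfun_apply (l *\<^sub>R id_blinfun :: 'a \<Rightarrow>\<^sub>L 'a)) = l" by (simp only: norm_blinfun.rep_eq)
  have "(\<lambda>v. Deriv (gen ?K) x v /\<^sub>R onorm (Deriv (gen ?K) x)) = id" if x: "x \<in> cantor_set ?K" for x
  proof -
    obtain i where "i < N" "x - c i \<in> V" using cantor_set_affine_dataE[OF assms(1) x] by metis
    then have "Deriv (gen ?K) x = l *\<^sub>R id_blinfun" by (rule Deriv_gen_affine_data[OF assms(1)])
    then show ?thesis unfolding onorm using \<open>0 < l\<close> by (simp only: onorm) (auto simp: scaleR_blinfun.rep_eq fun_eq_iff)
  qed
  then show "homothetical_cantor ?K" "conformal_cantor ?K"
    by (auto simp: homothetical_cantor_def conformal_cantor_def orthogonal_transformation_def linear_id)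
qed

text \<open>Both systems have the same pieces, so the identity can serve as the change of coordinates.\<close>

lemma cantor_close_affine_data:
  assumes sys: "affine_system N c A V T" "affine_system N c A' V T" and r: "0 < r" "thicken r T \<subseteq> V"
    and "bunched_cantor \<alpha> (affine_data N c A' V T)" and "0 \<le> \<delta>"
    and close: "\<And>i x. i < N \<Longrightarrow> x \<in> open_thicken r T \<Longrightarrow> norm (A' i x - A i x) \<le> \<delta>"
      "\<And>i. i < N \<Longrightarrow> norm (A' i - A i) \<le> \<delta>"
  shows "cantor_close \<alpha> r \<delta> (affine_data N c A V T) (affine_data N c A' V T)"
  unfolding cantor_close_def
proof (intro conjI ballI)
  let ?K = "affine_data N c A V T" and ?L = "affine_data N c A' V T"
  show "star_radius \<alpha> r ?K" "star_radius \<alpha> r ?L" "regular_cantor \<alpha> ?L"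
    using sys r by (auto intro: star_radius_affine_data regular_cantor_affine_data)
  fix i assume "i \<in> alphabet ?K"
  then have i: "i < N" by simp
  let ?U = "(+) (c i) ` open_thicken r T"
  have star: "star_piece r ?K i = ?U" "star_piece r ?L i = ?U" using sys star_piece_affine_data by blast+
  have U: "open ?U" "x - c i \<in> V" "x - c i \<in> open_thicken r T" if "x \<in> ?U" for x
    using subsetD[OF subset_trans[OF open_thicken_subset r(2)], of "x - c i"] that
      open_translation[OF open_open_thicken] by (simp_all only: mem_translate_iff)
  have "C1_holder_diffeo \<alpha> ?U ?U (\<lambda>x. x)"
    unfolding C1_holder_diffeo_def
    by (intro conjI exI[of _ "\<lambda>x. x"] homeomorphism_ident C1_holder_on_affine)
      (auto intro!: open_translation open_open_thicken exI[of _ UNIV] exI[of _ "\<lambda>x. x"])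
  moreover have "C1_holder_norm_le \<alpha> ?U (\<lambda>x. x - x) \<delta>"
    using \<open>0 \<le> \<delta>\<close> by (auto simp: C1_holder_norm_le_def onorm_zero)
  moreover have "C1_holder_norm_le \<alpha> ?U (\<lambda>x. gen ?L x - gen ?K x) \<delta>"
  proof -
    have d: "((\<lambda>x. gen ?L x - gen ?K x) has_derivative A' i - A i) (at x)" if "x \<in> ?U" for x
      unfolding minus_blinfun.rep_eq using sys i U[OF that] by (intro derivative_intros gen_affine_data_deriv)
    have D: "Deriv (\<lambda>x. gen ?L x - gen ?K x) x = A' i - A i" if "x \<in> ?U" for x
      using frechet_derivative_at[OF d[OF that]] by simp
    have "norm (gen ?L x - gen ?K x) \<le> \<delta>" if "x \<in> ?U" for x
      using close(1)[OF i U(3)[OF that]] sys i U(2)[OF that] by (simp add: gen_affine_data)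
    moreover have "onorm (A' i - A i) \<le> \<delta>" using close(2)[OF i] by (simp add: norm_blinfun.rep_eq)
    ultimately show ?thesis
      unfolding C1_holder_norm_le_def using d D \<open>0 \<le> \<delta>\<close>
      by (auto simp: onorm_zero differentiable_def)
  qed
  ultimately show "C1_holder_close \<alpha> \<delta> (star_piece r ?K i) (gen ?K) (star_piece r ?L i) (gen ?L)"
    unfolding C1_holder_close_def star by blast
qed (use assms in auto)

lemma cantor_set_affine_data_cover:
  assumes sys: "affine_system N c A V T" and S: "\<And>i x. i < N \<Longrightarrow> S i (A i x) = x"
  shows "cantor_set (affine_data N c A V T) \<subseteq> (\<Union>i<N. (\<lambda>y. c i + S i y) ` cantor_set (affine_data N c A V T))"
proof
  let ?K = "affine_data N c A V T"
  fix x assume x: "x \<in> cantor_set ?K"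
  then obtain i where i: "i < N" "x - c i \<in> V" using cantor_set_affine_dataE[OF sys] by metis
  have "(gen ?K ^^ n) (gen ?K x) \<in> (\<Union>a\<in>alphabet ?K. piece ?K a)" for n
  proof -
    have "x \<in> (gen ?K ^^ Suc n) -` (\<Union>a\<in>alphabet ?K. piece ?K a)" using x unfolding cantor_set_def by blast
    then show ?thesis by (simp add: funpow_swap1)
  qed
  then have "gen ?K x \<in> cantor_set ?K" unfolding cantor_set_def by blast
  moreover have "x = c i + S i (gen ?K x)" using i S gen_affine_data[OF sys i] by simp
  ultimately show "x \<in> (\<Union>i<N. (\<lambda>y. c i + S i y) ` cantor_set ?K)" using i(1) by blast
qed

text \<open>Membership in the Cantor set demands that the orbit stays in the pieces, not merely in their
  neighbourhoods.  By the Markov property the itinerary of \<open>x\<close> is followed for any finite time by an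
  orbit inside the pieces; by expansion that orbit is exponentially close to the one of \<open>x\<close>, and the
  pieces are closed.\<close>

lemma expanding_orbit_in_cantor_set:
  assumes reg: "regular_cantor \<alpha> L" and alph: "\<And>n. i n \<in> alphabet L"
    and adm: "\<And>n. (i n, i (Suc n)) \<in> admissible L" and "0 < r"
    and expand: "\<And>a p q. a \<in> alphabet L \<Longrightarrow> p \<in> star_piece r L a \<Longrightarrow> q \<in> star_piece r L a \<Longrightarrow>
        2 * dist p q \<le> dist (gen L p) (gen L q)"
    and bdd: "\<And>a. a \<in> alphabet L \<Longrightarrow> bounded (star_piece r L a)"
    and orbit: "\<And>n. (gen L ^^ n) x \<in> star_piece r L (i n)"
  shows "x \<in> cantor_set L"
proof -
  have sub: "piece L a \<subseteq> star_piece r L a" for a using \<open>0 < r\<close> by (auto simp: star_piece_def intro!: bexI)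
  have markov: "piece L (i (Suc n)) \<subseteq> gen L ` piece L (i n)" for n
    using reg alph[of n] alph[of "Suc n"] adm[of n] unfolding regular_cantor_def by (metis (no_types, lifting))
  have itinerary: "\<exists>y. \<forall>k\<le>n. (gen L ^^ k) y \<in> piece L (i (m + k))" for n m
  proof (induction n arbitrary: m)
    case 0
    have "piece L (i m) \<noteq> {}" using reg alph[of m] unfolding regular_cantor_def by blast
    then show ?case by auto
  next
    case (Suc n)
    obtain y where y: "\<forall>k\<le>n. (gen L ^^ k) y \<in> piece L (i (Suc m + k))" using Suc[of "Suc m"] by blast
    then have "y \<in> piece L (i (Suc m))" by (metis add_0_right funpow_0 le0)
    then obtain z where z: "z \<in> piece L (i m)" "y = gen L z" using markov by blast
    have "(gen L ^^ k) z \<in> piece L (i (m + k))" if "k \<le> Suc n" for k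
      using that z y by (cases k) (auto simp: funpow_swap1)
    then show ?case by blast
  qed
  have "bounded (\<Union>a\<in>alphabet L. star_piece r L a)"
    using reg bdd unfolding regular_cantor_def by (intro bounded_Union) auto
  then obtain D where D: "\<And>p q a. a \<in> alphabet L \<Longrightarrow> p \<in> star_piece r L a \<Longrightarrow> q \<in> star_piece r L a \<Longrightarrow> dist p q \<le> D"
    unfolding bounded_two_points by (metis UN_I)
  have "(gen L ^^ k) x \<in> piece L (i k)" for k
  proof -
    have "\<exists>z\<in>piece L (i k). dist z ((gen L ^^ k) x) < e" if "e > 0" for e
    proof -
      have "(\<lambda>n. D * (1/2) ^ n) \<longlonglongrightarrow> D * 0" by (intro tendsto_intros) auto
      then have "\<forall>\<^sub>F n in sequentially. D * (1/2) ^ n < e" using \<open>e > 0\<close> by (simp add: order_tendstoD)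
      then obtain n where n: "D * (1/2) ^ n < e" using eventually_happens'[OF sequentially_bot] by blast
      obtain y where y: "\<forall>j\<le>k + n. (gen L ^^ j) y \<in> piece L (i (0 + j))" using itinerary by blast
      have "2 ^ j * dist ((gen L ^^ k) y) ((gen L ^^ k) x) \<le> dist ((gen L ^^ (k + j)) y) ((gen L ^^ (k + j)) x)"
        if "j \<le> n" for j using that
      proof (induction j)
        case (Suc j)
        have "2 * dist ((gen L ^^ (k + j)) y) ((gen L ^^ (k + j)) x) \<le>
            dist (gen L ((gen L ^^ (k + j)) y)) (gen L ((gen L ^^ (k + j)) x))"
          using y sub[of "i (k + j)"] orbit Suc.prems by (intro expand[OF alph[of "k + j"]]) auto
        then show ?case using Suc by simp
      qed simp
      from this[of n] have "2 ^ n * dist ((gen L ^^ k) y) ((gen L ^^ k) x) \<le>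
          dist ((gen L ^^ (k + n)) y) ((gen L ^^ (k + n)) x)" by simp
      also have "\<dots> \<le> D"
      proof (rule D[OF alph[of "k + n"] _ orbit])
        have "(gen L ^^ (k + n)) y \<in> piece L (i (k + n))" using y by simp
        then show "(gen L ^^ (k + n)) y \<in> star_piece r L (i (k + n))" using sub by blast
      qed
      finally have "dist ((gen L ^^ k) y) ((gen L ^^ k) x) \<le> D * (1/2) ^ n" by (simp add: field_simps power_divide)
      then have "dist ((gen L ^^ k) y) ((gen L ^^ k) x) < e" using n by simp
      moreover have "(gen L ^^ k) y \<in> piece L (i k)" using y by simp
      ultimately show ?thesis by blast
    qed
    then have "(gen L ^^ k) x \<in> closure (piece L (i k))" by (simp add: closure_approachable)
    moreover have "compact (piece L (i k))" using reg alph unfolding regular_cantor_def by blast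
    ultimately show ?thesis by (simp add: compact_imp_closed)
  qed
  then show ?thesis using alph unfolding cantor_set_def by blast
qed

lemma hausdorff_dim_affine_data_less:
  fixes T :: "'a::euclidean_space set"
  assumes sys: "affine_system N c A V T" and q: "0 < q" "q < 1" and s: "0 < s" "s < \<epsilon>" and small: "real N * q powr s < 1"
    and A: "\<And>i x. i < N \<Longrightarrow> norm x \<le> q * norm (A i x)"
  shows "hausdorff_dim (cantor_set (affine_data N c A V T)) < ereal \<epsilon>"
proof -
  let ?K = "affine_data N c A V T"
  have "\<exists>R :: 'a \<Rightarrow>\<^sub>L 'a. (\<forall>x. blinfun_apply R (A i x) = x) \<and> norm R \<le> q" if i: "i < N" for i
  proof -
    have "1 / q * norm x \<le> norm (A i x)" for x using A[OF i, of x] q by (simp add: field_simps)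
    then obtain R :: "'a \<Rightarrow>\<^sub>L 'a" where "\<And>x. R (A i x) = x" "norm R \<le> 1 / (1 / q)"
      using linear_expanding_invertible[of "1 / q" "A i"] q by force
    then show ?thesis by auto
  qed
  then obtain R :: "nat \<Rightarrow> 'a \<Rightarrow>\<^sub>L 'a" where R: "\<And>i x. i < N \<Longrightarrow> blinfun_apply (R i) (A i x) = x" "\<And>i. i < N \<Longrightarrow> norm (R i) \<le> q"
    by metis
  have "bounded (cantor_set ?K)"
  proof (rule bounded_subset)
    have "compact T" using sys by (simp add: affine_system_def)
    then show "bounded (\<Union>i<N. (+) (c i) ` T)" by (intro bounded_Union) (auto intro: compact_imp_bounded compact_translation)
    show "cantor_set ?K \<subseteq> (\<Union>i<N. (+) (c i) ` T)"
    proof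
      fix x assume "x \<in> cantor_set ?K"
      then obtain i where "i < N" "x - c i \<in> T" using cantor_set_affine_dataE[OF sys] by metis
      then show "x \<in> (\<Union>i<N. (+) (c i) ` T)" unfolding mem_translate_iff[symmetric] by blast
    qed
  qed
  then have "hausdorff_measure s (cantor_set ?K) = 0"
  proof (rule hausdorff_measure_self_covered[OF _ q s(1) small])
    show "dist (c i + R i x) (c i + R i y) \<le> q * dist x y" if "i < N" for i x y
    proof -
      have "norm (R i (x - y)) \<le> q * norm (x - y)"
        using R(2)[OF that] by (intro order_trans[OF norm_blinfun] mult_right_mono) auto
      then show ?thesis by (simp add: dist_norm blinfun.diff_right)
    qed
    show "cantor_set ?K \<subseteq> (\<Union>i<N. (\<lambda>y. c i + R i y) ` cantor_set ?K)"
      by (rule cantor_set_affine_data_cover[OF sys R(1)])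
  qed
  then have "hausdorff_dim (cantor_set ?K) \<le> ereal s"
    unfolding hausdorff_dim_def using s(1) by (intro Inf_lower) auto
  then show ?thesis using s(2) by (simp add: le_less_trans)
qed

lemma thicken_cball_subset:
  assumes "s + r < t"
  shows "thicken r (cball (0 :: 'a::euclidean_space) s) \<subseteq> ball 0 t"
proof
  fix z :: 'a assume "z \<in> thicken r (cball 0 s)"
  then obtain x where "norm x \<le> s" "norm (z - x) \<le> r" unfolding thicken_def by auto
  then show "z \<in> ball 0 t" using assms norm_triangle_sub[of z x] by simp
qed

lemma thicken_cube_subset:
  assumes "s + r < t"
  shows "thicken r {x :: real ^ 'd. \<forall>k. \<bar>x $ k\<bar> \<le> s} \<subseteq> {x. \<forall>k. \<bar>x $ k\<bar> < t}"
proof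
  fix z :: "real ^ 'd" assume "z \<in> thicken r {x :: real ^ 'd. \<forall>k. \<bar>x $ k\<bar> \<le> s}"
  then obtain x where x: "\<And>k. \<bar>x $ k\<bar> \<le> s" "norm (z - x) \<le> r" unfolding thicken_def by auto
  have "\<bar>z $ k\<bar> < t" for k
    using component_le_norm_cart[of "z - x" k] x(1)[of k] x(2) assms by simp
  then show "z \<in> {x. \<forall>k. \<bar>x $ k\<bar> < t}" by blast
qed

section \<open>Perturbations of an affine system\<close>

text \<open>The definition of closeness, read in terms of the affine maps: on the neighbourhood \<open>U\<close> of a
  piece, the coordinate change \<open>\<phi>\<close> is close to the identity and \<open>gen L \<circ> \<phi>\<close> to the affine generator.\<close>

lemma cantor_close_affine_dataE:
  fixes T :: "'a::euclidean_space set"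
  assumes sys: "affine_system N c A V T" and "0 < r" "cantor_close \<alpha> r \<delta> (affine_data N c A V T) L" "i < N"
  defines "U \<equiv> (+) (c i) ` open_thicken r T"
  assumes r: "thicken r T \<subseteq> V"
  obtains \<phi> \<Phi> D where "\<phi> ` U = star_piece r L i"
    "has_holder_deriv \<alpha> U \<phi> \<Phi> \<delta>" "\<And>x. x \<in> U \<Longrightarrow> norm (\<phi> x - (id_blinfun x + 0)) \<le> \<delta>"
    "\<And>x. x \<in> U \<Longrightarrow> norm (\<Phi> x - id_blinfun) \<le> \<delta>"
    "has_holder_deriv \<alpha> U (\<lambda>x. gen L (\<phi> x)) D \<delta>"
    "\<And>x. x \<in> U \<Longrightarrow> norm (gen L (\<phi> x) - (A i x + - A i (c i))) \<le> \<delta>"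
    "\<And>x. x \<in> U \<Longrightarrow> norm (D x - A i) \<le> \<delta>"
proof -
  let ?K = "affine_data N c A V T"
  have star: "star_piece r ?K i = U" unfolding U_def by (rule star_piece_affine_data[OF sys])
  have "C1_holder_close \<alpha> \<delta> (star_piece r ?K i) (gen ?K) (star_piece r L i) (gen L)"
    using assms(3) \<open>i < N\<close> unfolding cantor_close_def by simp
  then obtain \<phi> where \<phi>: "C1_holder_diffeo \<alpha> U (star_piece r L i) \<phi>"
    "C1_holder_norm_le \<alpha> U (\<lambda>x. \<phi> x - x) \<delta>" "C1_holder_norm_le \<alpha> U (\<lambda>x. gen L (\<phi> x) - gen ?K x) \<delta>"
    unfolding C1_holder_close_def star by blast
  have img: "\<phi> ` U = star_piece r L i" using \<phi>(1) unfolding C1_holder_diffeo_def homeomorphism_def by blast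
  have "open U" unfolding U_def by (intro open_translation open_open_thicken)
  have V: "x - c i \<in> V" if "x \<in> U" for x
    using subsetD[OF subset_trans[OF open_thicken_subset r], of "x - c i"] that
    unfolding U_def by (simp only: mem_translate_iff)
  obtain \<Phi> where \<Phi>: "has_holder_deriv \<alpha> U \<phi> \<Phi> \<delta>" "\<And>x. x \<in> U \<Longrightarrow> norm (\<phi> x - (id_blinfun x + 0)) \<le> \<delta>"
    "\<And>x. x \<in> U \<Longrightarrow> norm (\<Phi> x - id_blinfun) \<le> \<delta>"
    by (rule C1_holder_norm_le_affine[OF \<phi>(2) \<open>open U\<close>, of id_blinfun 0]) auto
  obtain D where D: "has_holder_deriv \<alpha> U (\<lambda>x. gen L (\<phi> x)) D \<delta>"
    "\<And>x. x \<in> U \<Longrightarrow> norm (gen L (\<phi> x) - (A i x + - A i (c i))) \<le> \<delta>"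
    "\<And>x. x \<in> U \<Longrightarrow> norm (D x - A i) \<le> \<delta>"
  proof (rule C1_holder_norm_le_affine[OF \<phi>(3) \<open>open U\<close>, of "A i" "- A i (c i)"])
    fix x assume "x \<in> U"
    then show "gen ?K x = A i x + - A i (c i)"
      using gen_affine_data[OF sys \<open>i < N\<close> V] by (simp add: blinfun.diff_right)
  qed auto
  show ?thesis using that[OF img \<Phi> D] .
qed

text \<open>The generator of a perturbation is expanding on each neighbourhood of a piece: up to the
  change of coordinates \<open>\<phi>\<close>, which is bi-Lipschitz with constants near 1, it is close to the affine
  map, which expands by the factor 4.\<close>

lemma cantor_close_orbit:
  fixes T :: "'a::euclidean_space set"
  assumes sys: "affine_system N c A V T" and r: "0 < r" "thicken r T \<subseteq> V"
    and close: "cantor_close \<alpha> r \<delta> (affine_data N c A V T) L" and "\<delta> \<le> 1/2"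
    and i: "\<And>n. i n < N" and orbit: "\<And>n. (gen L ^^ n) x \<in> star_piece r L (i n)"
  shows "x \<in> cantor_set L"
proof -
  let ?K = "affine_data N c A V T"
  have L: "regular_cantor \<alpha> L" "alphabet L = {..<N}" "symbolic_type L = subshift {..<N} ({..<N} \<times> {..<N})"
    using close unfolding cantor_close_def by auto
  have T: "compact T" "convex T" using sys unfolding affine_system_def by auto
  have adm: "(a, b) \<in> admissible L" if "a < N" "b < N" for a b
  proof -
    have "(\<lambda>n. if n = 0 then a else b) \<in> symbolic_type L" unfolding L(3) using that by (auto simp: subshift_def)
    then have "((if (0::nat) = 0 then a else b), (if Suc 0 = 0 then a else b)) \<in> admissible L"
      unfolding subshift_def by blast
    then show ?thesis by simp
  qed
  have pieces: "bounded (star_piece r L a) \<and>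
      (\<forall>p\<in>star_piece r L a. \<forall>q\<in>star_piece r L a. 2 * dist p q \<le> dist (gen L p) (gen L q))" if a: "a < N" for a
  proof -
    let ?U = "(+) (c a) ` open_thicken r T"
    obtain \<phi> \<Phi> D where \<phi>: "\<phi> ` ?U = star_piece r L a"
      "has_holder_deriv \<alpha> ?U \<phi> \<Phi> \<delta>" "\<And>x. x \<in> ?U \<Longrightarrow> norm (\<phi> x - (id_blinfun x + 0)) \<le> \<delta>"
      "\<And>x. x \<in> ?U \<Longrightarrow> norm (\<Phi> x - id_blinfun) \<le> \<delta>"
      "has_holder_deriv \<alpha> ?U (\<lambda>x. gen L (\<phi> x)) D \<delta>"
      "\<And>x. x \<in> ?U \<Longrightarrow> norm (D x - A a) \<le> \<delta>"
      using cantor_close_affine_dataE[OF sys r(1) close a r(2)] by metis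
    have cv: "convex ?U" using convex_translation[OF convex_open_thicken[OF T(2)]] by blast
    have "bounded ?U"
      using bounded_translation[OF bounded_subset[OF compact_imp_bounded[OF compact_thicken[OF T(1)]] open_thicken_subset]] by blast
    then obtain M where M: "\<And>x. x \<in> ?U \<Longrightarrow> norm x \<le> M" unfolding bounded_iff by blast
    have "norm p \<le> M + \<delta>" if "p \<in> star_piece r L a" for p
    proof -
      obtain x where "x \<in> ?U" "p = \<phi> x" using \<open>p \<in> star_piece r L a\<close> \<phi>(1) by blast
      then show ?thesis using M[of x] \<phi>(3)[of x] norm_triangle_sub[of "\<phi> x" x] by simp
    qed
    then have "bounded (star_piece r L a)" unfolding bounded_iff by blast
    moreover have "2 * dist p q \<le> dist (gen L p) (gen L q)" if pq: "p \<in> star_piece r L a" "q \<in> star_piece r L a" for p q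
    proof -
      obtain x y where xy: "x \<in> ?U" "p = \<phi> x" "y \<in> ?U" "q = \<phi> y" using pq \<phi>(1) by blast
      have e: "\<delta> * norm (x - y) \<le> 1/2 * norm (x - y)" using \<open>\<delta> \<le> 1/2\<close> by (intro mult_right_mono) auto
      have "norm ((p - q) - (x - y)) \<le> 1/2 * norm (x - y)"
        using near_affine_bilipschitz[OF \<phi>(2) cv \<phi>(4) xy(1,3)] e xy by simp
      then have 1: "norm (p - q) \<le> 3/2 * norm (x - y)" using norm_triangle_sub[of "p - q" "x - y"] by linarith
      have "norm ((gen L p - gen L q) - A a (x - y)) \<le> 1/2 * norm (x - y)"
        using near_affine_bilipschitz[OF \<phi>(5) cv \<phi>(6) xy(1,3)] e xy by simp
      moreover have "4 * norm (x - y) \<le> norm (A a (x - y))" by (rule affine_system_expanding[OF sys a])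
      ultimately have "7/2 * norm (x - y) \<le> norm (gen L p - gen L q)"
        using norm_triangle_sub[of "A a (x - y)" "gen L p - gen L q"]
        by (simp add: norm_minus_commute)
      then show ?thesis using 1 norm_ge_zero[of "x - y"] unfolding dist_norm by linarith
    qed
    ultimately show ?thesis by blast
  qed
  show ?thesis
  proof (rule expanding_orbit_in_cantor_set[OF L(1) _ _ r(1) _ _ orbit])
    show "i n \<in> alphabet L" for n using i L(2) by simp
    show "(i n, i (Suc n)) \<in> admissible L" for n using adm i by simp
    show "2 * dist p q \<le> dist (gen L p) (gen L q)"
      if "a \<in> alphabet L" "p \<in> star_piece r L a" "q \<in> star_piece r L a" for a p q
      using pieces[of a] that L(2) by simp
    show "bounded (star_piece r L a)" if "a \<in> alphabet L" for a using pieces[of a] that L(2) by simp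
  qed
qed

text \<open>The inverse branch is \<open>\<phi> \<circ> v\<close>, where \<open>v\<close> inverts \<open>gen L \<circ> \<phi>\<close>, a map close to an affine one.  In this
  form only maps defined on the fixed set \<open>U\<close> have to be estimated.\<close>

lemma perturbed_inverse_branch:
  fixes T :: "'a::euclidean_space set" and S :: "'a \<Rightarrow>\<^sub>L 'a"
  assumes sys: "affine_system N c A V T" and r: "0 < r" "thicken r T \<subseteq> V"
    and close: "cantor_close \<alpha> r \<delta> (affine_data N c A V T) L" and \<delta>: "0 \<le> \<delta>" "\<delta> \<le> 1/2"
    and \<alpha>: "0 \<le> \<alpha>" "\<alpha> \<le> 1" and i: "i < N"
    and S: "\<And>x. A i (S x) = x" "\<And>x. S (A i x) = x" "norm S \<le> 1"
    and W: "open W" "convex W" "\<And>y. y \<in> W \<Longrightarrow> cball (S y) \<delta> \<subseteq> open_thicken r T"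
  obtains f F where "has_holder_deriv \<alpha> W f F (20 * \<delta>)" "\<And>y. y \<in> W \<Longrightarrow> norm (F y - S) \<le> 4 * \<delta>"
    "\<And>y. y \<in> W \<Longrightarrow> norm (f y - (c i + S y)) \<le> 2 * \<delta>"
    "\<And>y. y \<in> W \<Longrightarrow> f y \<in> star_piece r L i" "\<And>y. y \<in> W \<Longrightarrow> gen L (f y) = y"
proof -
  let ?U = "(+) (c i) ` open_thicken r T"
  obtain \<phi> \<Phi> D where \<phi>: "\<phi> ` ?U = star_piece r L i"
    "has_holder_deriv \<alpha> ?U \<phi> \<Phi> \<delta>" "\<And>x. x \<in> ?U \<Longrightarrow> norm (\<phi> x - (id_blinfun x + 0)) \<le> \<delta>"
    "\<And>x. x \<in> ?U \<Longrightarrow> norm (\<Phi> x - id_blinfun) \<le> \<delta>"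
    "has_holder_deriv \<alpha> ?U (\<lambda>x. gen L (\<phi> x)) D \<delta>"
    "\<And>x. x \<in> ?U \<Longrightarrow> norm (gen L (\<phi> x) - (A i x + - A i (c i))) \<le> \<delta>"
    "\<And>x. x \<in> ?U \<Longrightarrow> norm (D x - A i) \<le> \<delta>"
    using cantor_close_affine_dataE[OF sys r(1) close i r(2)] by blast
  have cv: "convex ?U"
    using sys convex_translation[OF convex_open_thicken] unfolding affine_system_def by blast
  have centre: "S (y - - A i (c i)) = c i + S y" for y
    by (simp add: blinfun.add_right S)
  have "cball (S (y - - A i (c i))) \<delta> \<subseteq> ?U" if "y \<in> W" for y
  proof
    fix z assume "z \<in> cball (S (y - - A i (c i))) \<delta>"
    then have "z - c i \<in> cball (S y) \<delta>" unfolding centre by (simp add: dist_norm algebra_simps)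
    then show "z \<in> ?U" using W(3)[OF that] by (auto simp: mem_translate_iff)
  qed
  then obtain v Dv where v: "\<And>y. y \<in> W \<Longrightarrow> v y \<in> ?U" "\<And>y. y \<in> W \<Longrightarrow> gen L (\<phi> (v y)) = y"
    "\<And>y. y \<in> W \<Longrightarrow> norm (v y - S (y - - A i (c i))) \<le> \<delta>"
    "has_holder_deriv \<alpha> W v Dv (8 * \<delta>)" "\<And>y. y \<in> W \<Longrightarrow> norm (Dv y - S) \<le> 2 * \<delta>"
    using near_affine_inverse[OF \<phi>(5) cv W(1) S \<phi>(6,7) \<delta>(2,1) \<alpha>] by metis
  have nDv: "norm (Dv y) \<le> 2" if "y \<in> W" for y
    using v(5)[OF that] norm_triangle_sub[of "Dv y" S] S(3) \<delta> by linarith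
  have n\<Phi>: "norm (\<Phi> x) \<le> 3/2" if "x \<in> ?U" for x
    using \<phi>(4)[OF that] norm_triangle_sub[of "\<Phi> x" id_blinfun] norm_blinfun_id_le[where 'a='a] \<delta> by linarith
  show ?thesis
  proof (rule that)
    have "has_holder_deriv \<alpha> W (\<lambda>y. \<phi> (v y)) (\<lambda>y. \<Phi> (v y) o\<^sub>L Dv y) (\<delta> * 2 powr \<alpha> * 2 + 3/2 * (8 * \<delta>))"
      using v(1) nDv n\<Phi> by (intro has_holder_deriv_compose[OF \<phi>(2) v(4) W(2) _ \<alpha>(1) \<delta>(1)]) auto
    moreover have "\<delta> * 2 powr \<alpha> * 2 + 3/2 * (8 * \<delta>) \<le> 20 * \<delta>"
      using mult_left_mono[OF powr_2_le[OF \<alpha>(2)] \<delta>(1)] \<delta>(1) by linarith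
    ultimately show "has_holder_deriv \<alpha> W (\<lambda>y. \<phi> (v y)) (\<lambda>y. \<Phi> (v y) o\<^sub>L Dv y) (20 * \<delta>)"
      by (rule has_holder_deriv_mono)
    fix y assume y: "y \<in> W"
    have e: "(\<Phi> (v y) o\<^sub>L Dv y) - S = ((\<Phi> (v y) - id_blinfun) o\<^sub>L Dv y) + (Dv y - S)"
      by (rule blinfun_eqI) (simp add: blinfun.bilinear_simps)
    have "norm ((\<Phi> (v y) o\<^sub>L Dv y) - S) \<le> norm (\<Phi> (v y) - id_blinfun) * norm (Dv y) + norm (Dv y - S)"
      unfolding e by (rule order_trans[OF norm_triangle_ineq add_right_mono[OF norm_blinfun_compose]])
    also have "\<dots> \<le> \<delta> * 2 + 2 * \<delta>" using \<phi>(4)[OF v(1)[OF y]] nDv[OF y] v(5)[OF y] \<delta>(1) by (intro add_mono mult_mono) auto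
    finally show "norm ((\<Phi> (v y) o\<^sub>L Dv y) - S) \<le> 4 * \<delta>" by simp
    show "norm (\<phi> (v y) - (c i + S y)) \<le> 2 * \<delta>"
    proof -
      have e: "\<phi> (v y) - (c i + S y) = (\<phi> (v y) - v y) + (v y - (c i + S y))" by simp
      have "norm (\<phi> (v y) - v y) \<le> \<delta>" using \<phi>(3)[OF v(1)[OF y]] by simp
      moreover have "norm (v y - (c i + S y)) \<le> \<delta>" using v(3)[OF y] unfolding centre .
      ultimately show ?thesis
        unfolding e using norm_triangle_ineq[of "\<phi> (v y) - v y" "v y - (c i + S y)"] by linarith
    qed
    show "\<phi> (v y) \<in> star_piece r L i" using \<phi>(1) v(1)[OF y] by blast
    show "gen L (\<phi> (v y)) = y" by (rule v(2)[OF y])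
  qed
qed

text \<open>Here \<open>\<phi>\<close> itself has to be inverted, as \<open>gen L = (gen L \<circ> \<phi>) \<circ> \<phi>\<^sup>-\<^sup>1\<close>.  That \<open>\<phi>\<close> is close to the identity
  also shows that its image, the neighbourhood of the perturbed piece, covers the original piece.\<close>

lemma perturbed_gen_on_piece:
  fixes T :: "'a::euclidean_space set"
  assumes sys: "affine_system N c A V T" and r: "0 < r" "thicken r T \<subseteq> V"
    and close: "cantor_close \<alpha> r \<delta> (affine_data N c A V T) L" and \<delta>: "0 \<le> \<delta>" "\<delta> \<le> 1/2"
    and \<alpha>: "0 \<le> \<alpha>" "\<alpha> \<le> 1" and i: "i < N" and \<Lambda>: "norm (A i) \<le> \<Lambda>" "1 \<le> \<Lambda>"
    and W: "open W" "convex W" "\<And>y. y \<in> W \<Longrightarrow> cball (y - c i) \<delta> \<subseteq> open_thicken r T"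
  obtains G where "has_holder_deriv \<alpha> W (gen L) G (20 * \<Lambda> * \<delta>)"
    "\<And>y. y \<in> W \<Longrightarrow> norm (G y - A i) \<le> 4 * \<Lambda> * \<delta>"
    "\<And>y. y \<in> W \<Longrightarrow> norm (gen L y - A i (y - c i)) \<le> 2 * \<Lambda> * \<delta>" "W \<subseteq> star_piece r L i"
proof -
  let ?U = "(+) (c i) ` open_thicken r T"
  obtain \<phi> \<Phi> D where \<phi>: "\<phi> ` ?U = star_piece r L i"
    "has_holder_deriv \<alpha> ?U \<phi> \<Phi> \<delta>" "\<And>x. x \<in> ?U \<Longrightarrow> norm (\<phi> x - (id_blinfun x + 0)) \<le> \<delta>"
    "\<And>x. x \<in> ?U \<Longrightarrow> norm (\<Phi> x - id_blinfun) \<le> \<delta>"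
    "has_holder_deriv \<alpha> ?U (\<lambda>x. gen L (\<phi> x)) D \<delta>"
    "\<And>x. x \<in> ?U \<Longrightarrow> norm (gen L (\<phi> x) - (A i x + - A i (c i))) \<le> \<delta>"
    "\<And>x. x \<in> ?U \<Longrightarrow> norm (D x - A i) \<le> \<delta>"
    using cantor_close_affine_dataE[OF sys r(1) close i r(2)] by blast
  have cv: "convex ?U"
    using sys convex_translation[OF convex_open_thicken] unfolding affine_system_def by blast
  have "cball (id_blinfun (y - 0)) \<delta> \<subseteq> ?U" if "y \<in> W" for y
  proof
    fix z assume "z \<in> cball (id_blinfun (y - 0)) \<delta>"
    then have "z - c i \<in> cball (y - c i) \<delta>" by (simp add: dist_norm)
    then show "z \<in> ?U" using W(3)[OF that] by (auto simp: mem_translate_iff)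
  qed
  then obtain v Dv where v: "\<And>y. y \<in> W \<Longrightarrow> v y \<in> ?U" "\<And>y. y \<in> W \<Longrightarrow> \<phi> (v y) = y"
    "\<And>y. y \<in> W \<Longrightarrow> norm (v y - id_blinfun (y - 0)) \<le> \<delta>"
    "has_holder_deriv \<alpha> W v Dv (8 * \<delta>)" "\<And>y. y \<in> W \<Longrightarrow> norm (Dv y - id_blinfun) \<le> 2 * \<delta>"
    using near_affine_inverse[OF \<phi>(2) cv W(1) _ _ norm_blinfun_id_le \<phi>(3,4) \<delta>(2,1) \<alpha>]
    by (metis id_blinfun.rep_eq id_apply)
  have nDv: "norm (Dv y) \<le> 2" if "y \<in> W" for y
    using v(5)[OF that] norm_triangle_sub[of "Dv y" id_blinfun] norm_blinfun_id_le[where 'a='a] \<delta> by linarith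
  have nD: "norm (D x) \<le> \<Lambda> + 1/2" if "x \<in> ?U" for x
    using \<phi>(7)[OF that] norm_triangle_sub[of "D x" "A i"] \<Lambda> \<delta> by linarith
  show ?thesis
  proof (rule that)
    have comp: "has_holder_deriv \<alpha> W (\<lambda>y. gen L (\<phi> (v y))) (\<lambda>y. D (v y) o\<^sub>L Dv y)
        (\<delta> * 2 powr \<alpha> * 2 + (\<Lambda> + 1/2) * (8 * \<delta>))"
      using v(1) nDv nD by (intro has_holder_deriv_compose[OF \<phi>(5) v(4) W(2) _ \<alpha>(1) \<delta>(1)]) auto
    have "\<delta> * 2 powr \<alpha> * 2 + (\<Lambda> + 1/2) * (8 * \<delta>) \<le> 20 * \<Lambda> * \<delta>"
    proof -
      have "\<delta> \<le> \<Lambda> * \<delta>" using \<Lambda>(2) \<delta>(1) by (simp add: mult_le_cancel_right1)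
      then show ?thesis
        using mult_left_mono[OF powr_2_le[OF \<alpha>(2)] \<delta>(1)] \<delta>(1) by (simp add: algebra_simps)
    qed
    then have "has_holder_deriv \<alpha> W (\<lambda>y. gen L (\<phi> (v y))) (\<lambda>y. D (v y) o\<^sub>L Dv y) (20 * \<Lambda> * \<delta>)"
      using comp has_holder_deriv_mono by blast
    then show "has_holder_deriv \<alpha> W (gen L) (\<lambda>y. D (v y) o\<^sub>L Dv y) (20 * \<Lambda> * \<delta>)"
      by (rule has_holder_deriv_cong[OF _ W(1)]) (simp add: v(2))
    have d\<Lambda>: "\<delta> \<le> \<Lambda> * \<delta>" using \<Lambda>(2) \<delta>(1) by (simp add: mult_le_cancel_right1)
    fix y assume y: "y \<in> W"
    have "(D (v y) o\<^sub>L Dv y) - A i = ((D (v y) - A i) o\<^sub>L Dv y) + (A i o\<^sub>L (Dv y - id_blinfun))"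
      by (rule blinfun_eqI) (simp add: blinfun.bilinear_simps)
    then have "norm ((D (v y) o\<^sub>L Dv y) - A i) \<le> norm (D (v y) - A i) * norm (Dv y) + norm (A i) * norm (Dv y - id_blinfun)"
      using norm_triangle_ineq[of "(D (v y) - A i) o\<^sub>L Dv y" "A i o\<^sub>L (Dv y - id_blinfun)"]
        norm_blinfun_compose[of "D (v y) - A i" "Dv y"] norm_blinfun_compose[of "A i" "Dv y - id_blinfun"] by simp
    also have "\<dots> \<le> \<delta> * 2 + \<Lambda> * (2 * \<delta>)"
      using \<phi>(7)[OF v(1)[OF y]] nDv[OF y] v(5)[OF y] \<delta>(1) \<Lambda> by (intro add_mono mult_mono) auto
    finally show "norm ((D (v y) o\<^sub>L Dv y) - A i) \<le> 4 * \<Lambda> * \<delta>" using d\<Lambda> by linarith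
    have "gen L y - A i (y - c i) = (gen L (\<phi> (v y)) - (A i (v y) + - A i (c i))) + A i (v y - y)"
      using v(2)[OF y] by (simp add: blinfun.bilinear_simps)
    then have "norm (gen L y - A i (y - c i)) \<le> \<delta> + norm (A i (v y - y))"
      using norm_triangle_ineq[of "gen L (\<phi> (v y)) - (A i (v y) + - A i (c i))" "A i (v y - y)"] \<phi>(6)[OF v(1)[OF y]] by simp
    also have "norm (A i (v y - y)) \<le> \<Lambda> * \<delta>"
      using norm_blinfun[of "A i" "v y - y"] v(3)[OF y] mult_mono[OF \<Lambda>(1) v(3)[OF y]] \<Lambda> by simp
    finally show "norm (gen L y - A i (y - c i)) \<le> 2 * \<Lambda> * \<delta>" using d\<Lambda> by simp
  next
    show "W \<subseteq> star_piece r L i"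
    proof
      fix y assume "y \<in> W"
      then show "y \<in> star_piece r L i" using \<phi>(1) v(1,2) by (metis imageI)
    qed
  qed
qed

section \<open>Renormalization of relative placements\<close>

text \<open>If \<open>h\<^sub>n\<close> is the \<open>n\<close>-th placement and \<open>F\<^sub>n = f\<^sub>0 \<circ> \<dots> \<circ> f\<^sub>n\<^sub>-\<^sub>1\<close>, then \<open>h\<^sub>n = g'\<^sup>n \<circ> F\<^sub>n\<close>, while
  \<open>g\<^sup>n\<close> undoes \<open>F\<^sub>n\<close>.  A point in all the compact sets \<open>F\<^sub>n(C)\<close> therefore has both orbits under
  control.\<close>

lemma nested_intersection:
  fixes f :: "nat \<Rightarrow> 'a::euclidean_space \<Rightarrow> 'a"
  assumes start: "good id"
    and step: "\<And>h. good h \<Longrightarrow> \<exists>i\<in>I. \<exists>j\<in>J. (\<forall>x\<in>D. h (f i x) \<in> W j) \<and> good (g' \<circ> h \<circ> f i)"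
    and C: "compact C" "C \<noteq> {}" "C \<subseteq> D" and f: "\<And>i. i \<in> I \<Longrightarrow> continuous_on D (f i)" "\<And>i. i \<in> I \<Longrightarrow> f i ` D \<subseteq> C"
    and inv: "\<And>i y. i \<in> I \<Longrightarrow> y \<in> D \<Longrightarrow> g (f i y) = y"
  obtains x i j where "\<And>n. i n \<in> I" "\<And>n. j n \<in> J" "\<And>n. (g ^^ n) x \<in> f (i n) ` D" "\<And>n. (g' ^^ n) x \<in> W (j n)"
proof -
  have "\<exists>h. \<forall>n. (good (h n) \<and> (n = 0 \<longrightarrow> h n = id)) \<and> (\<exists>i\<in>I. \<exists>j\<in>J.
      (\<forall>x\<in>D. h n (f i x) \<in> W j) \<and> h (Suc n) = g' \<circ> h n \<circ> f i)"
  proof (rule dependent_nat_choice[where P="\<lambda>n h. good h \<and> (n = 0 \<longrightarrow> h = id)" and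
        Q="\<lambda>n h h'. \<exists>i\<in>I. \<exists>j\<in>J. (\<forall>x\<in>D. h (f i x) \<in> W j) \<and> h' = g' \<circ> h \<circ> f i"])
    show "\<exists>h. good h \<and> ((0::nat) = 0 \<longrightarrow> h = id)" using start by blast
    show "\<exists>h'. (good h' \<and> (Suc n = 0 \<longrightarrow> h' = id)) \<and> (\<exists>i\<in>I. \<exists>j\<in>J. (\<forall>x\<in>D. h (f i x) \<in> W j) \<and>
        h' = g' \<circ> h \<circ> f i)" if "good h \<and> (n = 0 \<longrightarrow> h = id)" for h n
      using step[OF conjunct1[OF that]] by auto
  qed
  then obtain h where h: "h 0 = id" "\<forall>n. \<exists>i\<in>I. \<exists>j\<in>J. (\<forall>x\<in>D. h n (f i x) \<in> W j) \<and> h (Suc n) = g' \<circ> h n \<circ> f i"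
    by blast
  obtain i where i: "\<forall>n. i n \<in> I \<and> (\<exists>j\<in>J. (\<forall>x\<in>D. h n (f (i n) x) \<in> W j) \<and> h (Suc n) = g' \<circ> h n \<circ> f (i n))"
    using h(2) unfolding Bex_def by metis
  obtain j where j: "\<forall>n. j n \<in> J \<and> (\<forall>x\<in>D. h n (f (i n) x) \<in> W (j n))"
    using i unfolding Bex_def by metis
  have hs: "h (Suc n) = g' \<circ> h n \<circ> f (i n)" for n using i by blast
  have fD: "f (i n) ` D \<subseteq> C" for n using f(2) i by blast
  define F where "F = rec_nat id (\<lambda>n Fn. Fn \<circ> f (i n))"
  have F: "F 0 = id" "F (Suc n) = F n \<circ> f (i n)" for n by (simp_all add: F_def)
  have hF: "h n = (g' ^^ n) \<circ> F n" for n
    by (induction n) (simp_all add: h(1) F hs o_assoc)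
  have gF: "(g ^^ n) (F n y) = y" if "y \<in> D" for n y using that
  proof (induction n arbitrary: y)
    case (Suc n)
    then have "f (i n) y \<in> D" using fD C(3) by blast
    then have "(g ^^ n) (F n (f (i n) y)) = f (i n) y" by (rule Suc.IH)
    then show ?case using inv[of "i n" y] i Suc.prems by (simp add: F(2))
  qed (simp add: F)
  have cont: "continuous_on D (F n)" for n
  proof (induction n)
    case (Suc n)
    have "continuous_on (f (i n) ` D) (F n)" using Suc fD C(3) continuous_on_subset by blast
    then show ?case unfolding F(2) using f(1) i continuous_on_compose by blast
  qed (simp add: F)
  have "\<Inter>(range (\<lambda>n. F n ` C)) \<noteq> {}"
  proof (rule compact_nest)
    show "compact (F n ` C)" for n using C cont continuous_on_subset compact_continuous_image by metis
    show "F n ` C \<noteq> {}" for n using C(2) by simp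
    have "F (Suc n) ` C \<subseteq> F n ` C" for n
    proof -
      have "f (i n) ` C \<subseteq> C" using fD C(3) by blast
      then show ?thesis unfolding F(2) image_comp[symmetric] by (rule image_mono)
    qed
    then show "F n ` C \<subseteq> F m ` C" if "m \<le> n" for m n using that by (rule lift_Suc_antimono_le)
  qed
  then obtain x where x: "\<And>n. x \<in> F n ` C" by blast
  show ?thesis
  proof (rule that[of i j x])
    show "i n \<in> I" "j n \<in> J" for n using i j by auto
    fix n
    obtain y where y: "y \<in> D" "x = F n (f (i n) y)" using x[of "Suc n"] C(3) unfolding F(2) by auto
    have fy: "f (i n) y \<in> D" using y(1) fD C(3) by blast
    show "(g ^^ n) x \<in> f (i n) ` D" unfolding y(2) gF[OF fy] using y(1) by blast
    have "(g' ^^ n) x = h n (f (i n) y)" unfolding hF y(2) by simp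
    then show "(g' ^^ n) x \<in> W (j n)" using j y(1) by auto
  qed
qed

text \<open>The strips of width \<open>w\<close> about the hyperplanes \<open>y\<^sub>k \<in> 4\<int> + 2\<close> contain the gaps of the grid.  Two points
  whose \<open>k\<close>-th coordinates differ by more than \<open>w\<close> and less than \<open>4 - w\<close> cannot both lie in strips of
  direction \<open>k\<close>, so \<open>d\<close> directions cannot spoil \<open>d + 1\<close> points.\<close>

lemma exists_point_off_strips:
  fixes p :: "nat \<Rightarrow> real ^ 'd"
  assumes sep: "\<And>l l' k. l < l' \<Longrightarrow> l' \<le> CARD('d) \<Longrightarrow> w < \<bar>p l $ k - p l' $ k\<bar> \<and> \<bar>p l $ k - p l' $ k\<bar> < 4 - w"
  obtains l where "l \<le> CARD('d)" "\<And>k. \<exists>z::int. \<bar>p l $ k - 4 * of_int z\<bar> \<le> 2 - w / 2"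
proof -
  have "\<exists>l\<le>CARD('d). \<forall>k. \<exists>z::int. \<bar>p l $ k - 4 * of_int z\<bar> \<le> 2 - w / 2"
  proof (rule ccontr)
    assume "\<not> ?thesis"
    then obtain k where k: "\<And>l z. l \<le> CARD('d) \<Longrightarrow> \<bar>p l $ k l - 4 * of_int (z::int)\<bar> > 2 - w / 2"
      by (metis not_le)
    have strip: "\<exists>u::int. \<bar>p l $ k l - (4 * of_int u + 2)\<bar> < w / 2" if l: "l \<le> CARD('d)" for l
    proof -
      define z where "z = \<lfloor>(p l $ k l + 2) / 4\<rfloor>"
      have z: "4 * of_int z \<le> p l $ k l + 2" "p l $ k l + 2 < 4 * of_int z + 4"
        using floor_correct[of "(p l $ k l + 2) / 4"] unfolding z_def by (simp_all add: field_simps)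
      show ?thesis
      proof (cases "p l $ k l \<le> 4 * of_int z")
        case True
        then show ?thesis using z k[OF l, of z] by (intro exI[of _ "z - 1"]) (simp add: abs_if split: if_splits)
      next
        case False
        then show ?thesis using z k[OF l, of z] by (intro exI[of _ z]) (simp add: abs_if split: if_splits)
      qed
    qed
    have "\<not> inj_on k {..CARD('d)}"
    proof
      assume "inj_on k {..CARD('d)}"
      then have "card {..CARD('d)} \<le> CARD('d)" by (metis card_inj_on_le finite subset_UNIV)
      then show False by simp
    qed
    then obtain l l' where ll: "l \<le> CARD('d)" "l' \<le> CARD('d)" "k l = k l'" "l < l'"
      unfolding inj_on_def by (metis atMost_iff linorder_neqE_nat)
    obtain u u' :: int where u: "\<bar>p l $ k l - (4 * of_int u + 2)\<bar> < w / 2" "\<bar>p l' $ k l - (4 * of_int u' + 2)\<bar> < w / 2"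
      using strip ll by metis
    have s: "w < \<bar>p l $ k l - p l' $ k l\<bar>" "\<bar>p l $ k l - p l' $ k l\<bar> < 4 - w" using sep[OF ll(4,2)] by auto
    have "\<bar>4 * real_of_int u - 4 * of_int u'\<bar> < 4" using u s by linarith
    then have "u = u'" by linarith
    then show False using u s by linarith
  qed
  then show ?thesis using that by blast
qed

text \<open>With \<open>X = H - I\<close> one has \<open>\<lambda>HS - I = \<lambda>(X - \<theta>Y)S\<close>.  Subtracting \<open>\<theta>Y\<close>, where
  \<open>Y\<close> is close to \<open>X/\<kappa>\<close>, lowers the bound \<open>\<kappa>\<close> for \<open>X\<close> by three quarters of \<open>\<theta>\<close>; the factor \<open>\<lambda>S\<close> has norm at most \<open>1/(1 - \<theta>)\<close> and costs only \<open>\<theta>\<kappa>\<close>.\<close>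

lemma linear_correction:
  fixes H S Y :: "'a::euclidean_space \<Rightarrow>\<^sub>L 'a"
  assumes "norm (H - id_blinfun) \<le> \<kappa>" and \<kappa>: "0 < \<kappa>" "\<kappa> \<le> 1/4" and \<theta>: "0 < \<theta>" "\<theta> \<le> \<kappa>" and "0 < lam"
    and Y: "norm ((1 / \<kappa>) *\<^sub>R (H - id_blinfun) - Y) \<le> 1/4"
    and S: "\<And>x. lam *\<^sub>R (S x + \<theta> *\<^sub>R Y (S x)) = x" "norm S \<le> 1 / (lam * (1 - \<theta>))"
  shows "norm (lam *\<^sub>R (H o\<^sub>L S) - id_blinfun) \<le> \<kappa> - \<theta> / 2"
proof -
  let ?X = "H - id_blinfun"
  have "lam *\<^sub>R (H o\<^sub>L S) - id_blinfun = lam *\<^sub>R ((?X - \<theta> *\<^sub>R Y) o\<^sub>L S)"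
  proof (rule blinfun_eqI)
    fix x
    have "blinfun_apply (lam *\<^sub>R (H o\<^sub>L S) - id_blinfun) x = lam *\<^sub>R H (S x) - lam *\<^sub>R (S x + \<theta> *\<^sub>R Y (S x))"
      by (simp add: blinfun.bilinear_simps S(1))
    also have "\<dots> = blinfun_apply (lam *\<^sub>R ((?X - \<theta> *\<^sub>R Y) o\<^sub>L S)) x"
      by (simp add: blinfun.bilinear_simps algebra_simps)
    finally show "blinfun_apply (lam *\<^sub>R (H o\<^sub>L S) - id_blinfun) x = blinfun_apply (lam *\<^sub>R ((?X - \<theta> *\<^sub>R Y) o\<^sub>L S)) x" .
  qed
  then have "norm (lam *\<^sub>R (H o\<^sub>L S) - id_blinfun) \<le> lam * (norm (?X - \<theta> *\<^sub>R Y) * norm S)"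
    using norm_blinfun_compose[of "?X - \<theta> *\<^sub>R Y" S] \<open>0 < lam\<close> by simp
  moreover have XY: "norm (?X - \<theta> *\<^sub>R Y) \<le> \<kappa> - 3/4 * \<theta>"
  proof -
    have "?X - \<theta> *\<^sub>R Y = (1 - \<theta> / \<kappa>) *\<^sub>R ?X + \<theta> *\<^sub>R ((1 / \<kappa>) *\<^sub>R ?X - Y)"
      by (simp add: algebra_simps)
    then have "norm (?X - \<theta> *\<^sub>R Y) \<le> norm ((1 - \<theta> / \<kappa>) *\<^sub>R ?X) + norm (\<theta> *\<^sub>R ((1 / \<kappa>) *\<^sub>R ?X - Y))"
      by (metis norm_triangle_ineq)
    also have "norm ((1 - \<theta> / \<kappa>) *\<^sub>R ?X) = (1 - \<theta> / \<kappa>) * norm ?X" using \<theta> \<kappa> by simp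
    also have "\<dots> \<le> (1 - \<theta> / \<kappa>) * \<kappa>" using assms(1) \<theta> \<kappa> by (intro mult_left_mono) auto
    also have "norm (\<theta> *\<^sub>R ((1 / \<kappa>) *\<^sub>R ?X - Y)) \<le> \<theta> * (1/4)"
      unfolding norm_scaleR using Y \<theta> by (intro mult_mono) auto
    also have "(1 - \<theta> / \<kappa>) * \<kappa> + \<theta> * (1/4) = \<kappa> - 3/4 * \<theta>" using \<kappa> by (simp add: field_simps)
    finally show ?thesis by simp
  qed
  moreover have "lam * (norm (?X - \<theta> *\<^sub>R Y) * norm S) \<le> lam * ((\<kappa> - 3/4 * \<theta>) * (1 / (lam * (1 - \<theta>))))"
    using XY S(2) \<open>0 < lam\<close> \<theta> \<kappa> by (intro mult_left_mono mult_mono) auto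
  ultimately have "norm (lam *\<^sub>R (H o\<^sub>L S) - id_blinfun) \<le> lam * ((\<kappa> - 3/4 * \<theta>) * (1 / (lam * (1 - \<theta>))))"
    by linarith
  also have "\<dots> = (\<kappa> - 3/4 * \<theta>) / (1 - \<theta>)" using \<open>0 < lam\<close> by simp
  also have "\<dots> \<le> \<kappa> - \<theta> / 2"
  proof -
    have "\<theta> * \<kappa> \<le> \<theta> * (1/4)" using \<theta> \<kappa> by (intro mult_left_mono) auto
    moreover have "0 \<le> \<theta> * \<theta>" by simp
    moreover have "(\<kappa> - \<theta> / 2) * (1 - \<theta>) = \<kappa> - \<theta> / 2 - \<theta> * \<kappa> + \<theta> * \<theta> / 2" by (simp add: field_simps)
    ultimately have "\<kappa> - 3/4 * \<theta> \<le> (\<kappa> - \<theta> / 2) * (1 - \<theta>)" by linarith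
    then show ?thesis using \<theta> \<kappa> by (simp add: pos_divide_le_eq)
  qed
  finally show ?thesis .
qed

lemma norm_const_vec:
  fixes a :: real
  shows "norm ((\<chi> k. a) :: real ^ 'n) \<le> CARD('n) * \<bar>a\<bar>"
  using norm_le_l1_cart[of "(\<chi> k. a) :: real ^ 'n"] by simp

text \<open>The data of one renormalization step.  \<open>S i\<close> is the linear part of the \<open>i\<close>-th unperturbed inverse
  branch of the first system, and \<open>f i\<close> with derivative \<open>F i\<close> is the perturbed branch.  On the cube
  with centre \<open>e j\<close> the generator \<open>g\<close> of the perturbed second system, with derivative \<open>G j\<close>, is close
  to \<open>y \<mapsto> \<lambda> (y - e j)\<close>.  The size of all perturbations is \<open>\<eta>\<close>.  The branches \<open>i\<close> with the same
  quotient \<open>m\<close> by \<open>d + 1\<close> share the correction \<open>Y m\<close>.\<close>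

locale renormalization =
  fixes \<alpha> \<kappa> \<theta> \<tau> \<gamma> lam \<eta> :: real and M n :: nat
    and Y :: "nat \<Rightarrow> (real ^ 'd) \<Rightarrow>\<^sub>L (real ^ 'd)"
    and S :: "nat \<Rightarrow> (real ^ 'd) \<Rightarrow>\<^sub>L (real ^ 'd)"
    and f :: "nat \<Rightarrow> (real ^ 'd) \<Rightarrow> (real ^ 'd)" and F :: "nat \<Rightarrow> (real ^ 'd) \<Rightarrow> (real ^ 'd) \<Rightarrow>\<^sub>L (real ^ 'd)"
    and J :: "nat set" and e :: "nat \<Rightarrow> real ^ 'd"
    and g :: "(real ^ 'd) \<Rightarrow> (real ^ 'd)" and G :: "nat \<Rightarrow> (real ^ 'd) \<Rightarrow> (real ^ 'd) \<Rightarrow>\<^sub>L (real ^ 'd)"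
  assumes \<alpha>: "0 \<le> \<alpha>"
    and \<kappa>: "0 < \<kappa>" "\<kappa> \<le> 1/4" "\<kappa> * CARD('d) \<le> 1/2"
    and \<theta>: "0 < \<theta>" "\<theta> \<le> \<kappa>"
    and \<gamma>: "0 < \<gamma>" "24 * \<gamma> \<le> \<tau>" "\<gamma> \<le> 1/4"
    and lam: "5 \<le> lam * \<gamma>" "(2 / lam) powr \<alpha> \<le> 1/8" "lam * (2 - \<gamma>) = 4 * real n + 2"
    and \<eta>: "0 < \<eta>" "46 * lam * \<eta> \<le> \<theta>"
    and \<tau>: "\<tau> * CARD('d) * (M * Suc CARD('d)) \<le> 1/2"
    and net: "\<And>X. norm X \<le> 1 \<Longrightarrow> \<exists>m<M. norm (X - Y m) \<le> 1/4"
    and S: "\<And>i x. i < M * Suc CARD('d) \<Longrightarrow> lam *\<^sub>R (S i x + \<theta> *\<^sub>R Y (i div Suc CARD('d)) (S i x)) = x"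
      "\<And>i. i < M * Suc CARD('d) \<Longrightarrow> norm (S i) \<le> 1 / (lam * (1 - \<theta>))"
    and f: "\<And>i. i < M * Suc CARD('d) \<Longrightarrow> has_holder_deriv \<alpha> (ball 0 1) (f i) (F i) \<eta>"
      "\<And>i y. i < M * Suc CARD('d) \<Longrightarrow> y \<in> ball 0 1 \<Longrightarrow> norm (F i y - S i) \<le> \<eta>"
      "\<And>i y. i < M * Suc CARD('d) \<Longrightarrow> y \<in> ball 0 1 \<Longrightarrow> norm (f i y - ((\<chi> k. \<tau> * i) + S i y)) \<le> \<eta>"
    and e: "\<And>z :: 'd \<Rightarrow> int. (\<And>k. \<bar>z k\<bar> \<le> int n) \<Longrightarrow> \<exists>j\<in>J. e j = (\<chi> k. 4 * of_int (z k))"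
    and g: "\<And>j. j \<in> J \<Longrightarrow> has_holder_deriv \<alpha> {y. \<forall>k. \<bar>y $ k - e j $ k\<bar> < 2 - \<gamma>} g (G j) \<eta>"
      "\<And>j y. j \<in> J \<Longrightarrow> \<forall>k. \<bar>y $ k - e j $ k\<bar> < 2 - \<gamma> \<Longrightarrow> norm (G j y - lam *\<^sub>R id_blinfun) \<le> \<eta>"
      "\<And>j y. j \<in> J \<Longrightarrow> \<forall>k. \<bar>y $ k - e j $ k\<bar> < 2 - \<gamma> \<Longrightarrow> norm (g y - lam *\<^sub>R (y - e j)) \<le> \<eta>"
begin

text \<open>The value \<open>10 \<lambda> \<eta>\<close> is a Hoelder constant which a step reproduces: it is contracted to at most its
  half, and the perturbations add at most \<open>5 \<lambda> \<eta>\<close>.  The bound \<open>4 n + 2\<close> is the half side of the cube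
  that contains the grid.\<close>

definition near_identity :: "((real ^ 'd) \<Rightarrow> (real ^ 'd)) \<Rightarrow> bool" where
  "near_identity h \<longleftrightarrow> (\<exists>H. has_holder_deriv \<alpha> (ball 0 1) h H (10 * lam * \<eta>) \<and>
     (\<forall>x\<in>ball 0 1. norm (H x - id_blinfun) \<le> \<kappa>) \<and> (\<forall>x\<in>ball 0 1. \<forall>k. \<bar>h x $ k\<bar> \<le> 4 * real n + 2))"

lemma lam_ge: "20 \<le> lam"
proof -
  have "0 < lam * \<gamma>" using lam(1) by linarith
  then have "0 < lam" using \<gamma>(1) by (simp add: zero_less_mult_iff)
  then have "lam * \<gamma> \<le> lam * (1/4)" using \<gamma>(3) by (intro mult_left_mono) auto
  then show ?thesis using lam(1) by linarith
qed

lemma lam_\<eta>: "lam * \<eta> \<le> 1/184" using \<eta> \<theta> \<kappa> by linarith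

lemma \<eta>_small: "\<eta> \<le> 1/3000"
proof -
  have "20 * \<eta> \<le> lam * \<eta>" using lam_ge \<eta>(1) by (intro mult_right_mono) auto
  then show ?thesis using lam_\<eta> by linarith
qed

lemma \<eta>_rho: "\<eta> \<le> 1 / (184 * lam)"
  using lam_\<eta> lam_ge by (simp add: pos_le_divide_eq mult_ac)

lemma norm_S: "i < M * Suc CARD('d) \<Longrightarrow> norm (S i) \<le> 4 / (3 * lam)"
proof -
  assume i: "i < M * Suc CARD('d)"
  have "1 / (lam * (1 - \<theta>)) \<le> 1 / (lam * (3/4))"
    using lam_ge \<theta> \<kappa> by (intro divide_left_mono mult_left_mono mult_pos_pos) auto
  then show ?thesis using S(2)[OF i] by simp
qed

lemma norm_F: "i < M * Suc CARD('d) \<Longrightarrow> y \<in> ball 0 1 \<Longrightarrow> norm (F i y) \<le> 2 / lam"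
proof -
  assume i: "i < M * Suc CARD('d)" "y \<in> ball 0 1"
  have "norm (F i y) \<le> 4 / (3 * lam) + 1 / (184 * lam)"
    using norm_triangle_sub[of "F i y" "S i"] f(2)[OF i] norm_S[OF i(1)] \<eta>_rho by linarith
  also have "\<dots> \<le> 2 / lam" using lam_ge by (simp add: field_simps)
  finally show ?thesis .
qed

lemma f_into: 
  assumes i: "i < M * Suc CARD('d)" "y \<in> ball 0 1"
  shows "f i y \<in> cball 0 (3/4)"
proof -
  have "0 < \<tau>" using \<gamma> by linarith
  have "norm (\<chi> k::'d. \<tau> * i) \<le> CARD('d) * \<bar>\<tau> * i\<bar>" by (rule norm_const_vec)
  also have "\<dots> = \<tau> * CARD('d) * i" using \<open>0 < \<tau>\<close> by (simp add: abs_mult)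
  also have "\<dots> \<le> \<tau> * CARD('d) * real (M * Suc CARD('d))" using \<open>0 < \<tau>\<close> i(1) by (intro mult_left_mono) (auto simp del: of_nat_mult)
  also have "\<dots> \<le> 1/2" using \<tau> by simp
  finally have c: "norm (\<chi> k::'d. \<tau> * i) \<le> 1/2" .
  have "norm (S i y) \<le> norm (S i) * 1" using norm_blinfun[of "S i" y] i(2) mult_left_mono[of "norm y" 1 "norm (S i)"] by simp
  also have "\<dots> \<le> 4 / (3 * lam)" using norm_S[OF i(1)] by simp
  also have "\<dots> \<le> 1/15" using lam_ge by (simp add: field_simps)
  finally have s: "norm (S i y) \<le> 1/15" .
  have "norm (f i y) \<le> norm ((\<chi> k::'d. \<tau> * i) + S i y) + \<eta>"
    using norm_triangle_sub[of "f i y" "(\<chi> k::'d. \<tau> * i) + S i y"] f(3)[OF i] by linarith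
  also have "\<dots> \<le> 1/2 + 1/15 + \<eta>" using norm_triangle_ineq[of "\<chi> k::'d. \<tau> * i" "S i y"] c s by linarith
  finally show ?thesis using \<eta>_small by simp
qed

lemma near_identity_id: "near_identity id"
  unfolding near_identity_def
proof (intro exI[of _ "\<lambda>_. id_blinfun"] conjI ballI allI)
  have 0: "0 \<le> 10 * lam * \<eta>" using lam_ge \<eta> by simp
  show "has_holder_deriv \<alpha> (ball 0 1) id (\<lambda>_. id_blinfun) (10 * lam * \<eta>)"
    unfolding has_holder_deriv_def using 0 by (auto simp: id_def id_blinfun.rep_eq)
  fix x :: "real ^ 'd" and k assume "x \<in> ball 0 1"
  then have "norm x < 1" by simp
  then have "\<bar>x $ k\<bar> < 1" using component_le_norm_cart[of x k] by linarith
  then show "\<bar>id x $ k\<bar> \<le> 4 * real n + 2" by simp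
qed (use \<kappa> in simp)

text \<open>The class of placements is invariant.  The derivative at the origin selects the correction \<open>Y m\<close>, the
  gaps then select one of the \<open>d + 1\<close> branches with this correction, and the position of the image
  selects the piece of the second system.\<close>

lemma near_identity_step:
  assumes "near_identity h"
  obtains i j where "i < M * Suc CARD('d)" "j \<in> J" "\<And>x. x \<in> ball 0 1 \<Longrightarrow> \<forall>k. \<bar>h (f i x) $ k - e j $ k\<bar> < 2 - \<gamma>"
    "near_identity (g \<circ> h \<circ> f i)"
proof -
  let ?d = "CARD('d)" and ?B = "ball (0 :: real ^ 'd) 1"
  obtain H where H: "has_holder_deriv \<alpha> ?B h H (10 * lam * \<eta>)" "\<And>x. x \<in> ?B \<Longrightarrow> norm (H x - id_blinfun) \<le> \<kappa>"
    and hR: "\<And>x k. x \<in> ?B \<Longrightarrow> \<bar>h x $ k\<bar> \<le> 4 * real n + 2"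
    using assms unfolding near_identity_def by blast
  have lam0: "0 < lam" using lam_ge by linarith
  have \<tau>0: "0 < \<tau>" using \<gamma> by linarith
  have B0: "(0 :: real ^ 'd) \<in> ?B" by simp
  have fB: "f i y \<in> ?B" if "i < M * Suc CARD('d)" "y \<in> ?B" for i y using f_into[OF that] by simp
  have hlip: "norm ((h x - h y) - (x - y)) \<le> \<kappa> * norm (x - y)" if "x \<in> ?B" "y \<in> ?B" for x y
    using near_affine_bilipschitz[OF H(1) convex_ball H(2) that] by simp
  have hdist: "norm (h x - h y) \<le> 5/4 * norm (x - y)" if "x \<in> ?B" "y \<in> ?B" for x y
    using hlip[OF that] norm_triangle_sub[of "h x - h y" "x - y"]
      mult_right_mono[OF \<kappa>(2) norm_ge_zero[of "x - y"]] by linarith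
  have "norm ((1 / \<kappa>) *\<^sub>R (H 0 - id_blinfun)) \<le> 1" 
    unfolding norm_scaleR using H(2)[OF B0] \<kappa>(1) by (simp add: field_simps del: scaleR_diff_right)
  then obtain m where m: "m < M" "norm ((1 / \<kappa>) *\<^sub>R (H 0 - id_blinfun) - Y m) \<le> 1/4" using net by blast
  have iN: "m * Suc ?d + l < M * Suc CARD('d)" if "l \<le> ?d" for l
  proof -
    have "m * Suc ?d + l < (m + 1) * Suc ?d" using that by simp
    also have "\<dots> \<le> M * Suc CARD('d)" using m(1) by (intro mult_right_mono) auto
    finally show ?thesis .
  qed
  define p where "p l = h (f (m * Suc ?d + l) 0)" for l
  have sep: "6 * \<gamma> < \<bar>p l $ k - p l' $ k\<bar> \<and> \<bar>p l $ k - p l' $ k\<bar> < 4 - 6 * \<gamma>" if l: "l < l'" "l' \<le> ?d" for l l' k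
  proof -
    let ?i = "m * Suc ?d + l" and ?i' = "m * Suc ?d + l'"
    let ?q = "f ?i 0" and ?q' = "f ?i' 0"
    define a where "a = \<tau> * (real l' - real l)"
    have i: "?i < M * Suc CARD('d)" "?i' < M * Suc CARD('d)" using iN l by auto
    have "\<tau> * 1 \<le> a" unfolding a_def using \<tau>0 l by (intro mult_left_mono) auto
    then have a: "\<tau> \<le> a" by simp
    have "norm (?q' - ?q - (\<chi> k. a)) \<le> 2 * \<eta>"
    proof -
      have "(\<chi> k::'d. a) = (\<chi> k. \<tau> * real ?i') - (\<chi> k. \<tau> * real ?i)"
        by (simp add: vec_eq_iff a_def algebra_simps)
      then have q: "?q' - ?q - (\<chi> k. a) = (?q' - (\<chi> k. \<tau> * real ?i')) - (?q - (\<chi> k. \<tau> * real ?i))" by simp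
      have "norm (?q' - (\<chi> k. \<tau> * real ?i')) \<le> \<eta>" "norm (?q - (\<chi> k. \<tau> * real ?i)) \<le> \<eta>"
        using f(3)[OF i(1) B0] f(3)[OF i(2) B0] by simp_all
      then show ?thesis unfolding q using norm_triangle_ineq4[of "?q' - (\<chi> k. \<tau> * real ?i')" "?q - (\<chi> k. \<tau> * real ?i)"] by linarith
    qed
    note r = this
    have qk: "\<bar>(?q' - ?q) $ k - a\<bar> \<le> 2 * \<eta>" using component_le_norm_cart[of "?q' - ?q - (\<chi> k. a)" k] r by simp
    have "norm (?q' - ?q) \<le> norm (\<chi> k::'d. a) + 2 * \<eta>"
      using norm_triangle_sub[of "?q' - ?q" "\<chi> k::'d. a"] r by linarith
    then have nq: "norm (?q' - ?q) \<le> ?d * a + 2 * \<eta>" using norm_const_vec[of a, where 'n='d] a \<tau>0 by simp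
    have "\<kappa> * norm (?q' - ?q) \<le> \<kappa> * (?d * a + 2 * \<eta>)" using nq \<kappa>(1) by (intro mult_left_mono) auto
    also have "\<dots> = (\<kappa> * ?d) * a + \<kappa> * (2 * \<eta>)" by (simp add: algebra_simps)
    also have "\<dots> \<le> 1/2 * a + 1/4 * (2 * \<eta>)"
      using \<kappa> a \<tau>0 \<eta> by (intro add_mono mult_right_mono) auto
    finally have \<kappa>q: "\<kappa> * norm (?q' - ?q) \<le> 1/2 * a + \<eta> / 2" by simp
    have "\<bar>(p l' - p l - (?q' - ?q)) $ k\<bar> \<le> 1/2 * a + \<eta> / 2"
      using component_le_norm_cart[of "p l' - p l - (?q' - ?q)" k] hlip[OF fB[OF i(2) B0] fB[OF i(1) B0]] \<kappa>q
      unfolding p_def by linarith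
    then have "p l' $ k - p l $ k \<ge> a / 2 - 3 * \<eta>" using qk \<eta>(1) by (simp add: abs_le_iff)
    moreover have "\<eta> < \<gamma>"
    proof -
      have "184 * (lam * \<eta>) < lam * \<gamma>" using lam_\<eta> lam(1) by linarith
      then have "lam * \<eta> < lam * \<gamma>" using lam0 \<eta>(1) by (smt (verit) mult_pos_pos)
      then show ?thesis using lam0 by simp
    qed
    ultimately have low: "6 * \<gamma> < p l' $ k - p l $ k" using a \<gamma> by linarith
    have "norm ?q' \<le> 3/4" "norm ?q \<le> 3/4" using f_into[OF i(1) B0] f_into[OF i(2) B0] by simp_all
    then have "norm (?q' - ?q) \<le> 3/2" using norm_triangle_ineq4[of ?q' ?q] by linarith
    then have "norm (p l' - p l) \<le> 15/8" using hdist[OF fB[OF i(2) B0] fB[OF i(1) B0]] unfolding p_def by linarith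
    then have "\<bar>(p l' - p l) $ k\<bar> \<le> 15/8" using component_le_norm_cart[of "p l' - p l" k] by linarith
    then show ?thesis using low \<gamma> by (auto simp: abs_if)
  qed
  obtain l where l: "l \<le> ?d" "\<And>k. \<exists>z::int. \<bar>p l $ k - 4 * of_int z\<bar> \<le> 2 - 6 * \<gamma> / 2"
    using exists_point_off_strips[of "6 * \<gamma>" p] sep by blast
  define i where "i = m * Suc ?d + l"
  have i: "i < M * Suc CARD('d)" unfolding i_def by (rule iN[OF l(1)])
  have idiv: "i div Suc ?d = m"
  proof -
    have "i div Suc ?d = m + l div Suc ?d" unfolding i_def by (rule div_mult_self3) simp
    then show ?thesis using l(1) by simp
  qed
  obtain z :: "'d \<Rightarrow> int" where z: "\<And>k. \<bar>h (f i 0) $ k - 4 * of_int (z k)\<bar> \<le> 2 - 3 * \<gamma>"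
  proof -
    have "6 * \<gamma> / 2 = 3 * \<gamma>" by simp
    then have "\<forall>k. \<exists>z::int. \<bar>h (f i 0) $ k - 4 * of_int z\<bar> \<le> 2 - 3 * \<gamma>"
      using l(2) unfolding p_def i_def by metis
    then show ?thesis using that by metis
  qed
  have "\<bar>z k\<bar> \<le> int n" for k
  proof -
    have "\<bar>4 * real_of_int (z k)\<bar> < 4 * real n + 4" using z[of k] hR[OF fB[OF i B0], of k] \<gamma>(1) by linarith
    then show ?thesis by linarith
  qed
  then obtain j where j: "j \<in> J" "e j = (\<chi> k. 4 * of_int (z k))" using e by blast
  \<comment> \<open>The image of the branch is so small that it stays off the gaps together with its centre.\<close>
  have lamrho: "5/2 * (1 / lam) \<le> \<gamma>" using lam(1) lam0 by (simp add: field_simps)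
  have inner: "\<bar>h (f i x) $ k - e j $ k\<bar> \<le> 2 - 2 * \<gamma>" if x: "x \<in> ?B" for x k
  proof -
    have "norm (S i x) \<le> norm (S i) * 1" using norm_blinfun[of "S i" x] x mult_left_mono[of "norm x" 1 "norm (S i)"] by simp
    then have s: "norm (S i x) \<le> 4 / (3 * lam)" using norm_S[OF i] by simp
    have c0: "norm (f i 0 - (\<chi> k. \<tau> * i)) \<le> \<eta>" using f(3)[OF i B0] by simp
    have cx: "norm (f i x - (\<chi> k. \<tau> * i) - S i x) \<le> \<eta>" using f(3)[OF i x] by (simp add: diff_diff_eq)
    have "norm (f i x - f i 0) \<le> norm (S i x) + 2 * \<eta>"
    proof -
      have q: "f i x - f i 0 = ((f i x - (\<chi> k. \<tau> * i) - S i x) + S i x) - (f i 0 - (\<chi> k. \<tau> * i))" by simp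
      show ?thesis unfolding q
        using norm_triangle_ineq4[of "(f i x - (\<chi> k. \<tau> * i) - S i x) + S i x" "f i 0 - (\<chi> k. \<tau> * i)"]
          norm_triangle_ineq[of "f i x - (\<chi> k. \<tau> * i) - S i x" "S i x"] c0 cx by linarith
    qed
    also have "\<dots> \<le> 4 / (3 * lam) + 2 * (1 / (184 * lam))" using s \<eta>_rho by linarith
    also have "\<dots> \<le> 2 / lam" using lam0 by (simp add: field_simps)
    finally have "norm (h (f i x) - h (f i 0)) \<le> 5/4 * (2 / lam)"
      using hdist[OF fB[OF i x] fB[OF i B0]] by linarith
    then have "norm (h (f i x) - h (f i 0)) \<le> \<gamma>" using lamrho by simp
    then have "\<bar>h (f i x) $ k - h (f i 0) $ k\<bar> \<le> \<gamma>"
      using component_le_norm_cart[of "h (f i x) - h (f i 0)" k] by simp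
    then show ?thesis using z[of k] j(2) by simp
  qed
  have inW: "\<forall>k. \<bar>h (f i x) $ k - e j $ k\<bar> < 2 - \<gamma>" if "x \<in> ?B" for x
  proof
    fix k show "\<bar>h (f i x) $ k - e j $ k\<bar> < 2 - \<gamma>" using inner[OF that, of k] \<gamma>(1) by linarith
  qed
  have nH: "norm (H x) \<le> 5/4" if "x \<in> ?B" for x
    using H(2)[OF that] norm_triangle_sub[of "H x" id_blinfun] norm_blinfun_id_le[where 'a="real ^ 'd"] \<kappa>(2) by linarith
  have nG: "norm (G j (h (f i x))) \<le> lam + \<eta>" if "x \<in> ?B" for x
  proof -
    have "norm (lam *\<^sub>R id_blinfun :: (real ^ 'd) \<Rightarrow>\<^sub>L (real ^ 'd)) \<le> lam" using lam0 by simp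
    then show ?thesis
      using g(2)[OF j(1) inW[OF that]] norm_triangle_sub[of "G j (h (f i x))" "lam *\<^sub>R id_blinfun"] by linarith
  qed
  define H' where "H' x = G j (h (f i x)) o\<^sub>L (H (f i x) o\<^sub>L F i x)" for x
  have lam\<eta>: "0 < lam * \<eta>" using lam0 \<eta> by simp
  have nn: "0 \<le> 10 * lam * \<eta>" using lam0 \<eta>(1) by simp
  have comp1: "has_holder_deriv \<alpha> ?B (\<lambda>x. h (f i x)) (\<lambda>x. H (f i x) o\<^sub>L F i x)
      (10 * lam * \<eta> * (2 / lam) powr \<alpha> * (2 / lam) + 5/4 * \<eta>)"
    using fB[OF i] norm_F[OF i] nH
    by (intro has_holder_deriv_compose[OF H(1) f(1)[OF i] convex_ball _ \<alpha> nn]) (auto simp: image_subset_iff)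
  have nHF: "norm (H (f i x) o\<^sub>L F i x) \<le> 1" if "x \<in> ?B" for x
  proof -
    have "norm (H (f i x) o\<^sub>L F i x) \<le> 5/4 * (2 / lam)"
      using mult_mono[OF nH[OF fB[OF i that]] norm_F[OF i that]]
      by (intro order_trans[OF norm_blinfun_compose]) auto
    also have "\<dots> \<le> 1" using lam_ge by (simp add: field_simps)
    finally show ?thesis .
  qed
  have "has_holder_deriv \<alpha> ?B (\<lambda>x. g (h (f i x))) H'
      (\<eta> * 1 powr \<alpha> * 1 + (lam + \<eta>) * (10 * lam * \<eta> * (2 / lam) powr \<alpha> * (2 / lam) + 5/4 * \<eta>))"
    unfolding H'_def using inW nHF nG \<eta>(1)
    by (intro has_holder_deriv_compose[OF g(1)[OF j(1)] comp1 convex_ball _ \<alpha>]) (auto simp: image_subset_iff)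
  moreover have "\<eta> * 1 powr \<alpha> * 1 + (lam + \<eta>) * (10 * lam * \<eta> * (2 / lam) powr \<alpha> * (2 / lam) + 5/4 * \<eta>) \<le> 10 * lam * \<eta>"
  proof -
    have "10 * lam * \<eta> * (2 / lam) powr \<alpha> * (2 / lam) \<le> 10 * lam * \<eta> * (1/8) * (2 / lam)"
      using lam(2) lam0 \<eta>(1) by (intro mult_right_mono mult_left_mono) auto
    also have "\<dots> = 5/2 * \<eta>" using lam0 by simp
    finally have "10 * lam * \<eta> * (2 / lam) powr \<alpha> * (2 / lam) + 5/4 * \<eta> \<le> 15/4 * \<eta>" by simp
    then have "(lam + \<eta>) * (10 * lam * \<eta> * (2 / lam) powr \<alpha> * (2 / lam) + 5/4 * \<eta>) \<le> (2 * lam) * (15/4 * \<eta>)"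
      using \<eta>(1) \<eta>_small lam_ge by (intro mult_mono) auto
    also have "\<dots> = 15/2 * (lam * \<eta>)" by simp
    finally have "(lam + \<eta>) * (10 * lam * \<eta> * (2 / lam) powr \<alpha> * (2 / lam) + 5/4 * \<eta>) \<le> 15/2 * (lam * \<eta>)" .
    moreover have "1 * \<eta> \<le> lam * \<eta>" using lam_ge \<eta>(1) by (intro mult_right_mono) auto
    moreover have "\<eta> * 1 powr \<alpha> * 1 = \<eta>" by simp
    moreover have "10 * lam * \<eta> = 10 * (lam * \<eta>)" by simp
    ultimately show ?thesis using lam\<eta> by linarith
  qed
  ultimately have holder: "has_holder_deriv \<alpha> ?B (g \<circ> h \<circ> f i) H' (10 * lam * \<eta>)"
    unfolding o_def by (rule has_holder_deriv_mono)
  have near: "norm (H' x - id_blinfun) \<le> \<kappa>" if x: "x \<in> ?B" for x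
  proof -
    \<comment> \<open>The linear part of the unperturbed step, to which \<open>H' x\<close> is compared.\<close>
    have lin: "norm (lam *\<^sub>R (H 0 o\<^sub>L S i) - id_blinfun) \<le> \<kappa> - \<theta> / 2"
      using linear_correction[OF H(2)[OF B0] \<kappa>(1,2) \<theta> lam0 m(2)] S(1)[OF i] S(2)[OF i] unfolding idiv by blast
    have H0: "norm (H (f i x) - H 0) \<le> 10 * lam * \<eta>"
    proof -
      have "norm (H (f i x) - H 0) \<le> 10 * lam * \<eta> * dist (f i x) 0 powr \<alpha>"
        by (rule has_holder_derivD(2)[OF H(1) fB[OF i x] B0])
      also have "\<dots> \<le> 10 * lam * \<eta> * 1"
        using fB[OF i x] \<alpha> by (intro mult_left_mono nn powr_le1) auto
      finally show ?thesis by simp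
    qed
    have split: "H' x - id_blinfun = ((G j (h (f i x)) - lam *\<^sub>R id_blinfun) o\<^sub>L (H (f i x) o\<^sub>L F i x))
        + (lam *\<^sub>R ((H (f i x) - H 0) o\<^sub>L F i x) + lam *\<^sub>R (H 0 o\<^sub>L (F i x - S i)))
        + (lam *\<^sub>R (H 0 o\<^sub>L S i) - id_blinfun)"
      unfolding H'_def by (rule blinfun_eqI) (simp add: blinfun.bilinear_simps algebra_simps)
    have 1: "norm ((G j (h (f i x)) - lam *\<^sub>R id_blinfun) o\<^sub>L (H (f i x) o\<^sub>L F i x)) \<le> \<eta> * 1"
      using mult_mono[OF g(2)[OF j(1) inW[OF x]] nHF[OF x]] \<eta>(1)
      by (intro order_trans[OF norm_blinfun_compose]) auto
    have "norm ((H (f i x) - H 0) o\<^sub>L F i x) \<le> (10 * lam * \<eta>) * (2 / lam)"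
      using mult_mono[OF H0 norm_F[OF i x] nn norm_ge_zero] by (rule order_trans[OF norm_blinfun_compose])
    then have 2: "norm (lam *\<^sub>R ((H (f i x) - H 0) o\<^sub>L F i x)) \<le> 20 * (lam * \<eta>)"
      using lam0 by (simp add: field_simps)
    have "norm (H 0 o\<^sub>L (F i x - S i)) \<le> 5/4 * \<eta>"
      using mult_mono[OF nH[OF B0] f(2)[OF i x]] by (intro order_trans[OF norm_blinfun_compose]) auto
    then have 3: "norm (lam *\<^sub>R (H 0 o\<^sub>L (F i x - S i))) \<le> 5/4 * (lam * \<eta>)"
      using lam0 by (simp add: field_simps)
    have "norm (H' x - id_blinfun) \<le> \<eta> * 1 + (20 * (lam * \<eta>) + 5/4 * (lam * \<eta>)) + (\<kappa> - \<theta> / 2)"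
      unfolding split by (intro norm_triangle_mono 1 2 3 lin)
    moreover have "1 * \<eta> \<le> lam * \<eta>" using lam_ge \<eta>(1) by (intro mult_right_mono) auto
    moreover have "46 * (lam * \<eta>) \<le> \<theta>" using \<eta>(2) by simp
    ultimately show ?thesis using lam\<eta> by linarith
  qed
  have range: "\<bar>(g \<circ> h \<circ> f i) x $ k\<bar> \<le> 4 * real n + 2" if x: "x \<in> ?B" for x k
  proof -
    let ?y = "h (f i x)"
    have "\<bar>(g ?y - lam *\<^sub>R (?y - e j)) $ k\<bar> \<le> \<eta>"
      using g(3)[OF j(1) inW[OF x]] component_le_norm_cart[of "g ?y - lam *\<^sub>R (?y - e j)" k] by linarith
    then have "\<bar>g ?y $ k - lam * (?y $ k - e j $ k)\<bar> \<le> \<eta>" by simp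
    moreover have "\<bar>lam * (?y $ k - e j $ k)\<bar> = lam * \<bar>?y $ k - e j $ k\<bar>" using lam0 by (simp add: abs_mult)
    ultimately have "\<bar>g ?y $ k\<bar> \<le> lam * \<bar>?y $ k - e j $ k\<bar> + \<eta>" by linarith
    also have "\<dots> \<le> lam * (2 - 2 * \<gamma>) + \<eta>" using inner[OF x] lam0 by simp
    also have "\<dots> \<le> lam * (2 - \<gamma>)" using lam(1) \<eta>_small by (simp add: algebra_simps)
    finally show ?thesis using lam(3) by simp
  qed
  show ?thesis
  proof (rule that[OF i j(1) inW])
    show "near_identity (g \<circ> h \<circ> f i)" unfolding near_identity_def using holder near range by blast
  qed
qed

end

section \<open>The diagonal system and the grid system\<close>

lemma finite_net_of_linear_maps:
  obtains M and Y :: "nat \<Rightarrow> 'a::euclidean_space \<Rightarrow>\<^sub>L 'a"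
  where "\<And>m. m < M \<Longrightarrow> norm (Y m) \<le> 1" "\<And>X. norm X \<le> 1 \<Longrightarrow> \<exists>m<M. norm (X - Y m) \<le> 1/4" "0 < M"
proof -
  have "compact (cball (0 :: 'a \<Rightarrow>\<^sub>L 'a) 1)" by simp
  then obtain Q where Q: "Q \<subseteq> cball (0 :: 'a \<Rightarrow>\<^sub>L 'a) 1" "finite Q" "cball 0 1 \<subseteq> (\<Union>q\<in>Q. ball q (1/4))"
  proof (rule compactE_image[where C="cball 0 1" and f="\<lambda>q. ball q (1/4)"])
    show "cball 0 1 \<subseteq> (\<Union>q\<in>cball (0 :: 'a \<Rightarrow>\<^sub>L 'a) 1. ball q (1/4))"
    proof
      fix X :: "'a \<Rightarrow>\<^sub>L 'a" assume "X \<in> cball 0 1"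
      moreover have "X \<in> ball X (1/4)" by simp
      ultimately show "X \<in> (\<Union>q\<in>cball 0 1. ball q (1/4))" by blast
    qed
  qed (use that in auto)
  obtain ys where ys: "set ys = Q" using finite_list[OF Q(2)] by blast
  show ?thesis
  proof (rule that[of "length ys" "\<lambda>m. ys ! m"])
    show "norm (ys ! m) \<le> 1" if "m < length ys" for m
      using Q(1) ys nth_mem[OF that] by auto
    show "\<exists>m<length ys. norm (X - ys ! m) \<le> 1/4" if X: "norm X \<le> 1" for X :: "'a \<Rightarrow>\<^sub>L 'a"
    proof -
      have "X \<in> cball 0 1" using X by simp
      then obtain q where q: "q \<in> Q" "X \<in> ball q (1/4)" using Q(3) by blast
      then obtain m where "m < length ys" "q = ys ! m" using ys by (metis in_set_conv_nth)
      then show ?thesis using q(2) by (intro exI[of _ m]) (simp add: dist_norm norm_minus_commute)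
    qed
    have "0 \<in> cball (0 :: 'a \<Rightarrow>\<^sub>L 'a) 1" by simp
    then have "Q \<noteq> {}" using Q(3) by blast
    then show "0 < length ys" using ys by auto
  qed
qed

text \<open>The expansion factor \<open>(4 n + 2) / (2 - \<gamma>)\<close> is forced by the grid, which has \<open>2 n + 1\<close> cells of side 4 in
  each direction and pieces of half side \<open>2 - \<gamma>\<close>; it can be made large only through \<open>n\<close>.\<close>

lemma eventually_expansion_large:
  assumes "0 < \<alpha>" "0 < e" "0 < \<gamma>" "\<gamma> < 2"
  obtains n :: nat where "1 \<le> n" "5 \<le> (4 * real n + 2) / (2 - \<gamma>) * \<gamma>"
    "(2 / ((4 * real n + 2) / (2 - \<gamma>))) powr \<alpha> \<le> 1/8" "c * (2 / ((4 * real n + 2) / (2 - \<gamma>))) powr e < 1"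
proof -
  define l where "l n = (4 * real n + 2) / (2 - \<gamma>)" for n
  have "filterlim l at_top sequentially"
  proof (rule filterlim_at_top_mono[OF filterlim_real_sequentially always_eventually])
    show "\<forall>n. real n \<le> l n"
    proof
      fix n
      have "real n * (2 - \<gamma>) \<le> real n * 2" using assms by (intro mult_left_mono) auto
      then show "real n \<le> l n" using assms unfolding l_def by (simp add: pos_le_divide_eq)
    qed
  qed
  then have lim: "(\<lambda>n. 2 / l n) \<longlonglongrightarrow> 0"
    by (intro real_tendsto_divide_at_top[OF tendsto_const])
  have pw: "(\<lambda>n. (2 / l n) powr s) \<longlonglongrightarrow> 0" if "0 < s" for s
  proof -
    have "(\<lambda>n. (2 / l n) powr s) \<longlonglongrightarrow> 0 powr s"
      by (rule tendsto_powr'[OF lim tendsto_const]) (use that assms in \<open>auto simp: l_def\<close>)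
    then show ?thesis by simp
  qed
  have "\<forall>\<^sub>F n in sequentially. (2 / l n) powr \<alpha> < 1/8" using pw[OF assms(1)] by (rule order_tendstoD) simp
  moreover have "(\<lambda>n. c * (2 / l n) powr e) \<longlonglongrightarrow> c * 0" by (intro tendsto_intros pw assms)
  then have "\<forall>\<^sub>F n in sequentially. c * (2 / l n) powr e < 1" by (rule order_tendstoD) simp
  moreover have "\<forall>\<^sub>F n in sequentially. 5 / \<gamma> \<le> l n"
    using \<open>filterlim l at_top sequentially\<close> by (auto simp: filterlim_at_top)
  moreover have "\<forall>\<^sub>F n in sequentially. 1 \<le> n" by (rule eventually_ge_at_top)
  ultimately have "\<forall>\<^sub>F n in sequentially. 1 \<le> n \<and> 5 / \<gamma> \<le> l n \<and> (2 / l n) powr \<alpha> < 1/8 \<and> c * (2 / l n) powr e < 1"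
    by eventually_elim auto
  then obtain n where n: "1 \<le> n" "5 / \<gamma> \<le> l n" "(2 / l n) powr \<alpha> < 1/8" "c * (2 / l n) powr e < 1"
    using eventually_happens'[OF sequentially_bot] by blast
  have "5 \<le> l n * \<gamma>" using n(2) assms(3) by (simp add: pos_divide_le_eq)
  then show ?thesis using n that[of n] unfolding l_def by simp
qed

text \<open>The centres lie on the diagonal within distance \<open>1/2\<close> of the origin and any two of them differ by at
  least \<open>\<tau>\<close> in every coordinate.  The radius \<open>2/\<lambda>\<close> of the pieces, instead of \<open>1/\<lambda>\<close>, makes their images
  cover the unit ball in spite of the corrections of the derivatives.\<close>

lemma diagonal_affine_system:
  fixes A :: "nat \<Rightarrow> (real ^ 'd) \<Rightarrow>\<^sub>L (real ^ 'd)" and \<tau> lam :: real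
  assumes "2 \<le> N" "0 < \<tau>" "\<tau> * CARD('d) * real N \<le> 1/2" "20 \<le> lam" "120 \<le> lam * \<tau>"
    and A: "\<And>i x. i < N \<Longrightarrow> 3/4 * lam * norm x \<le> norm (A i x)"
  shows "affine_system N (\<lambda>i. \<chi> k. \<tau> * real i) A (ball 0 (\<tau> / 2)) (cball 0 (2 / lam))"
  unfolding affine_system_def
proof (intro conjI allI impI)
  have l: "2 / lam \<le> \<tau> / 60" using assms(4,5) by (simp add: pos_divide_le_eq mult_ac)
  then show "cball (0 :: real ^ 'd) (2 / lam) \<subseteq> ball 0 (\<tau> / 2)" using \<open>0 < \<tau>\<close> by auto
  show "cball (0 :: real ^ 'd) (2 / lam) \<noteq> {}" using assms(4) by simp
  fix i assume i: "i < N"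
  show "4 * norm x \<le> norm (A i x)" for x
  proof -
    have "4 * norm x \<le> 3/4 * lam * norm x" using assms(4) by (intro mult_right_mono) auto
    then show ?thesis using A[OF i, of x] by linarith
  qed
  fix j assume j: "j < N"
  show "(+) (\<chi> k. \<tau> * real i) ` ball (0 :: real ^ 'd) (\<tau> / 2) \<inter> (+) (\<chi> k. \<tau> * real j) ` ball 0 (\<tau> / 2) = {}"
    if "i \<noteq> j"
  proof (rule ccontr)
    assume "\<not> ?thesis"
    then obtain z :: "real ^ 'd" where "z - (\<chi> k. \<tau> * real i) \<in> ball 0 (\<tau> / 2)" "z - (\<chi> k. \<tau> * real j) \<in> ball 0 (\<tau> / 2)"
      unfolding mem_translate_iff[symmetric] by blast
    then have z: "norm (z - (\<chi> k. \<tau> * real i)) < \<tau> / 2" "norm (z - (\<chi> k. \<tau> * real j)) < \<tau> / 2" by simp_all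
    obtain k :: 'd where True by simp
    have "\<bar>z $ k - \<tau> * real i\<bar> < \<tau> / 2" "\<bar>z $ k - \<tau> * real j\<bar> < \<tau> / 2"
      using component_le_norm_cart[of "z - (\<chi> k. \<tau> * real i)" k] component_le_norm_cart[of "z - (\<chi> k. \<tau> * real j)" k] z
      by simp_all
    then have "\<bar>\<tau> * real i - \<tau> * real j\<bar> < \<tau>" by linarith
    then have "\<tau> * \<bar>real i - real j\<bar> < \<tau> * 1" using \<open>0 < \<tau>\<close> by (simp add: abs_mult flip: right_diff_distrib)
    then have "\<bar>real i - real j\<bar> < 1" using \<open>0 < \<tau>\<close> by simp
    then show False using \<open>i \<noteq> j\<close> by linarith
  qed
  show "(+) (\<chi> k. \<tau> * real j) ` cball (0 :: real ^ 'd) (2 / lam) \<subseteq> A i ` cball 0 (2 / lam)"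
  proof clarify
    fix x :: "real ^ 'd" assume x: "x \<in> cball 0 (2 / lam)"
    have "norm ((\<chi> k. \<tau> * real j) :: real ^ 'd) \<le> CARD('d) * \<bar>\<tau> * real j\<bar>" by (rule norm_const_vec)
    also have "\<dots> = \<tau> * CARD('d) * real j" using \<open>0 < \<tau>\<close> by (simp add: abs_mult)
    also have "\<dots> \<le> \<tau> * CARD('d) * real N" using \<open>0 < \<tau>\<close> j by (intro mult_left_mono) auto
    finally have c: "norm ((\<chi> k. \<tau> * real j) :: real ^ 'd) \<le> 1/2" using assms(3) by linarith
    have "2 / lam \<le> 1/10" using assms(4) by (simp add: field_simps)
    then have p: "norm ((\<chi> k. \<tau> * real j) + x) \<le> 1"
      using norm_triangle_ineq[of "\<chi> k. \<tau> * real j" x] c x by simp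
    obtain R :: "(real ^ 'd) \<Rightarrow>\<^sub>L (real ^ 'd)" where R: "\<And>x. A i (R x) = x" "norm R \<le> 1 / (3/4 * lam)"
      using linear_expanding_invertible[of "3/4 * lam" "A i"] A[OF i] assms(4) by force
    have "norm (R ((\<chi> k. \<tau> * real j) + x)) \<le> 1 / (3/4 * lam) * 1"
      using mult_mono[OF R(2) p] assms(4) by (intro order_trans[OF norm_blinfun]) auto
    also have "\<dots> \<le> 2 / lam" using assms(4) by (simp add: field_simps)
    finally have "R ((\<chi> k. \<tau> * real j) + x) \<in> cball 0 (2 / lam)" by simp
    then show "(\<chi> k. \<tau> * real j) + x \<in> A i ` cball 0 (2 / lam)" using R(1) by (metis image_eqI)
  qed
qed (use assms in auto)

lemma cube_compact_convex:
  fixes b :: real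
  assumes "0 \<le> b"
  shows "compact {x :: real ^ 'd. \<forall>k. \<bar>x $ k\<bar> \<le> b}" "convex {x :: real ^ 'd. \<forall>k. \<bar>x $ k\<bar> \<le> b}"
proof -
  have "{x :: real ^ 'd. \<forall>k. \<bar>x $ k\<bar> \<le> b} = cbox (\<chi> k. - b) (\<chi> k. b)"
    by (auto simp: mem_box_cart abs_le_iff) (metis minus_le_iff)+
  then show "compact {x :: real ^ 'd. \<forall>k. \<bar>x $ k\<bar> \<le> b}" "convex {x :: real ^ 'd. \<forall>k. \<bar>x $ k\<bar> \<le> b}"
    by (simp_all add: compact_cbox)
qed

lemma open_cube:
  fixes e :: "real ^ 'd" and b :: real
  shows "open {x. \<forall>k. \<bar>x $ k - e $ k\<bar> < b}" "convex {x. \<forall>k. \<bar>x $ k - e $ k\<bar> < b}"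
proof -
  have "{x. \<forall>k. \<bar>x $ k - e $ k\<bar> < b} = box (\<chi> k. e $ k - b) (\<chi> k. e $ k + b)"
    by (auto simp: mem_box_cart abs_less_iff) (smt (verit))+
  then show "open {x. \<forall>k. \<bar>x $ k - e $ k\<bar> < b}" "convex {x. \<forall>k. \<bar>x $ k - e $ k\<bar> < b}"
    by (simp_all add: open_box)
qed

definition grid :: "nat \<Rightarrow> (real ^ 'd) set" where
  "grid n = {v. \<exists>z :: 'd \<Rightarrow> int. (\<forall>k. \<bar>z k\<bar> \<le> int n) \<and> v = (\<chi> k. 4 * of_int (z k))}"

lemma finite_grid: "finite (grid n :: (real ^ 'd) set)"
proof -
  have "finite (PiE (UNIV :: 'd set) (\<lambda>_. {- int n..int n}))" by (intro finite_PiE) auto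
  moreover have "(grid n :: (real ^ 'd) set) \<subseteq> (\<lambda>z. \<chi> k. 4 * of_int (z k)) ` PiE UNIV (\<lambda>_. {- int n..int n})"
    unfolding grid_def by (auto intro!: imageI simp: abs_le_iff) (metis minus_le_iff)
  ultimately show ?thesis using finite_surj by blast
qed

lemma card_grid: "1 \<le> n \<Longrightarrow> 2 \<le> card (grid n :: (real ^ 'd) set)"
proof -
  assume n: "1 \<le> n"
  have "(\<chi> k. 0) \<in> (grid n :: (real ^ 'd) set)" unfolding grid_def by (intro CollectI exI[of _ "\<lambda>_. 0"]) simp
  moreover have "(\<chi> k. 4) \<in> (grid n :: (real ^ 'd) set)" unfolding grid_def using n by (intro CollectI exI[of _ "\<lambda>_. 1"]) simp
  ultimately have "{(\<chi> k. 0), (\<chi> k. 4)} \<subseteq> (grid n :: (real ^ 'd) set)" by simp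
  moreover have "card {(\<chi> k. 0), (\<chi> k. 4) :: real ^ 'd} = 2" by (simp add: vec_eq_iff)
  ultimately show ?thesis by (metis card_mono finite_grid)
qed

text \<open>The equation for \<open>\<lambda>\<close> says that each cubical piece is mapped onto the whole cube of half side
  \<open>4 n + 2\<close>.\<close>

lemma grid_affine_system:
  fixes e :: "nat \<Rightarrow> real ^ 'd"
  assumes e: "bij_betw e {..<card (grid n :: (real ^ 'd) set)} (grid n)" and "1 \<le> n"
    and \<gamma>: "0 < \<gamma>" "\<gamma> \<le> 1/4" and lam: "20 \<le> lam" "lam * (2 - \<gamma>) = 4 * real n + 2"
  shows "affine_system (card (grid n :: (real ^ 'd) set)) e (\<lambda>_. lam *\<^sub>R id_blinfun)
    {x. \<forall>k. \<bar>x $ k\<bar> < 2} {x. \<forall>k. \<bar>x $ k\<bar> \<le> 2 - \<gamma>}"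
  unfolding affine_system_def
proof (intro conjI allI impI)
  let ?T = "{x :: real ^ 'd. \<forall>k. \<bar>x $ k\<bar> \<le> 2 - \<gamma>}" and ?V = "{x :: real ^ 'd. \<forall>k. \<bar>x $ k\<bar> < 2}"
  show "2 \<le> card (grid n :: (real ^ 'd) set)" by (rule card_grid[OF assms(2)])
  show "open ?V" using open_cube(1)[of 0 2] by simp
  show "?T \<subseteq> ?V" using \<gamma> by (auto intro: le_less_trans)
  show "compact ?T" "convex ?T" using \<gamma> by (auto intro: cube_compact_convex)
  have "0 \<in> ?T" using \<gamma> by simp
  then show "?T \<noteq> {}" by blast
  show "4 * norm x \<le> norm ((lam *\<^sub>R id_blinfun) x)" for x :: "real ^ 'd"
  proof -
    have "4 * norm x \<le> lam * norm x" using lam by (intro mult_right_mono) auto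
    then show ?thesis using lam by (simp add: scaleR_blinfun.rep_eq)
  qed
  have egrid: "\<exists>z. (\<forall>k. \<bar>z k\<bar> \<le> int n) \<and> e i = (\<chi> k. 4 * of_int (z k))" if "i < card (grid n :: (real ^ 'd) set)" for i
    using bij_betw_apply[OF e, of i] that unfolding grid_def by simp
  fix i j assume i: "i < card (grid n :: (real ^ 'd) set)" and j: "j < card (grid n :: (real ^ 'd) set)"
  show "(+) (e i) ` ?V \<inter> (+) (e j) ` ?V = {}" if "i \<noteq> j"
  proof (rule ccontr)
    assume "\<not> ?thesis"
    then obtain x where x: "x - e i \<in> ?V" "x - e j \<in> ?V" unfolding mem_translate_iff[symmetric] by blast
    obtain z z' :: "'d \<Rightarrow> int" where z: "e i = (\<chi> k. 4 * of_int (z k))" "e j = (\<chi> k. 4 * of_int (z' k))"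
      using egrid i j by metis
    have "z k = z' k" for k
    proof -
      have "\<bar>x $ k - 4 * of_int (z k)\<bar> < 2" "\<bar>x $ k - 4 * of_int (z' k)\<bar> < 2" using x z by auto
      then have "\<bar>4 * real_of_int (z k) - 4 * of_int (z' k)\<bar> < 4" by linarith
      then show ?thesis by linarith
    qed
    then have "e i = e j" using z by simp
    then show False using e i j \<open>i \<noteq> j\<close> unfolding bij_betw_def inj_on_def by blast
  qed
  show "(+) (e j) ` ?T \<subseteq> (lam *\<^sub>R id_blinfun) ` ?T"
  proof clarify
    fix x :: "real ^ 'd" assume x: "\<forall>k. \<bar>x $ k\<bar> \<le> 2 - \<gamma>"
    obtain z :: "'d \<Rightarrow> int" where z: "\<forall>k. \<bar>z k\<bar> \<le> int n" "e j = (\<chi> k. 4 * of_int (z k))"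
      using egrid j by blast
    have "\<bar>(e j + x) $ k\<bar> \<le> lam * (2 - \<gamma>)" for k
    proof -
      have "\<bar>real_of_int (z k)\<bar> \<le> real n" using z(1) by (metis of_int_abs of_int_le_iff of_int_of_nat_eq)
      then show ?thesis using spec[OF x, of k] z(2) lam(2) \<gamma> by simp
    qed
    then have "(1 / lam) *\<^sub>R (e j + x) \<in> ?T" using lam(1) by (simp add: abs_mult field_simps)
    moreover have "e j + x = (lam *\<^sub>R id_blinfun) ((1 / lam) *\<^sub>R (e j + x))"
      using lam(1) by (simp add: scaleR_blinfun.rep_eq)
    ultimately show "e j + x \<in> (lam *\<^sub>R id_blinfun) ` ?T" by (rule rev_image_eqI)
  qed
qed

section \<open>Stable intersection\<close>

text \<open>Once the perturbed branches are provided by the lemmas of the previous sections, this is the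
  renormalization argument started at the identity.\<close>

lemma diagonal_grid_stable_intersection:
  fixes Y A :: "nat \<Rightarrow> (real ^ 'd) \<Rightarrow>\<^sub>L (real ^ 'd)" and \<alpha> \<kappa> \<theta> \<tau> \<gamma> lam :: real and e :: "nat \<Rightarrow> real ^ 'd"
  assumes \<alpha>: "0 < \<alpha>" "\<alpha> < 1"
    and \<kappa>: "0 < \<kappa>" "\<kappa> \<le> 1/4" "\<kappa> * CARD('d) \<le> 1/2"
    and \<theta>: "0 < \<theta>" "\<theta> \<le> \<kappa>"
    and \<gamma>: "0 < \<gamma>" "24 * \<gamma> \<le> \<tau>" "\<gamma> \<le> 1/4"
    and lam: "5 \<le> lam * \<gamma>" "(2 / lam) powr \<alpha> \<le> 1/8" "lam * (2 - \<gamma>) = 4 * real n + 2"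
    and \<tau>: "\<tau> * CARD('d) * (M * Suc CARD('d)) \<le> 1/2"
    and net: "\<And>X. norm X \<le> 1 \<Longrightarrow> \<exists>m<M. norm (X - Y m) \<le> 1/4"
    and n: "1 \<le> n" and e: "bij_betw e {..<card (grid n :: (real ^ 'd) set)} (grid n)"
    and A: "\<And>i x. i < M * Suc CARD('d) \<Longrightarrow> A i x = lam *\<^sub>R (x + \<theta> *\<^sub>R Y (i div Suc CARD('d)) x)"
    and expand: "\<And>i x. i < M * Suc CARD('d) \<Longrightarrow> lam * (1 - \<theta>) * norm x \<le> norm (A i x)"
    and sys: "affine_system (M * Suc CARD('d)) (\<lambda>i. \<chi> k. \<tau> * real i) A (ball 0 (\<tau> / 2)) (cball 0 (2 / lam))"
    and sys': "affine_system (card (grid n :: (real ^ 'd) set)) e (\<lambda>_. lam *\<^sub>R id_blinfun)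
      {x. \<forall>k. \<bar>x $ k\<bar> < 2} {x. \<forall>k. \<bar>x $ k\<bar> \<le> 2 - \<gamma>}"
    and r0: "0 < r0" "\<And>r. 0 < r \<Longrightarrow> r < r0 \<Longrightarrow> thicken r (cball 0 (2 / lam)) \<subseteq> ball (0 :: real ^ 'd) (\<tau> / 2)"
      "\<And>r. 0 < r \<Longrightarrow> r < r0 \<Longrightarrow> thicken r {x :: real ^ 'd. \<forall>k. \<bar>x $ k\<bar> \<le> 2 - \<gamma>} \<subseteq> {x. \<forall>k. \<bar>x $ k\<bar> < 2}"
  shows "stable_intersection \<alpha>
    (affine_data (M * Suc CARD('d)) (\<lambda>i. \<chi> k. \<tau> * real i) A (ball 0 (\<tau> / 2)) (cball 0 (2 / lam)))
    (affine_data (card (grid n :: (real ^ 'd) set)) e (\<lambda>_. lam *\<^sub>R id_blinfun)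
      {x. \<forall>k. \<bar>x $ k\<bar> < 2} {x. \<forall>k. \<bar>x $ k\<bar> \<le> 2 - \<gamma>})"
    (is "stable_intersection \<alpha> ?K ?K'")
proof -
  let ?N = "M * Suc CARD('d)" and ?N' = "card (grid n :: (real ^ 'd) set)"
  let ?c = "\<lambda>i. (\<chi> k. \<tau> * real i) :: real ^ 'd"
  let ?T = "cball (0 :: real ^ 'd) (2 / lam)" and ?T' = "{x :: real ^ 'd. \<forall>k. \<bar>x $ k\<bar> \<le> 2 - \<gamma>}"
  let ?B = "ball (0 :: real ^ 'd) 1" and ?W = "\<lambda>j. {y. \<forall>k. \<bar>y $ k - e j $ k\<bar> < 2 - \<gamma>}"
  have "0 < lam * \<gamma>" using lam(1) by linarith
  then have lam0: "0 < lam" using \<gamma>(1) by (simp add: zero_less_mult_iff)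
  have "lam * \<gamma> \<le> lam * (1/4)" using \<gamma>(3) lam0 by (intro mult_left_mono) auto
  then have lam20: "20 \<le> lam" using lam(1) by linarith
  \<comment> \<open>The errors in the linear part add up to at most \<open>23 \<lambda> \<eta>\<close>, which the gain \<open>\<theta>/2\<close> has to absorb.\<close>
  define \<eta> where "\<eta> = \<theta> / (46 * lam)"
  have \<eta>: "0 < \<eta>" "46 * lam * \<eta> \<le> \<theta>" using \<theta> lam0 by (auto simp: \<eta>_def)
  have "cantor_set L \<inter> cantor_set L' \<noteq> {}"
    if r: "0 < r" "r < r0" and \<delta>: "0 < \<delta>" "\<delta> \<le> 1/2" "\<delta> < r" "20 * lam * \<delta> \<le> \<eta>"
      and L: "cantor_close \<alpha> r \<delta> ?K L" and L': "cantor_close \<alpha> r \<delta> ?K' L'" for r \<delta> L L'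
  proof -
    note th = r0(2)[OF r] and th' = r0(3)[OF r]
    have "1 * \<delta> \<le> lam * \<delta>" using lam20 \<delta>(1) by (intro mult_right_mono) auto
    then have \<delta>\<eta>: "20 * \<delta> \<le> \<eta>" using \<delta>(4) by linarith
    define branch where "branch i R f F \<longleftrightarrow>
        (\<forall>x. lam *\<^sub>R (blinfun_apply R x + \<theta> *\<^sub>R Y (i div Suc CARD('d)) (blinfun_apply R x)) = x) \<and>
        norm R \<le> 1 / (lam * (1 - \<theta>)) \<and> has_holder_deriv \<alpha> ?B f F \<eta> \<and>
        (\<forall>y\<in>?B. norm (F y - R) \<le> \<eta> \<and> norm (f y - (?c i + blinfun_apply R y)) \<le> \<eta> \<and>
          f y \<in> star_piece r L i \<and> gen L (f y) = y)"
      for i and R :: "(real ^ 'd) \<Rightarrow>\<^sub>L (real ^ 'd)" and f F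
    have "\<exists>R f F. branch i R f F" if i: "i < ?N" for i
    proof -
      have pos: "0 < lam * (1 - \<theta>)" using lam0 \<theta> \<kappa> by simp
      obtain R :: "(real ^ 'd) \<Rightarrow>\<^sub>L (real ^ 'd)" where R: "\<And>x. R (A i x) = x" "\<And>x. A i (R x) = x"
        "norm R \<le> 1 / (lam * (1 - \<theta>))"
        using linear_expanding_invertible[OF pos, of "A i"] expand[OF i] by blast
      have "15 \<le> lam * (1 - \<theta>)" using mult_mono[of 20 lam "3/4" "1 - \<theta>"] lam20 \<theta> \<kappa> by simp
      then have R1: "norm R \<le> 1" using R(3) by (smt (verit) divide_le_eq_1)
      have R2: "norm R \<le> 2 / lam"
      proof -
        have "1 / (lam * (1 - \<theta>)) \<le> 1 / (lam * (1/2))"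
          using lam0 \<theta> \<kappa> by (intro divide_left_mono mult_left_mono mult_pos_pos) auto
        then show ?thesis using R(3) by simp
      qed
      have ball: "cball (R y) \<delta> \<subseteq> open_thicken r ?T" if "y \<in> ?B" for y
      proof
        fix x assume x: "x \<in> cball (R y) \<delta>"
        have "norm (R y) \<le> 2 / lam * 1"
          using mult_mono[OF R2, of "norm y" 1] that lam0 by (intro order_trans[OF norm_blinfun]) auto
        then have "R y \<in> ?T" by simp
        moreover have "norm (x - R y) < r" using x \<delta>(3) by (simp add: dist_norm norm_minus_commute)
        ultimately show "x \<in> open_thicken r ?T" unfolding open_thicken_def by blast
      qed
      obtain f F where f: "has_holder_deriv \<alpha> ?B f F (20 * \<delta>)" "\<And>y. y \<in> ?B \<Longrightarrow> norm (F y - R) \<le> 4 * \<delta>"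
        "\<And>y. y \<in> ?B \<Longrightarrow> norm (f y - (?c i + R y)) \<le> 2 * \<delta>"
        "\<And>y. y \<in> ?B \<Longrightarrow> f y \<in> star_piece r L i" "\<And>y. y \<in> ?B \<Longrightarrow> gen L (f y) = y"
        using perturbed_inverse_branch[OF sys r(1) th L less_imp_le[OF \<delta>(1)] \<delta>(2) less_imp_le[OF \<alpha>(1)]
            less_imp_le[OF \<alpha>(2)] i R(2,1) R1 open_ball convex_ball ball] by blast
      show ?thesis
        unfolding branch_def
      proof (intro exI[of _ R] exI[of _ f] exI[of _ F] conjI allI ballI)
        show "lam *\<^sub>R (R x + \<theta> *\<^sub>R Y (i div Suc CARD('d)) (R x)) = x" for x using R(2)[of x] A[OF i, of "R x"] by simp
        show "has_holder_deriv \<alpha> ?B f F \<eta>" by (rule has_holder_deriv_mono[OF f(1) \<delta>\<eta>])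
        fix y assume y: "y \<in> ?B"
        show "norm (F y - R) \<le> \<eta>" using f(2)[OF y] \<delta>\<eta> \<delta>(1) by linarith
        show "norm (f y - (?c i + R y)) \<le> \<eta>" using f(3)[OF y] \<delta>\<eta> \<delta>(1) by linarith
      qed (use R(3) f(4,5) in auto)
    qed
    then obtain R f F where "\<And>i. i < ?N \<Longrightarrow> branch i (R i) (f i) (F i)" by metis
    then have RfF: "\<And>i x. i < ?N \<Longrightarrow> lam *\<^sub>R (blinfun_apply (R i) x + \<theta> *\<^sub>R Y (i div Suc CARD('d)) (blinfun_apply (R i) x)) = x"
      "\<And>i. i < ?N \<Longrightarrow> norm (R i) \<le> 1 / (lam * (1 - \<theta>))" "\<And>i. i < ?N \<Longrightarrow> has_holder_deriv \<alpha> ?B (f i) (F i) \<eta>"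
      "\<And>i y. i < ?N \<Longrightarrow> y \<in> ?B \<Longrightarrow> norm (F i y - R i) \<le> \<eta>"
      "\<And>i y. i < ?N \<Longrightarrow> y \<in> ?B \<Longrightarrow> norm (f i y - (?c i + blinfun_apply (R i) y)) \<le> \<eta>"
      "\<And>i y. i < ?N \<Longrightarrow> y \<in> ?B \<Longrightarrow> f i y \<in> star_piece r L i" "\<And>i y. i < ?N \<Longrightarrow> y \<in> ?B \<Longrightarrow> gen L (f i y) = y"
      unfolding branch_def by blast+
    define smooth where "smooth j G \<longleftrightarrow> has_holder_deriv \<alpha> (?W j) (gen L') G \<eta> \<and>
        (\<forall>y\<in>?W j. norm (G y - lam *\<^sub>R id_blinfun) \<le> \<eta> \<and>
        norm (gen L' y - lam *\<^sub>R (y - e j)) \<le> \<eta> \<and> y \<in> star_piece r L' j)" for j G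
    have "\<exists>G. smooth j G" if j: "j < ?N'" for j
    proof -
      have nl: "norm (lam *\<^sub>R id_blinfun :: (real ^ 'd) \<Rightarrow>\<^sub>L (real ^ 'd)) \<le> lam" "1 \<le> lam" using lam20 by simp_all
      have ball: "cball (y - e j) \<delta> \<subseteq> open_thicken r ?T'" if "y \<in> ?W j" for y
      proof
        fix x assume x: "x \<in> cball (y - e j) \<delta>"
        have "y - e j \<in> ?T'" using that by (auto intro: less_imp_le)
        moreover have "norm (x - (y - e j)) < r" using x \<delta>(3) by (simp add: dist_norm norm_minus_commute)
        ultimately show "x \<in> open_thicken r ?T'" unfolding open_thicken_def by blast
      qed
      obtain G where G: "has_holder_deriv \<alpha> (?W j) (gen L') G (20 * lam * \<delta>)"
        "\<And>y. y \<in> ?W j \<Longrightarrow> norm (G y - lam *\<^sub>R id_blinfun) \<le> 4 * lam * \<delta>"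
        "\<And>y. y \<in> ?W j \<Longrightarrow> norm (gen L' y - (lam *\<^sub>R id_blinfun) (y - e j)) \<le> 2 * lam * \<delta>"
        "?W j \<subseteq> star_piece r L' j"
        using perturbed_gen_on_piece[OF sys' r(1) th' L' less_imp_le[OF \<delta>(1)] \<delta>(2) less_imp_le[OF \<alpha>(1)]
            less_imp_le[OF \<alpha>(2)] j nl open_cube ball] by blast
      have l\<delta>: "0 < lam * \<delta>" using lam0 \<delta>(1) by simp
      show ?thesis
        unfolding smooth_def
      proof (intro exI[of _ G] conjI ballI)
        show "has_holder_deriv \<alpha> (?W j) (gen L') G \<eta>" by (rule has_holder_deriv_mono[OF G(1) \<delta>(4)])
        fix y assume y: "y \<in> ?W j"
        show "norm (G y - lam *\<^sub>R id_blinfun) \<le> \<eta>" using G(2)[OF y] \<delta>(4) l\<delta> by linarith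
        show "norm (gen L' y - lam *\<^sub>R (y - e j)) \<le> \<eta>"
          using G(3)[OF y] \<delta>(4) l\<delta> by (simp add: scaleR_blinfun.rep_eq)
        show "y \<in> star_piece r L' j" using G(4) y by blast
      qed
    qed
    then obtain G where "\<And>j. j < ?N' \<Longrightarrow> smooth j (G j)" by metis
    then have G: "\<And>j. j < ?N' \<Longrightarrow> has_holder_deriv \<alpha> (?W j) (gen L') (G j) \<eta>"
      "\<And>j y. j < ?N' \<Longrightarrow> y \<in> ?W j \<Longrightarrow> norm (G j y - lam *\<^sub>R id_blinfun) \<le> \<eta>"
      "\<And>j y. j < ?N' \<Longrightarrow> y \<in> ?W j \<Longrightarrow> norm (gen L' y - lam *\<^sub>R (y - e j)) \<le> \<eta>"
      "\<And>j y. j < ?N' \<Longrightarrow> y \<in> ?W j \<Longrightarrow> y \<in> star_piece r L' j"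
      unfolding smooth_def by blast+
    interpret renormalization \<alpha> \<kappa> \<theta> \<tau> \<gamma> lam \<eta> M n Y R f F "{..<?N'}" e "gen L'" G
    proof
      fix z :: "'d \<Rightarrow> int" assume "\<And>k. \<bar>z k\<bar> \<le> int n"
      then have "(\<chi> k. 4 * of_int (z k)) \<in> (grid n :: (real ^ 'd) set)" unfolding grid_def by blast
      then show "\<exists>j\<in>{..<?N'}. e j = (\<chi> k. 4 * of_int (z k))" using e unfolding bij_betw_def by (metis imageE)
    qed (use \<alpha> \<kappa> \<theta> \<gamma> lam \<eta> \<tau> net RfF G in auto)
    obtain x i j where x: "\<And>n. i n < ?N" "\<And>n. j n < ?N'" "\<And>n. (gen L ^^ n) x \<in> f (i n) ` ?B" "\<And>n. (gen L' ^^ n) x \<in> ?W (j n)"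
    proof (rule nested_intersection[where good=near_identity and I="{..<?N}" and J="{..<?N'}" and D="?B" and W="?W" and
          g'="gen L'" and f=f and C="cball 0 (3/4)" and g="gen L"])
      show "near_identity id" by (rule near_identity_id)
      show "\<exists>i\<in>{..<?N}. \<exists>j\<in>{..<?N'}. (\<forall>x\<in>?B. h (f i x) \<in> ?W j) \<and> near_identity (gen L' \<circ> h \<circ> f i)" if "near_identity h" for h
      proof -
        obtain i j where ij: "i < ?N" "j \<in> {..<?N'}" "\<And>x. x \<in> ?B \<Longrightarrow> \<forall>k. \<bar>h (f i x) $ k - e j $ k\<bar> < 2 - \<gamma>"
          "near_identity (gen L' \<circ> h \<circ> f i)" using near_identity_step[OF \<open>near_identity h\<close>] by blast
        have "\<forall>x\<in>?B. h (f i x) \<in> ?W j" using ij(3) by (intro ballI CollectI)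
        then show ?thesis using ij(1,2,4) by blast
      qed
      show "continuous_on ?B (f i)" if "i \<in> {..<?N}" for i
        using RfF(3)[of i] that has_holder_derivD(1)
        by (intro continuous_at_imp_continuous_on ballI has_derivative_continuous) blast
      show "f i ` ?B \<subseteq> cball 0 (3/4)" if "i \<in> {..<?N}" for i using f_into that by blast
      show "gen L (f i y) = y" if "i \<in> {..<?N}" "y \<in> ?B" for i y using RfF(7) that by blast
    qed (use that in auto)
    have "x \<in> cantor_set L"
    proof (rule cantor_close_orbit[OF sys r(1) th L \<delta>(2) x(1)])
      show "(gen L ^^ n) x \<in> star_piece r L (i n)" for n
      proof -
        obtain y where "y \<in> ?B" "(gen L ^^ n) x = f (i n) y" using x(3)[of n] by (rule imageE)
        then show ?thesis using RfF(6)[OF x(1)] by simp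
      qed
    qed
    moreover have "x \<in> cantor_set L'"
    proof (rule cantor_close_orbit[OF sys' r(1) th' L' \<delta>(2) x(2)])
      show "(gen L' ^^ n) x \<in> star_piece r L' (j n)" for n by (rule G(4)[OF x(2,4)])
    qed
    ultimately show ?thesis by blast
  qed
  note inter = this
  have "\<exists>\<delta>>0. \<forall>L L'. cantor_close \<alpha> r \<delta> ?K L \<and> cantor_close \<alpha> r \<delta> ?K' L' \<longrightarrow> cantor_set L \<inter> cantor_set L' \<noteq> {}"
    if r: "0 < r" "r < r0" for r
  proof -
    define \<delta> where "\<delta> = min (1/2) (min (r / 2) (\<eta> / (20 * lam)))"
    have "0 < \<delta>" "\<delta> \<le> 1/2" "\<delta> < r" using r \<eta> lam0 by (auto simp: \<delta>_def min_less_iff_disj)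
    moreover have "\<delta> \<le> \<eta> / (20 * lam)" by (simp add: \<delta>_def)
    then have "20 * lam * \<delta> \<le> \<eta>" using lam0 by (simp add: field_simps)
    ultimately show ?thesis using inter[OF r, of \<delta>] by blast
  qed
  then show ?thesis
    unfolding stable_intersection_def eventually_at_right_field using r0(1) by (intro exI[of _ r0]) auto
qed

text \<open>The order in which the constants are chosen is essential: first the net and with it the number of
  pieces of \<open>K\<close>, then the width of the gaps of \<open>K'\<close>, then the expansion factor, which makes the
  dimension small, and last the size \<open>\<theta>\<close> of the corrections, which makes \<open>K\<close> close to homothetical.\<close>

lemma affine_pair:
  fixes \<alpha> \<epsilon> \<delta> :: real
  assumes \<alpha>: "0 < \<alpha>" "\<alpha> < 1" and "0 < \<epsilon>" "0 < \<delta>"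
  shows "\<exists>K K' :: (real ^ 'd) cantor_data.
            regular_cantor \<alpha> K \<and> regular_cantor \<alpha> K' \<and>
            stable_intersection \<alpha> K K' \<and> hausdorff_dim (cantor_set K) < ereal \<epsilon> \<and>
            affine_cantor K \<and> affine_cantor K' \<and>
            (\<forall>L\<in>{K, K'}. \<exists>C. regular_cantor \<alpha> C \<and> conformal_cantor C \<and> homothetical_cantor C \<and>
               (\<forall>\<^sub>F r in at_right 0. cantor_close \<alpha> r \<delta> C L))"
proof -
  obtain M and Y :: "nat \<Rightarrow> (real ^ 'd) \<Rightarrow>\<^sub>L (real ^ 'd)"
    where Y: "\<And>m. m < M \<Longrightarrow> norm (Y m) \<le> 1" "\<And>X. norm X \<le> 1 \<Longrightarrow> \<exists>m<M. norm (X - Y m) \<le> 1/4" "0 < M"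
    using finite_net_of_linear_maps by blast
  define d where "d = CARD('d)"
  have d: "1 \<le> d" unfolding d_def by (simp add: Suc_leI)
  define N where "N = M * Suc d"
  have "1 * 2 \<le> M * Suc d" using Y(3) d by (intro mult_mono) auto
  then have N: "2 \<le> N" by (simp add: N_def)
  \<comment> \<open>In \<open>near_identity_step\<close> a vector along the diagonal is \<open>d\<close> times as long as its coordinates at most,
    so \<open>\<kappa> d \<le> 1/2\<close> keeps the coordinates of the placed centres apart.\<close>
  define \<kappa> where "\<kappa> = 1 / (4 * real d)"
  have \<kappa>: "0 < \<kappa>" "\<kappa> \<le> 1/4" "\<kappa> * d \<le> 1/2" using d by (auto simp: \<kappa>_def field_simps)
  define \<tau> where "\<tau> = 1 / (2 * real d * real N)"
  have dN: "1 * 2 \<le> real d * real N" using d N by (intro mult_mono) auto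
  have \<tau>: "0 < \<tau>" "\<tau> * d * N \<le> 1/2" "\<tau> \<le> 1/4" using d N dN by (auto simp: \<tau>_def field_simps)
  define \<gamma> where "\<gamma> = \<tau> / 24"
  have \<gamma>: "0 < \<gamma>" "24 * \<gamma> \<le> \<tau>" "\<gamma> \<le> 1/4" "\<gamma> < 2" using \<tau> by (auto simp: \<gamma>_def)
  obtain n :: nat where n: "1 \<le> n" "5 \<le> (4 * real n + 2) / (2 - \<gamma>) * \<gamma>"
    "(2 / ((4 * real n + 2) / (2 - \<gamma>))) powr \<alpha> \<le> 1/8" "real N * (2 / ((4 * real n + 2) / (2 - \<gamma>))) powr (\<epsilon> / 2) < 1"
    using eventually_expansion_large[of \<alpha> "\<epsilon> / 2" \<gamma> "real N"] \<alpha> \<open>0 < \<epsilon>\<close> \<gamma> by auto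
  define lam where "lam = (4 * real n + 2) / (2 - \<gamma>)"
  have lam: "5 \<le> lam * \<gamma>" "(2 / lam) powr \<alpha> \<le> 1/8" "real N * (2 / lam) powr (\<epsilon> / 2) < 1"
    "lam * (2 - \<gamma>) = 4 * real n + 2"
    using n(2-4) \<gamma> unfolding lam_def by simp_all
  have lam0: "0 < lam" using n \<gamma> by (simp add: lam_def)
  have "lam * \<gamma> \<le> lam * (1/4)" using \<gamma>(3) lam0 by (intro mult_left_mono) auto
  then have lam20: "20 \<le> lam" using lam(1) by linarith
  have lam\<tau>: "120 \<le> lam * \<tau>" using lam(1) by (simp add: \<gamma>_def)
  have q1: "1 < 2 powr \<alpha>" using \<alpha> by simp
  \<comment> \<open>The three bounds serve the linear correction, closeness to the homothetical system, and bunching.\<close>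
  define \<theta> where "\<theta> = min \<kappa> (min (\<delta> / lam) ((2 powr \<alpha> - 1) / 4))"
  have \<theta>0: "0 < \<theta>" using \<kappa> \<open>0 < \<delta>\<close> lam0 q1 by (simp add: \<theta>_def)
  have "\<theta> \<le> (2 powr \<alpha> - 1) / 4" unfolding \<theta>_def by (intro min.coboundedI2 order_refl)
  then have \<theta>: "\<theta> \<le> \<kappa>" "\<theta> \<le> \<delta> / lam" "4 * \<theta> \<le> 2 powr \<alpha> - 1"
    by (simp_all add: \<theta>_def)
  have lam\<theta>: "lam * \<theta> \<le> \<delta>" using \<theta>(2) lam0 by (simp add: field_simps)
  define A where "A i = lam *\<^sub>R (id_blinfun + \<theta> *\<^sub>R Y (i div Suc d))" for i
  have A: "A i x = lam *\<^sub>R (x + \<theta> *\<^sub>R Y (i div Suc d) x)" for i x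
    by (simp add: A_def blinfun.bilinear_simps)
  have Yi: "norm (Y (i div Suc d)) \<le> 1" if "i < N" for i
    using that by (intro Y(1)) (simp add: N_def less_mult_imp_div_less)
  have expand: "lam * (1 - \<theta>) * norm x \<le> norm (A i x)" if "i < N" for i x
  proof -
    have "norm (\<theta> *\<^sub>R Y (i div Suc d) x) \<le> \<theta> * (1 * norm x)"
      using Yi[OF that] \<theta>0 unfolding norm_scaleR
      by (intro mult_mono order_trans[OF norm_blinfun]) (auto intro: mult_right_mono)
    then have "(1 - \<theta>) * norm x \<le> norm (x + \<theta> *\<^sub>R Y (i div Suc d) x)"
      using norm_diff_ineq[of x "\<theta> *\<^sub>R Y (i div Suc d) x"] by (simp add: algebra_simps)
    then show ?thesis unfolding A using lam0 by (simp add: mult_left_mono mult.assoc)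
  qed
  have near: "norm (A i - lam *\<^sub>R id_blinfun) \<le> lam * \<theta>" if "i < N" for i
  proof -
    have "A i - lam *\<^sub>R id_blinfun = (lam * \<theta>) *\<^sub>R Y (i div Suc d)" by (simp add: A_def algebra_simps)
    then show ?thesis using Yi[OF that] lam0 \<theta>0 by (simp add: mult_left_le)
  qed
  let ?c = "\<lambda>i. (\<chi> k. \<tau> * real i) :: real ^ 'd" and ?V = "ball (0 :: real ^ 'd) (\<tau> / 2)" and ?T = "cball (0 :: real ^ 'd) (2 / lam)"
  let ?A0 = "\<lambda>_::nat. lam *\<^sub>R id_blinfun :: (real ^ 'd) \<Rightarrow>\<^sub>L (real ^ 'd)"
  have half: "3/4 \<le> 1 - \<theta>" using \<theta> \<kappa> by linarith
  have sys: "affine_system N ?c A ?V ?T"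
  proof (rule diagonal_affine_system[OF N \<tau>(1) _ lam20 lam\<tau>])
    show "\<tau> * CARD('d) * real N \<le> 1/2" using \<tau>(2) by (simp add: d_def)
    show "3/4 * lam * norm x \<le> norm (A i x)" if "i < N" for i x
    proof -
      have "3/4 * lam \<le> lam * (1 - \<theta>)" using mult_right_mono[OF half, of lam] lam0 by (simp add: mult_ac)
      then have "3/4 * lam * norm x \<le> lam * (1 - \<theta>) * norm x" by (intro mult_right_mono) auto
      then show ?thesis using expand[OF that, of x] by linarith
    qed
  qed
  have sys0: "affine_system N ?c ?A0 ?V ?T"
  proof (rule diagonal_affine_system[OF N \<tau>(1) _ lam20 lam\<tau>])
    show "\<tau> * CARD('d) * real N \<le> 1/2" using \<tau>(2) by (simp add: d_def)
    show "3/4 * lam * norm x \<le> norm (?A0 i x)" if "i < N" for i x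
      using lam0 by (simp add: scaleR_blinfun.rep_eq)
  qed
  obtain e :: "nat \<Rightarrow> real ^ 'd" where e: "bij_betw e {..<card (grid n :: (real ^ 'd) set)} (grid n)"
    using ex_bij_betw_nat_finite[of "grid n :: (real ^ 'd) set"] finite_grid unfolding atLeast0LessThan by blast
  let ?V' = "{x :: real ^ 'd. \<forall>k. \<bar>x $ k\<bar> < 2}" and ?T' = "{x :: real ^ 'd. \<forall>k. \<bar>x $ k\<bar> \<le> 2 - \<gamma>}"
  let ?N' = "card (grid n :: (real ^ 'd) set)"
  have sys': "affine_system ?N' e ?A0 ?V' ?T'"
    by (rule grid_affine_system[OF e n(1) \<gamma>(1,3) lam20 lam(4)])
  \<comment> \<open>Up to this radius the neighbourhoods of the pieces remain in the translates of \<open>V\<close>.\<close>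
  define r0 where "r0 = min (\<tau> / 4) \<gamma>"
  have r0: "0 < r0" using \<tau> \<gamma> by (simp add: r0_def)
  have th: "thicken r ?T \<subseteq> ?V" if "r < r0" for r
  proof (rule thicken_cball_subset)
    have "2 / lam \<le> \<tau> / 60" using lam\<tau> lam0 by (simp add: field_simps)
    then show "2 / lam + r < \<tau> / 2" using that \<tau>(1) by (simp add: r0_def)
  qed
  have th': "thicken r ?T' \<subseteq> ?V'" if "r < r0" for r
    by (rule thicken_cube_subset) (use that in \<open>simp add: r0_def\<close>)
  let ?K = "affine_data N ?c A ?V ?T" and ?K' = "affine_data ?N' e ?A0 ?V' ?T'" and ?C = "affine_data N ?c ?A0 ?V ?T"
  have stable: "stable_intersection \<alpha> ?K ?K'"
    unfolding N_def d_def
  proof (rule diagonal_grid_stable_intersection[OF \<alpha> \<kappa>(1,2) _ \<theta>0 \<theta>(1) \<gamma>(1-3) lam(1,2,4) _ Y(2) n(1) e _ _ _ sys' r0 th th'])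
    show "\<kappa> * CARD('d) \<le> 1/2" using \<kappa>(3) by (simp add: d_def)
    show "\<tau> * CARD('d) * (M * Suc CARD('d)) \<le> 1/2" using \<tau>(2) by (simp only: N_def d_def)
    show "A i x = lam *\<^sub>R (x + \<theta> *\<^sub>R Y (i div Suc CARD('d)) x)" for i x using A by (simp only: d_def)
    show "lam * (1 - \<theta>) * norm x \<le> norm (A i x)" if "i < M * Suc CARD('d)" for i x
      using expand[of i x] that by (simp only: N_def d_def)
    show "affine_system (M * Suc CARD('d)) ?c A ?V ?T" using sys by (simp only: N_def d_def)
  qed
  have dim: "hausdorff_dim (cantor_set ?K) < ereal \<epsilon>"
  proof (rule hausdorff_dim_affine_data_less[OF sys, where q="2 / lam" and s="\<epsilon> / 2"])
    show "norm x \<le> 2 / lam * norm (A i x)" if "i < N" for i x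
    proof -
      have "lam * (1/2) * norm x \<le> lam * (1 - \<theta>) * norm x" using half lam0 by (intro mult_right_mono mult_left_mono) auto
      then have "lam * (1/2) * norm x \<le> norm (A i x)" using expand[OF that, of x] by linarith
      then show ?thesis using lam0 by (simp add: field_simps)
    qed
  qed (use lam lam20 \<open>0 < \<epsilon>\<close> in auto)
  have bunch: "bunched_cantor \<alpha> ?K"
  proof (rule bunched_affine_dataI[OF sys, where a="lam * (1 - \<theta>)" and b="lam * (1 + \<theta>)"])
    show "norm (A i) \<le> lam * (1 + \<theta>)" if "i < N" for i
      using norm_triangle_sub[of "A i" "lam *\<^sub>R id_blinfun"] near[OF that] lam0 by (simp add: algebra_simps)
    have "\<theta> * 2 powr \<alpha> \<le> \<theta> * 2" using powr_2_le[of \<alpha>] \<alpha> \<theta>0 by (intro mult_left_mono) auto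
    moreover have "(1 - \<theta>) * 2 powr \<alpha> = 2 powr \<alpha> - \<theta> * 2 powr \<alpha>" by (simp add: algebra_simps)
    ultimately have "1 + \<theta> < (1 - \<theta>) * 2 powr \<alpha>" using \<theta>(3) \<theta>0 by linarith
    then show "lam * (1 + \<theta>) < lam * (1 - \<theta>) * 2 powr \<alpha>" using lam0 by (simp add: mult.assoc)
  qed (use expand lam0 half in auto)
  have bunch': "bunched_cantor \<alpha> ?K'"
    by (rule bunched_affine_dataI[OF sys', where a=lam and b=lam])
      (use lam0 q1 in \<open>auto simp: scaleR_blinfun.rep_eq\<close>)
  have close: "cantor_close \<alpha> r \<delta> ?C ?K" if r: "0 < r" "r < r0" for r
  proof (rule cantor_close_affine_data[OF sys0 sys r(1) th[OF r(2)] bunch])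
    show *: "norm (A i - ?A0 i) \<le> \<delta>" if "i < N" for i using near[OF that] lam\<theta> by linarith
    show "norm (A i x - ?A0 i x) \<le> \<delta>" if i: "i < N" and "x \<in> open_thicken r ?T" for i x
    proof -
      have "x \<in> ?V" using that(2) th[OF r(2)] open_thicken_subset by blast
      then have "norm x \<le> 1" using \<tau>(3) by simp
      then have "norm ((A i - ?A0 i) x) \<le> \<delta> * 1"
        using *[OF i] \<open>0 < \<delta>\<close> by (intro order_trans[OF norm_blinfun] mult_mono) auto
      then show ?thesis by (simp add: blinfun.diff_left)
    qed
  qed (use \<open>0 < \<delta>\<close> in auto)
  have close': "cantor_close \<alpha> r \<delta> ?K' ?K'" if r: "0 < r" "r < r0" for r
    using cantor_close_affine_data[OF sys' sys' r(1) th'[OF r(2)] bunch', of \<delta>] \<open>0 < \<delta>\<close> by simp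
  have ev: "\<forall>\<^sub>F r in at_right 0. cantor_close \<alpha> r \<delta> ?C ?K" "\<forall>\<^sub>F r in at_right 0. cantor_close \<alpha> r \<delta> ?K' ?K'"
    unfolding eventually_at_right_field using r0 close close' by (auto intro!: exI[of _ r0])
  have "\<forall>L\<in>{?K, ?K'}. \<exists>C. regular_cantor \<alpha> C \<and> conformal_cantor C \<and> homothetical_cantor C \<and>
      (\<forall>\<^sub>F r in at_right 0. cantor_close \<alpha> r \<delta> C L)"
    using ev regular_cantor_affine_data[OF sys0] regular_cantor_affine_data[OF sys']
      homothetical_affine_data[OF sys0 lam0] homothetical_affine_data[OF sys' lam0] by blast
  then show ?thesis
    using stable dim regular_cantor_affine_data[OF sys] regular_cantor_affine_data[OF sys']
      affine_cantor_affine_data[OF sys] affine_cantor_affine_data[OF sys'] by blast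
qed

theorem theorem1:
  fixes \<alpha> \<epsilon> :: real
  assumes "0 < \<alpha>" and "\<alpha> < 1" and "0 < \<epsilon>"
  shows "(\<exists>K K' :: (real ^ 'd) cantor_data.
            regular_cantor \<alpha> K \<and> regular_cantor \<alpha> K' \<and>
            stable_intersection \<alpha> K K' \<and> hausdorff_dim (cantor_set K) < ereal \<epsilon>) \<and>
         (\<forall>\<delta>>0. \<exists>K K' :: (real ^ 'd) cantor_data.
            regular_cantor \<alpha> K \<and> regular_cantor \<alpha> K' \<and>
            stable_intersection \<alpha> K K' \<and> hausdorff_dim (cantor_set K) < ereal \<epsilon> \<and>
            affine_cantor K \<and> affine_cantor K' \<and>
            (\<forall>L\<in>{K, K'}. \<exists>C. regular_cantor \<alpha> C \<and> conformal_cantor C \<and> homothetical_cantor C \<and>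
               (\<forall>\<^sub>F r in at_right 0. cantor_close \<alpha> r \<delta> C L)))"
proof
  show "\<exists>K K' :: (real ^ 'd) cantor_data.
            regular_cantor \<alpha> K \<and> regular_cantor \<alpha> K' \<and>
            stable_intersection \<alpha> K K' \<and> hausdorff_dim (cantor_set K) < ereal \<epsilon>"
    using affine_pair[OF assms zero_less_one, where 'd='d] by blast
qed (use affine_pair[OF assms] in blast)

end
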